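(* Let $p$ be a prime, $C_p$ the cyclic group of order $p$, and $R=\mathbb{Z}C_p$. For every $R$-module $M$, the $R$-module $N_M$ can be decomposed as a direct sum of finitely generated projective $R$-modules and a trivial $R$-module.
   Context: Let $\alpha$ denote a fixed generator of $C_p$. A module is trivial if $\alpha$ acts on it as the identity. For an $R$-module $M$, $\mathbb{Z}M$ is the free abelian group with canonical basis $\{\widehat{x} : x\in M\}$, made into an $R$-module by $\alpha\cdot\sum_{x\in M}c_x\widehat{x}=\sum_{x\in M}c_x\widehat{\alpha x}$. The map $\pi_M:\mathbb{Z}M\to M$, $\pi_M(\sum_{x\in M}c_x\widehat{x})=\sum_{x\in M}c_x x$, is a surjective $R$-module map, and $N_M=\ker\pi_M$. *)

theory Defs
  imports "HOL-Algebra.Algebra"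
begin

section \<open>Integral group rings\<close>

text \<open>
  Elements of the free abelian group on a set \<open>S\<close> are the finitely supported functions
  \<^typ>\<open>'a \<Rightarrow>\<^sub>0 int\<close> whose keys lie in \<open>S\<close>, as in \<^const>\<open>free_Abelian_group\<close>; the basis element
  at \<open>x\<close> is \<^term>\<open>frag_of x\<close>, and \<^term>\<open>frag_extend f\<close> is the additive map with
  \<^term>\<open>frag_of x\<close> sent to \<^term>\<open>f x\<close>.
\<close>

definition group_ring :: "('c, 'z) monoid_scheme \<Rightarrow> ('c \<Rightarrow>\<^sub>0 int) ring"
  where "group_ring G =
    \<lparr>carrier = {a. Poly_Mapping.keys a \<subseteq> carrier G},
     monoid.mult = (\<lambda>a b. frag_extend (\<lambda>g. frag_extend (\<lambda>h. frag_of (g \<otimes>\<^bsub>G\<^esub> h)) b) a),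
     one = frag_of \<one>\<^bsub>G\<^esub>,
     ring.zero = 0,
     ring.add = (+)\<rparr>"


section \<open>Modules\<close>

definition module_iso ::
  "('r, 'x) ring_scheme \<Rightarrow> ('r, 'a, 'y) module_scheme \<Rightarrow> ('r, 'b, 'z) module_scheme \<Rightarrow> ('a \<Rightarrow> 'b) set"
  where "module_iso R M N =
    {f \<in> iso (add_monoid M) (add_monoid N).
       \<forall>r\<in>carrier R. \<forall>x\<in>carrier M. f (r \<odot>\<^bsub>M\<^esub> x) = r \<odot>\<^bsub>N\<^esub> f x}"

text \<open>
  The module \<open>M\<close> is the internal direct sum of the submodules \<open>F i\<close> with \<open>i \<in> I\<close>: the summation map
  from the external direct sum is bijective. The index set may be infinite, as
  \<^const>\<open>sum_group\<close> consists of the finitely supported families.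
\<close>

definition internal_direct_sum ::
  "('r, 'x) ring_scheme \<Rightarrow> ('r, 'a, 'y) module_scheme \<Rightarrow> 'i set \<Rightarrow> ('i \<Rightarrow> 'a set) \<Rightarrow> bool"
  where "internal_direct_sum R M I F \<longleftrightarrow>
    (\<forall>i\<in>I. submodule (F i) R M) \<and>
    (\<lambda>x. gfinprod (add_monoid M) x I)
      \<in> iso (sum_group I (\<lambda>i. add_monoid (M\<lparr>carrier := F i\<rparr>))) (add_monoid M)"

definition finitely_generated_module ::
  "('r, 'x) ring_scheme \<Rightarrow> ('r, 'a, 'y) module_scheme \<Rightarrow> bool"
  where "finitely_generated_module R M \<longleftrightarrow>
    (\<exists>S. finite S \<and> S \<subseteq> carrier M \<and> (\<lambda>H. submodule H R M) hull S = carrier M)"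

text \<open>
  The free module on \<open>B\<close>, i.e. the direct sum of copies of \<open>R\<close> indexed by \<open>B\<close>. The record type
  of modules extends that of rings; its fields \<open>mult\<close> and \<open>one\<close> play no role in modules.
\<close>

definition free_module :: "('r, 'x) ring_scheme \<Rightarrow> 'b set \<Rightarrow> ('r, 'b \<Rightarrow> 'r) module"
  where "free_module R B =
    \<lparr>carrier = carrier (sum_group B (\<lambda>_. add_monoid R)),
     monoid.mult = undefined,
     one = undefined,
     ring.zero = (\<lambda>i\<in>B. \<zero>\<^bsub>R\<^esub>),
     ring.add = (\<lambda>f g. \<lambda>i\<in>B. f i \<oplus>\<^bsub>R\<^esub> g i),
     smult = (\<lambda>r f. \<lambda>i\<in>B. r \<otimes>\<^bsub>R\<^esub> f i)\<rparr>"

text \<open>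
  Projective means isomorphic to a direct summand of a free module. The basis of that free module
  may be taken in the type of elements of the module, since a projective module is a direct
  summand of the free module on its own underlying set.
\<close>

definition projective_module ::
  "('r, 'x) ring_scheme \<Rightarrow> ('r, 'a, 'y) module_scheme \<Rightarrow> bool"
  where "projective_module R P \<longleftrightarrow> module R P \<and>
    (\<exists>(B :: 'a set) H K.
       internal_direct_sum R (free_module R B) UNIV (\<lambda>b. if b then H else K) \<and>
       module_iso R P ((free_module R B)\<lparr>carrier := H\<rparr>) \<noteq> {})"


section \<open>The modules \<open>\<int>M\<close> and \<open>N\<^sub>M\<close>\<close>

definition trivial_module ::
  "'c \<Rightarrow> ('c \<Rightarrow>\<^sub>0 int, 'a, 'z) module_scheme \<Rightarrow> bool"
  where "trivial_module \<alpha> M \<longleftrightarrow> (\<forall>x\<in>carrier M. frag_of \<alpha> \<odot>\<^bsub>M\<^esub> x = x)"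

text \<open>
  Scalar multiplication is the \<open>\<int>\<close>-linear extension of the action of the group elements,
  where \<open>g\<close> sends the basis element at \<open>x\<close> to the basis element at \<open>g x\<close>.
\<close>

definition int_free_module ::
  "('c \<Rightarrow>\<^sub>0 int, 'a, 'z) module_scheme \<Rightarrow> ('c \<Rightarrow>\<^sub>0 int, 'a \<Rightarrow>\<^sub>0 int) module"
  where "int_free_module M =
    \<lparr>carrier = {c. Poly_Mapping.keys c \<subseteq> carrier M},
     monoid.mult = undefined,
     one = undefined,
     ring.zero = 0,
     ring.add = (+),
     smult = (\<lambda>r c. frag_extend (\<lambda>g. frag_extend (\<lambda>x. frag_of (frag_of g \<odot>\<^bsub>M\<^esub> x)) c) r)\<rparr>"

definition eval_map :: "('c \<Rightarrow>\<^sub>0 int, 'a, 'z) module_scheme \<Rightarrow> ('a \<Rightarrow>\<^sub>0 int) \<Rightarrow> 'a"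
  where "eval_map M c =
    (\<Oplus>\<^bsub>M\<^esub>x\<in>Poly_Mapping.keys c. [Poly_Mapping.lookup c x] \<cdot>\<^bsub>M\<^esub> x)"

definition kernel_module ::
  "('c \<Rightarrow>\<^sub>0 int, 'a, 'z) module_scheme \<Rightarrow> ('c \<Rightarrow>\<^sub>0 int, 'a \<Rightarrow>\<^sub>0 int) module"
  where "kernel_module M =
    (int_free_module M)\<lparr>carrier := a_kernel (int_free_module M) M (eval_map M)\<rparr>"

end

theory Submission
  imports "HOL-Computational_Algebra.Polynomial" "HOL-Number_Theory.Cong" Defs
begin

text \<open>
  Write \<open>\<lambda> = \<alpha> - 1\<close> and \<open>N = 1 + \<alpha> + \<dots> + \<alpha>\<^sup>p\<^sup>-\<^sup>1\<close>, and let \<open>L = N\<^sub>M\<close>, a submodule of the permutation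
  module \<open>\<int>M\<close>. Since the permutation module has vanishing first cohomology and every fixed point \<open>m\<close> of
  \<open>M\<close> is the image of the fixed element at \<open>m\<close>, the first cohomology of \<open>L\<close> vanishes: if \<open>N l = 0\<close>
  with \<open>l \<in> L\<close>, then \<open>l \<in> \<lambda>L\<close>. The decomposition holds for every \<open>\<alpha>\<close>-stable subgroup \<open>L\<close> of a
  permutation module with this property; the module \<open>M\<close> plays no further role.

  Well-order the free orbits and let \<open>Lle x\<close> consist of the elements of \<open>L\<close> that are constant on all
  orbits beyond that of \<open>x\<close>; in \<open>Llt x\<close> they are constant on the orbit of \<open>x\<close> as well.
  Restriction to the orbit identifies \<open>Lle x / Llt x\<close> with the image of an ideal of \<open>\<int>C\<^sub>p\<close> in the quotient
  \<open>\<int>C\<^sub>p / (N)\<close>. After division by a power of \<open>\<lambda>\<close>, which is not a zero divisor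
  there, that ideal becomes an ideal \<open>K\<close> of \<open>\<int>C\<^sub>p\<close> that contains \<open>N\<close> and an element of augmentation 1
  (lemma \<open>ideal_lam_saturation\<close>). Such a \<open>K\<close> is projective (lemma \<open>dual_basis_ZO\<close>):
  it contains \<open>1 - p t\<close> for some \<open>t\<close>, because \<open>\<lambda>\<^sup>p\<close> is divisible by \<open>p\<close>; multiplication by \<open>1 - p t\<close>
  maps the whole ring to \<open>K\<close>, multiplication by \<open>p\<close> on \<open>K\<close> factors through a free module by averaging a
  \<open>\<int>\<close>-basis, and a combination of these two maps is the identity of \<open>K\<close>. This replaces the
  arithmetic of the Dedekind ring \<open>\<int>[\<zeta>\<^sub>p]\<close>.

  By projectivity the isomorphism of \<open>K / (N)\<close> with \<open>Lle x / Llt x\<close> lifts to a map from \<open>K\<close> to \<open>Lle x\<close>. When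
  it does not kill \<open>N\<close>, it is injective, its image \<open>P\<^sub>x\<close> satisfies \<open>Lle x = P\<^sub>x + Llt x\<close>, and \<open>P\<^sub>x \<inter> Llt x\<close> is
  generated by one fixed element \<open>N l\<close>. It remains to choose these maps so that the fixed elements
  obtained from all \<open>x\<close> extend to a basis of the subgroup \<open>L\<^sub>0\<close> of fixed elements of \<open>L\<close>. Well-order \<open>M\<close> and
  compare leading terms. Among all \<open>l\<close> that generate \<open>Lle x\<close> modulo \<open>Llt x\<close> and \<open>\<lambda>\<close>-multiples, take
  one for which the leading position of \<open>N l\<close> is least; vanishing cohomology gives \<open>N l \<noteq> 0\<close>, and
  minimality forces the leading coefficient to be an integer prime to \<open>p\<close> times the generator of the
  leading coefficients of \<open>L\<^sub>0\<close> at that position. Multiplying by cyclotomic units and adding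
  elements of \<open>p L\<^sub>0\<close> (lemma \<open>orbit_step\<close>) turns it into that generator. By minimality different \<open>x\<close>
  have different leading positions, so triangularity shows that \<open>L\<close> is the direct sum of the \<open>P\<^sub>x\<close> and of
  the trivial module \<open>T\<close> spanned by fixed elements at the unused leading positions (theorem
  \<open>direct_decomposition_exists\<close>).
\<close>

section \<open>Preliminaries on abelian groups and primes\<close>

lemma additive_diff:
  fixes f :: "'a::ab_group_add \<Rightarrow> 'b::ab_group_add"
  assumes "\<And>x y. x \<in> S \<Longrightarrow> y \<in> S \<Longrightarrow> f (x + y) = f x + f y"
    and "x \<in> S" "y \<in> S" "x - y \<in> S"
  shows "f (x - y) = f x - f y"
  using assms(1)[of "x - y" y] assms(2-4) by simp

lemma int_subgroup_generator:
  fixes S :: "int set"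
  assumes "0 \<in> S" and diff: "\<And>x y. x \<in> S \<Longrightarrow> y \<in> S \<Longrightarrow> x - y \<in> S"
  obtains g where "g \<in> S" "\<And>x. x \<in> S \<Longrightarrow> g dvd x"
proof (cases "S \<subseteq> {0}")
  case True
  then show ?thesis using that[of 0] assms by auto
next
  case False
  have minus: "- x \<in> S" if "x \<in> S" for x using diff[OF assms(1) that] by simp
  have add: "x + y \<in> S" if "x \<in> S" "y \<in> S" for x y using diff[OF that(1) minus[OF that(2)]] by simp
  have mult: "k * x \<in> S" if "x \<in> S" for k x
    by (induction k rule: int_induct[where k = 0])
      (use that assms in \<open>auto simp: left_diff_distrib distrib_right intro: add diff\<close>)
  from False obtain x where x: "x \<in> S" "x \<noteq> 0" by auto
  let ?P = "\<lambda>n::nat. n > 0 \<and> int n \<in> S"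
  have "?P (nat \<bar>x\<bar>)" using x minus[of x] by (auto simp: abs_if)
  then have P: "?P (LEAST n. ?P n)" by (rule LeastI)
  define g where "g = (LEAST n. ?P n)"
  have "int g dvd y" if "y \<in> S" for y
  proof -
    have "y - (y div int g) * int g \<in> S" using diff mult that P by (auto simp: g_def)
    then have "int (nat (y mod int g)) \<in> S" using P by (simp add: g_def minus_div_mult_eq_mod)
    moreover have "nat (y mod int g) < g" using P by (simp add: g_def nat_less_iff)
    ultimately have "nat (y mod int g) = 0"
      using not_less_Least[of "nat (y mod int g)" ?P] by (auto simp: g_def)
    moreover have "y mod int g \<ge> 0" using P by (simp add: g_def)
    ultimately show ?thesis by (simp add: dvd_eq_mod_eq_0)
  qed
  then show ?thesis using that P by (auto simp: g_def)
qed

text \<open>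
  Generators \<open>a\<^sub>i\<close> of a subgroup \<open>G\<close> with additive functionals \<open>\<chi>\<^sub>i\<close> that express every element of \<open>G\<close>
  in terms of them. Uniqueness of the expression is not required.
\<close>

definition coordinates ::
  "('m \<Rightarrow>\<^sub>0 int) set \<Rightarrow> nat \<Rightarrow> (nat \<Rightarrow> 'm \<Rightarrow>\<^sub>0 int) \<Rightarrow> (nat \<Rightarrow> ('m \<Rightarrow>\<^sub>0 int) \<Rightarrow> int) \<Rightarrow> bool"
  where "coordinates G n a \<chi> \<longleftrightarrow>
    (\<forall>i<n. a i \<in> G \<and> (\<forall>x\<in>G. \<forall>y\<in>G. \<chi> i (x + y) = \<chi> i x + \<chi> i y)) \<and>
    (\<forall>x\<in>G. x = (\<Sum>i<n. frag_cmul (\<chi> i x) (a i)))"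

lemma finite_rank_basis:
  fixes G :: "('m \<Rightarrow>\<^sub>0 int) set"
  assumes "finite F" and "0 \<in> G" and "\<And>x y. x \<in> G \<Longrightarrow> y \<in> G \<Longrightarrow> x - y \<in> G"
    and "\<And>c. c \<in> G \<Longrightarrow> Poly_Mapping.keys c \<subseteq> F"
  shows "\<exists>n a \<chi>. coordinates G n a \<chi>"
  using assms
proof (induction F arbitrary: G rule: finite_induct)
  case empty
  then show ?case by (intro exI[of _ 0]) (auto simp: coordinates_def keys_eq_empty[symmetric] simp del: keys_eq_empty)
next
  case (insert y F)
  note diff = insert.prems(2)
  have minus: "- x \<in> G" if "x \<in> G" for x using diff[OF insert.prems(1) that] by simp
  have add: "x + z \<in> G" if "x \<in> G" "z \<in> G" for x z using diff[OF that(1) minus[OF that(2)]] by simp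
  have cm: "frag_cmul k x \<in> G" if "x \<in> G" for k x
    by (rule frag_closure_minus_cmul[where P = "\<lambda>x. x \<in> G"]) (use insert.prems that in auto)
  define G' where "G' = {c \<in> G. Poly_Mapping.lookup c y = 0}"
  have "\<exists>n a \<chi>. coordinates G' n a \<chi>"
  proof (rule insert.IH)
    fix c assume "c \<in> G'"
    then show "Poly_Mapping.keys c \<subseteq> F"
      using insert.prems(3)[of c] by (auto simp: G'_def in_keys_iff)
  qed (use insert.prems in \<open>auto simp: G'_def lookup_minus\<close>)
  then obtain n a \<chi> where ih: "coordinates G' n a \<chi>" by auto
  note ih = ih[unfolded coordinates_def, THEN conjunct1] ih[unfolded coordinates_def, THEN conjunct2]
  let ?S = "(\<lambda>c. Poly_Mapping.lookup c y) ` G"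
  have "0 \<in> ?S"
    using insert.prems(1) by (intro image_eqI[of _ _ 0]) simp_all
  moreover have "u - v \<in> ?S" if "u \<in> ?S" "v \<in> ?S" for u v
    using that insert.prems(2) by (auto simp flip: lookup_minus)
  ultimately obtain g where g: "g \<in> ?S" "\<And>x. x \<in> ?S \<Longrightarrow> g dvd x"
    using int_subgroup_generator[of ?S] by metis
  from g(1) obtain a0 where a0: "a0 \<in> G" "Poly_Mapping.lookup a0 y = g" by auto
  define q where "q x = Poly_Mapping.lookup x y div g" for x
  define r where "r x = x - frag_cmul (q x) a0" for x
  have r: "r x \<in> G'" if "x \<in> G" for x
    using that g(2)[of "Poly_Mapping.lookup x y"] a0 insert.prems(2) cm
    by (auto simp: r_def G'_def lookup_minus q_def)
  have q_add: "q (x + z) = q x + q z" if "x \<in> G" "z \<in> G" for x z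
    using g(2) that by (simp add: q_def lookup_add div_plus_div_distrib_dvd_left)
  have r_add: "r (x + z) = r x + r z" if "x \<in> G" "z \<in> G" for x z
    using q_add that by (simp add: r_def frag_cmul_distrib)
  show ?case unfolding coordinates_def
  proof (intro exI conjI allI impI ballI)
    fix i assume i: "i < Suc n"
    show "(if i = n then a0 else a i) \<in> G" using i ih a0 by (auto simp: G'_def)
    fix x z assume xz: "x \<in> G" "z \<in> G"
    show "(if i = n then q (x + z) else \<chi> i (r (x + z)))
      = (if i = n then q x else \<chi> i (r x)) + (if i = n then q z else \<chi> i (r z))"
      using i xz r ih(1) by (simp add: q_add r_add)
  next
    fix x assume x: "x \<in> G"
    have "(\<Sum>i<Suc n. frag_cmul (if i = n then q x else \<chi> i (r x)) (if i = n then a0 else a i))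
      = (\<Sum>i<n. frag_cmul (\<chi> i (r x)) (a i)) + frag_cmul (q x) a0" by simp
    also have "\<dots> = r x + frag_cmul (q x) a0" using ih(2) r[OF x] by metis
    finally show "x = (\<Sum>i<Suc n. frag_cmul (if i = n then q x else \<chi> i (r x)) (if i = n then a0 else a i))"
      by (simp add: r_def)
  qed
qed

lemma prime_dvd_power_add_diff:
  fixes a b :: "'a::comm_ring_1"
  assumes "Factorial_Ring.prime p"
  shows "of_nat p dvd (a + b) ^ p - a ^ p - b ^ p"
proof -
  have p: "p > 0" using assms prime_gt_0_nat by blast
  have "(a + b) ^ p = (\<Sum>k\<le>p. of_nat (p choose k) * a ^ k * b ^ (p - k))"
    by (rule binomial_ring)
  also have "{..p} = insert 0 (insert p {0<..<p})" using p by auto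
  also have "(\<Sum>k\<in>\<dots>. of_nat (p choose k) * a ^ k * b ^ (p - k))
    = b ^ p + (a ^ p + (\<Sum>k\<in>{0<..<p}. of_nat (p choose k) * a ^ k * b ^ (p - k)))"
    using p by simp
  finally have "(a + b) ^ p - a ^ p - b ^ p = (\<Sum>k\<in>{0<..<p}. of_nat (p choose k) * a ^ k * b ^ (p - k))"
    by simp
  also have "of_nat p dvd \<dots>"
  proof (intro dvd_sum dvd_mult2)
    fix k assume "k \<in> {0<..<p}"
    then have "p dvd (p choose k)" using assms by (intro dvd_choose_prime) auto
    then show "(of_nat p :: 'a) dvd of_nat (p choose k)"
      by (elim dvdE) simp
  qed
  finally show ?thesis .
qed


section \<open>The permutation module of a permutation of prime order\<close>

text \<open>
  A permutation \<open>s\<close> of a type with \<open>s\<^sup>p = 1\<close> for a prime \<open>p\<close>; it makes the free abelian group on that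
  type a module over the group ring of the cyclic group of order \<open>p\<close>.
\<close>

locale prime_cyclic_perm =
  fixes s :: "'m \<Rightarrow> 'm" and p :: nat
  assumes prime_p: "Factorial_Ring.prime p" and s_pow_p: "s ^^ p = id"
begin

lemma p_pos: "p > 0"
  using prime_p by (simp add: prime_gt_0_nat)

text \<open>
  The automorphism of the free abelian group induced by the permutation.
\<close>

definition sg :: "('m \<Rightarrow>\<^sub>0 int) \<Rightarrow> ('m \<Rightarrow>\<^sub>0 int)"
  where "sg = frag_extend (frag_of \<circ> s)"

lemma sg_add: "sg (c + d) = sg c + sg d"
  and sg_diff: "sg (c - d) = sg c - sg d"
  and sg_zero [simp]: "sg 0 = 0"
  and sg_cmul: "sg (frag_cmul k c) = frag_cmul k (sg c)"
  and sg_frag_of [simp]: "sg (frag_of x) = frag_of (s x)"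
  by (simp_all add: sg_def frag_extend_add frag_extend_diff frag_extend_cmul)

lemma sg_sum: "sg (sum f I) = (\<Sum>i\<in>I. sg (f i))"
  by (induction I rule: infinite_finite_induct) (simp_all add: sg_add)

lemma sg_pow_add: "(sg ^^ n) (c + d) = (sg ^^ n) c + (sg ^^ n) d"
  and sg_pow_diff: "(sg ^^ n) (c - d) = (sg ^^ n) c - (sg ^^ n) d"
  and sg_pow_zero [simp]: "(sg ^^ n) 0 = 0"
  and sg_pow_frag_of: "(sg ^^ n) (frag_of x) = frag_of ((s ^^ n) x)"
  by (induction n) (simp_all add: sg_add sg_diff sg_cmul)

lemma sg_pow_p: "(sg ^^ p) c = c"
  using subset_UNIV[of "Poly_Mapping.keys c"]
  by (induction c rule: frag_induction) (simp_all add: sg_pow_frag_of sg_pow_diff s_pow_p)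

lemma s_inv: "(s ^^ (p - 1)) (s x) = x" "s ((s ^^ (p - 1)) x) = x"
proof -
  have "(s ^^ Suc (p - 1)) x = x" using p_pos s_pow_p by simp
  then show "(s ^^ (p - 1)) (s x) = x" "s ((s ^^ (p - 1)) x) = x"
    by (simp_all add: funpow_swap1)
qed

lemma inj_s: "inj s"
  by (metis injI s_inv(1))

lemma inj_s_pow: "inj (s ^^ n)"
  by (rule inj_fn[OF inj_s])

lemma lookup_sg: "Poly_Mapping.lookup (sg c) (s x) = Poly_Mapping.lookup c x"
  using subset_UNIV[of "Poly_Mapping.keys c"]
proof (induction c rule: frag_induction)
  case (one y) then show ?case using inj_s by (auto simp: inj_eq)
qed (simp_all add: sg_diff lookup_minus)

lemma lookup_sg_pow:
  "Poly_Mapping.lookup ((sg ^^ n) c) ((s ^^ n) x) = Poly_Mapping.lookup c x"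
  by (induction n) (simp_all add: lookup_sg)

lemma s_pow_mod: "(s ^^ (n mod p)) x = (s ^^ n) x"
proof -
  have "((s ^^ p) ^^ (n div p)) x = x" for x
    by (simp add: s_pow_p)
  then have "(s ^^ (p * (n div p))) x = x" for x by (simp add: funpow_mult)
  then show ?thesis
    by (metis comp_apply funpow_add mod_mult_div_eq)
qed

lemma s_pow_complement: "j \<le> p \<Longrightarrow> (s ^^ (p - j)) ((s ^^ j) x) = x"
  by (metis comp_apply funpow_add id_apply le_add_diff_inverse2 s_pow_p)

lemma lookup_sg_pow_complement:
  "j \<le> p \<Longrightarrow> Poly_Mapping.lookup ((sg ^^ (p - j)) c) x = Poly_Mapping.lookup c ((s ^^ j) x)"
  using lookup_sg_pow[of "p - j" c "(s ^^ j) x"] by (simp add: s_pow_complement)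

lemma lookup_sg_p_minus: "Poly_Mapping.lookup (sg c) x = Poly_Mapping.lookup c ((s ^^ (p - 1)) x)"
  by (metis lookup_sg s_inv(2))


text \<open>
  Group ring elements are represented by integer polynomials in the generator: a polynomial \<open>q\<close>
  acts as \<open>q\<close> evaluated at \<open>sg\<close>. Polynomials that differ by a multiple of \<open>X\<^sup>p - 1\<close> act alike.
\<close>

definition act :: "int poly \<Rightarrow> ('m \<Rightarrow>\<^sub>0 int) \<Rightarrow> ('m \<Rightarrow>\<^sub>0 int)"
  where "act q c = fold_coeffs (\<lambda>a d. frag_cmul a c + sg d) q 0"

lemma act_0 [simp]: "act 0 c = 0"
  by (simp add: act_def)

lemma act_pCons [simp]: "act (pCons a q) c = frag_cmul a c + sg (act q c)"
  by (cases "a = 0 \<and> q = 0")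
    (auto simp: act_def fold_coeffs_pCons_coeff_not_0_eq fold_coeffs_pCons_not_0_0_eq)

lemma act_add: "act (q + r) c = act q c + act r c"
  by (induction q r rule: poly_induct2) (simp_all add: frag_cmul_distrib sg_add algebra_simps)

lemma act_smult: "act (Polynomial.smult a q) c = frag_cmul a (act q c)"
  by (induction q) (simp_all add: frag_cmul_distrib2 sg_cmul)

lemma act_mult: "act (q * r) c = act q (act r c)"
  by (induction q) (simp_all add: act_add act_smult)

lemma act_diff: "act (q - r) c = act q c - act r c"
  using act_add[of "q - r" r c] by simp

lemma act_add_right: "act q (c + d) = act q c + act q d"
  by (induction q) (simp_all add: frag_cmul_distrib2 sg_add algebra_simps)

lemma act_zero_right [simp]: "act q 0 = 0"
  by (induction q) simp_all

lemma act_diff_right: "act q (c - d) = act q c - act q d"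
  using act_add_right[of q "c - d" d] by simp

lemma act_cmul_right: "act q (frag_cmul k c) = frag_cmul k (act q c)"
  by (induction q) (simp_all add: frag_cmul_distrib2 sg_cmul mult.commute)

lemma act_1 [simp]: "act 1 c = c"
  by (simp add: one_pCons)

lemma act_commute: "act q (act r c) = act r (act q c)"
  by (metis act_mult mult.commute)

lemma act_sg: "act q (sg c) = sg (act q c)"
  using act_commute[of q "[:0, 1:]" c] by simp

lemma act_sg_pow: "act q ((sg ^^ n) c) = (sg ^^ n) (act q c)"
  by (induction n) (simp_all add: act_sg)

lemma act_sum_right: "act q (sum f I) = (\<Sum>i\<in>I. act q (f i))"
  by (induction I rule: infinite_finite_induct) (simp_all add: act_add_right)

lemma act_sum: "act (sum f I) c = (\<Sum>i\<in>I. act (f i) c)"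
  by (induction I rule: infinite_finite_induct) (simp_all add: act_add)

abbreviation XX :: "int poly" where "XX \<equiv> [:0, 1:]"

lemma act_XX_pow: "act (XX ^ n) c = (sg ^^ n) c"
  by (induction n) (simp_all add: act_mult)

lemma act_XX_p: "act (XX ^ p) c = c"
  by (simp add: act_XX_pow sg_pow_p)

text \<open>
  The augmentation generator \<open>\<lambda> = X - 1\<close> and the norm element \<open>1 + X + \<dots> + X\<^sup>p\<^sup>-\<^sup>1\<close>.
\<close>

definition lam :: "int poly" where "lam = [:-1, 1:]"
definition nrm :: "int poly" where "nrm = (\<Sum>i<p. XX ^ i)"

lemma lam_eq: "lam = XX - 1"
  by (simp add: lam_def one_pCons)

lemma lam_nrm: "lam * nrm = XX ^ p - 1"
  unfolding lam_eq nrm_def by (rule power_diff_1_eq[symmetric])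

lemma act_lam: "act lam c = sg c - c"
  by (simp add: lam_def)

lemma act_lam_eq_0_iff: "act lam c = 0 \<longleftrightarrow> sg c = c"
  by (simp add: act_lam)

lemma act_lam_nrm: "act lam (act nrm c) = 0"
  by (simp add: act_mult[symmetric] lam_nrm act_diff act_XX_p)

lemma act_nrm_lam: "act nrm (act lam c) = 0"
  using act_lam_nrm act_commute by metis

lemma act_nrm: "act nrm c = (\<Sum>i<p. (sg ^^ i) c)"
  by (simp add: nrm_def act_sum act_XX_pow)

lemma poly_nrm_1 [simp]: "poly nrm 1 = int p"
  by (simp add: nrm_def poly_sum)

lemma poly_lam_1 [simp]: "poly lam 1 = 0"
  by (simp add: lam_def)

lemma act_fixed: "act lam c = 0 \<Longrightarrow> act q c = frag_cmul (poly q 1) c"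
  by (induction q) (simp_all add: act_lam_eq_0_iff frag_cmul_distrib sg_cmul)

text \<open>
  On a torsion-free module the kernel of \<open>\<lambda>\<^sup>2\<close> is the kernel of \<open>\<lambda>\<close>: on the image of \<open>\<lambda>\<close> the norm
  vanishes, whereas on fixed elements it is multiplication by \<open>p\<close>.
\<close>

lemma act_lam_reduced: "act lam (act lam c) = 0 \<Longrightarrow> act lam c = 0"
  using act_fixed[of "act lam c" nrm] p_pos by (simp add: act_nrm_lam)

lemma act_lam_pow_reduced: "act (lam ^ Suc k) c = 0 \<Longrightarrow> act lam c = 0"
proof (induction k)
  case (Suc k)
  then show ?case
    using act_lam_reduced[of "act (lam ^ k) c"] by (simp add: act_mult)
qed simp

lemma dvd_lam_iff: "lam dvd q \<longleftrightarrow> poly q 1 = 0"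
  by (simp add: lam_def poly_eq_0_iff_dvd)


text \<open>
  The submodules of the permutation module: its \<open>s\<close>-stable subgroups.
\<close>

definition submod :: "('m \<Rightarrow>\<^sub>0 int) set \<Rightarrow> bool"
  where "submod P \<longleftrightarrow> 0 \<in> P \<and> (\<forall>x\<in>P. \<forall>y\<in>P. x - y \<in> P) \<and> (\<forall>x\<in>P. sg x \<in> P)"

lemma
  assumes "submod P"
  shows submod_zero: "0 \<in> P"
    and submod_diff: "x \<in> P \<Longrightarrow> y \<in> P \<Longrightarrow> x - y \<in> P"
    and submod_sg: "x \<in> P \<Longrightarrow> sg x \<in> P"
    and submod_minus: "x \<in> P \<Longrightarrow> - x \<in> P"
    and submod_add: "x \<in> P \<Longrightarrow> y \<in> P \<Longrightarrow> x + y \<in> P"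
proof -
  show 0: "0 \<in> P" using assms by (auto simp: submod_def)
  have d: "x - y \<in> P" if "x \<in> P" "y \<in> P" for x y
    using assms that by (auto simp: submod_def)
  have m: "- x \<in> P" if "x \<in> P" for x
    using d[OF 0 that] by simp
  show "x \<in> P \<Longrightarrow> y \<in> P \<Longrightarrow> x - y \<in> P" "x \<in> P \<Longrightarrow> - x \<in> P"
    by (rule d m; assumption)+
  show "x \<in> P \<Longrightarrow> y \<in> P \<Longrightarrow> x + y \<in> P"
    using d[of x "- y"] m[of y] by simp
  show "x \<in> P \<Longrightarrow> sg x \<in> P" using assms by (auto simp: submod_def)
qed

lemma submod_cmul: "submod P \<Longrightarrow> x \<in> P \<Longrightarrow> frag_cmul k x \<in> P"
  by (rule frag_closure_minus_cmul) (auto intro: submod_zero submod_diff)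

lemma submod_sg_pow: "submod P \<Longrightarrow> x \<in> P \<Longrightarrow> (sg ^^ n) x \<in> P"
  by (induction n) (auto intro: submod_sg)

lemma submod_act: "submod P \<Longrightarrow> x \<in> P \<Longrightarrow> act q x \<in> P"
  by (induction q) (auto intro: submod_zero submod_add submod_sg submod_cmul)

lemma submod_sum: "submod P \<Longrightarrow> (\<And>i. i \<in> I \<Longrightarrow> f i \<in> P) \<Longrightarrow> sum f I \<in> P"
  by (induction I rule: infinite_finite_induct) (auto intro: submod_zero submod_add)

lemma hom_act:
  assumes P: "submod P" and x: "x \<in> P"
    and add: "\<And>x y. x \<in> P \<Longrightarrow> y \<in> P \<Longrightarrow> f (x + y) = f x + (f y :: 'm \<Rightarrow>\<^sub>0 int)"
    and eq: "\<And>x. x \<in> P \<Longrightarrow> f (sg x) = sg (f x)"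
  shows "f 0 = 0" "f (frag_cmul k x) = frag_cmul k (f x)" "f (act q x) = act q (f x)"
proof -
  show 0: "f 0 = 0" using add[of 0 0] submod_zero[OF P] by simp
  have cm: "f (frag_cmul k x) = frag_cmul k (f x)" if "x \<in> P" for k x
  proof -
    have "frag_cmul k x \<in> P \<and> f (frag_cmul k x) = frag_cmul k (f x)" 
    proof (induction k rule: int_induct[where k = 0])
      case base then show ?case using 0 submod_zero[OF P] by simp
    next
      case (step1 i)
      then show ?case using add[of "frag_cmul i x" x] that submod_add[OF P]
        by (simp add: frag_cmul_distrib)
    next
      case (step2 i)
      then show ?case using additive_diff[of P f "frag_cmul i x" x] add that submod_diff[OF P]
        by (simp add: frag_cmul_diff_distrib)
    qed
    then show ?thesis ..
  qed
  show "f (frag_cmul k x) = frag_cmul k (f x)" using cm x .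
  show "f (act q x) = act q (f x)"
    by (induction q) (simp_all add: 0 add submod_cmul submod_act submod_sg P x cm eq)
qed


text \<open>
  The module homomorphism that an additive functional \<open>\<chi>\<close> and an element \<open>a\<close> determine: \<open>\<chi>\<close> is turned
  into the homomorphism to the group ring with coefficient \<open>\<chi>(\<alpha>\<^sup>-\<^sup>j x)\<close> at \<open>\<alpha>\<^sup>j\<close>, followed by
  \<open>r \<mapsto> r a\<close>. Commuting with \<open>sg\<close> needs no assumption on \<open>\<chi>\<close>.
\<close>

definition tr :: "(('m \<Rightarrow>\<^sub>0 int) \<Rightarrow> int) \<Rightarrow> ('m \<Rightarrow>\<^sub>0 int) \<Rightarrow> ('m \<Rightarrow>\<^sub>0 int) \<Rightarrow> ('m \<Rightarrow>\<^sub>0 int)"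
  where "tr \<chi> a x = (\<Sum>j<p. frag_cmul (\<chi> ((sg ^^ (p - j)) x)) ((sg ^^ j) a))"

lemma tr_sg: "tr \<chi> a (sg x) = sg (tr \<chi> a x)"
proof -
  let ?f = "\<lambda>j. frag_cmul (\<chi> ((sg ^^ (Suc p - j)) x)) ((sg ^^ j) a)"
  have "tr \<chi> a (sg x) = sum ?f {..<p}"
    unfolding tr_def by (intro sum.cong) (simp_all add: Suc_diff_le funpow_swap1)
  also have "\<dots> = sum ?f {0<..p}"
  proof -
    have "{..<p} = insert 0 {0<..<p}" "{0<..p} = insert p {0<..<p}" using p_pos by auto
    then show ?thesis by (simp add: sg_pow_p)
  qed
  also have "\<dots> = (\<Sum>j<p. ?f (Suc j))"
    by (rule sum.reindex_bij_witness[of _ Suc "\<lambda>j. j - 1"]) auto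
  also have "\<dots> = sg (tr \<chi> a x)"
    by (simp add: tr_def sg_sum sg_cmul)
  finally show ?thesis .
qed

lemma tr_add:
  assumes "submod P" "\<And>x y. x \<in> P \<Longrightarrow> y \<in> P \<Longrightarrow> \<chi> (x + y) = \<chi> x + \<chi> y" "x \<in> P" "y \<in> P"
  shows "tr \<chi> a (x + y) = tr \<chi> a x + tr \<chi> a y"
  using assms by (simp add: tr_def sg_pow_add submod_sg_pow frag_cmul_distrib sum.distrib)

lemma tr_act: "tr \<chi> (act q a) x = act q (tr \<chi> a x)"
  by (simp add: tr_def act_sum_right act_cmul_right act_sg_pow)

lemma tr_closed: "submod P \<Longrightarrow> a \<in> P \<Longrightarrow> tr \<chi> a x \<in> P"
  by (simp add: tr_def submod_sum submod_cmul submod_sg_pow)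

text \<open>
  Finitely generated projective modules, described by a finite dual basis. A homomorphism to
  the group ring is determined by its coefficient at 1, an additive functional; so
  the dual basis lemma asks for elements \<open>a\<^sub>i\<close> and functionals \<open>\<chi>\<^sub>i\<close> with \<open>x = \<Sum>\<^sub>i tr \<chi>\<^sub>i a\<^sub>i x\<close>.
\<close>

definition dual_basis :: "('m \<Rightarrow>\<^sub>0 int) set \<Rightarrow> bool"
  where "dual_basis P \<longleftrightarrow> (\<exists>(n::nat) a \<chi>.
    (\<forall>i<n. a i \<in> P \<and> (\<forall>x\<in>P. \<forall>y\<in>P. \<chi> i (x + y) = \<chi> i x + \<chi> i y)) \<and>
    (\<forall>x\<in>P. x = (\<Sum>i<n. tr (\<chi> i) (a i) x)))"

lemma dual_basis_iso:
  assumes K: "submod K" "dual_basis K"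
    and add: "\<And>x y. x \<in> K \<Longrightarrow> y \<in> K \<Longrightarrow> f (x + y) = f x + f y"
    and eq: "\<And>x. x \<in> K \<Longrightarrow> f (sg x) = sg (f x)"
    and inj: "\<And>x. x \<in> K \<Longrightarrow> f x = 0 \<Longrightarrow> x = 0"
  shows "dual_basis (f ` K)"
proof -
  have injf: "inj_on f K"
  proof (rule inj_onI)
    fix x y assume xy: "x \<in> K" "y \<in> K" "f x = f y"
    have "f (x - y) = f x - f y"
      by (rule additive_diff[of K]) (use add xy submod_diff[OF K(1)] in auto)
    then show "x = y" using inj[of "x - y"] xy submod_diff[OF K(1)] by auto
  qed
  define g where "g = the_inv_into K f"
  have g: "g (f x) = x" if "x \<in> K" for x
    using the_inv_into_f_f[OF injf that] by (simp add: g_def)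
  have eqn: "f ((sg ^^ n) x) = (sg ^^ n) (f x)" if "x \<in> K" for n x
    by (induction n) (simp_all add: eq that submod_sg_pow K)
  obtain n a \<chi> where d: "\<forall>i<n::nat. a i \<in> K \<and> (\<forall>x\<in>K. \<forall>y\<in>K. \<chi> i (x + y) = \<chi> i x + \<chi> i y)"
    "\<forall>x\<in>K. x = (\<Sum>i<n. tr (\<chi> i) (a i) x)"
    using K(2) unfolding dual_basis_def by auto
  have fsum: "f (sum h I) = (\<Sum>i\<in>I. f (h i))" if "\<And>i. i \<in> I \<Longrightarrow> h i \<in> K" for h :: "nat \<Rightarrow> _" and I
    using that 
    by (induction I rule: infinite_finite_induct)
      (auto simp: hom_act(1)[OF K(1) submod_zero[OF K(1)] add eq] add submod_sum K)
  have trf: "f (tr (\<chi> i) (a i) x) = tr (\<lambda>y. \<chi> i (g y)) (f (a i)) (f x)" if "x \<in> K" "i < n" for x i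
    unfolding tr_def using d(1) that
    by (subst fsum)
      (auto simp: submod_cmul submod_sg_pow K hom_act(2)[OF K(1) _ add eq] g eqn[symmetric])
  show ?thesis unfolding dual_basis_def
  proof (intro exI conjI allI impI ballI)
    fix i assume i: "i < n"
    show "f (a i) \<in> f ` K" using d i by auto
    fix x y assume "x \<in> f ` K" "y \<in> f ` K"
    then show "\<chi> i (g (x + y)) = \<chi> i (g x) + \<chi> i (g y)"
      using d i by (auto simp: g add[symmetric] submod_add[OF K(1)])
  next
    fix x assume "x \<in> f ` K"
    then obtain y where y: "y \<in> K" "x = f y" by auto
    have "x = f (\<Sum>i<n. tr (\<chi> i) (a i) y)" using d(2) y by metis
    also have "\<dots> = (\<Sum>i<n. f (tr (\<chi> i) (a i) y))"
      by (rule fsum) (use d(1) tr_closed[OF K(1)] in auto)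
    finally show "x = (\<Sum>i<n. tr (\<lambda>y. \<chi> i (g y)) (f (a i)) x)"
      using y trf by simp
  qed
qed

text \<open>
  The internal direct sum \<open>L = (\<Oplus>\<^sub>x P\<^sub>x) \<oplus> T\<close> with finitely generated projective nonzero \<open>P\<^sub>x\<close> and trivial \<open>T\<close>:
  existence and uniqueness of the expression of an element as a finite sum.
\<close>

definition direct_decomposition ::
  "('m \<Rightarrow>\<^sub>0 int) set \<Rightarrow> 'i set \<Rightarrow> ('i \<Rightarrow> ('m \<Rightarrow>\<^sub>0 int) set) \<Rightarrow> ('m \<Rightarrow>\<^sub>0 int) set \<Rightarrow> bool"
  where "direct_decomposition L I P T \<longleftrightarrow>
    (\<forall>x\<in>I. submod (P x) \<and> P x \<subseteq> L \<and> dual_basis (P x) \<and> P x \<noteq> {0}) \<and>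
    submod T \<and> T \<subseteq> L \<and> (\<forall>t\<in>T. sg t = t) \<and>
    (\<forall>l\<in>L. \<exists>F f t. finite F \<and> F \<subseteq> I \<and> (\<forall>x\<in>F. f x \<in> P x) \<and> t \<in> T \<and> l = sum f F + t) \<and>
    (\<forall>F f t. finite F \<and> F \<subseteq> I \<and> (\<forall>x\<in>F. f x \<in> P x) \<and> t \<in> T \<and> sum f F + t = 0 \<longrightarrow>
      t = 0 \<and> (\<forall>x\<in>F. f x = 0))"

lemmas direct_decompositionD =
  direct_decomposition_def[THEN iffD1, THEN conjunct1]
  direct_decomposition_def[THEN iffD1, THEN conjunct2, THEN conjunct1]
  direct_decomposition_def[THEN iffD1, THEN conjunct2, THEN conjunct2, THEN conjunct1]
  direct_decomposition_def[THEN iffD1, THEN conjunct2, THEN conjunct2, THEN conjunct2, THEN conjunct1]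
  direct_decomposition_def[THEN iffD1, THEN conjunct2, THEN conjunct2, THEN conjunct2, THEN conjunct2, THEN conjunct1]
  direct_decomposition_def[THEN iffD1, THEN conjunct2, THEN conjunct2, THEN conjunct2, THEN conjunct2, THEN conjunct2]

text \<open>
  The lifting property of projective modules, for module endomorphisms \<open>g\<close> and \<open>h\<close> of the
  permutation module: if \<open>h\<close> maps \<open>K\<close> into \<open>g(E)\<close>, it factors on \<open>K\<close> through \<open>g\<close> and a map \<open>\<phi> : K \<rightarrow> E\<close>.
\<close>

lemma dual_basis_lift:
  assumes K: "submod K" "dual_basis K" and E: "submod E"
    and g: "\<And>c d. g (c + d) = g c + g d" "\<And>c. g (sg c) = sg (g c)"
    and h: "\<And>c d. h (c + d) = h c + h d" "\<And>c. h (sg c) = sg (h c)"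
    and lift: "\<And>a. a \<in> K \<Longrightarrow> \<exists>l\<in>E. g l = h a"
  obtains \<phi> where "\<And>c. c \<in> K \<Longrightarrow> \<phi> c \<in> E" "\<And>c. c \<in> K \<Longrightarrow> g (\<phi> c) = h c"
    "\<And>c d. c \<in> K \<Longrightarrow> d \<in> K \<Longrightarrow> \<phi> (c + d) = \<phi> c + \<phi> d" "\<And>c. c \<in> K \<Longrightarrow> \<phi> (sg c) = sg (\<phi> c)"
proof -
  obtain n a \<chi> where db: "(\<forall>i<n::nat. a i \<in> K \<and> (\<forall>x\<in>K. \<forall>y\<in>K. \<chi> i (x + y) = \<chi> i x + \<chi> i y)) \<and>
    (\<forall>x\<in>K. x = (\<Sum>i<n. tr (\<chi> i) (a i) x))"
    using K(2) unfolding dual_basis_def by (elim exE)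
  note a = db[THEN conjunct1] and exp = db[THEN conjunct2]
  have "\<forall>i. \<exists>l. i < n \<longrightarrow> l \<in> E \<and> g l = h (a i)" using lift a by blast
  then obtain l where l: "\<And>i. i < n \<Longrightarrow> l i \<in> E" "\<And>i. i < n \<Longrightarrow> g (l i) = h (a i)" by metis
  have U: "submod UNIV" by (simp add: submod_def)
  have hom: "f (sum u I) = (\<Sum>i\<in>I. f (u i))" "f (frag_cmul k c) = frag_cmul k (f c)"
    "f (act q c) = act q (f c)"
    if "\<And>c d. f (c + d) = f c + f d" "\<And>c. f (sg c) = sg (f c)"
    for f :: "('m \<Rightarrow>\<^sub>0 int) \<Rightarrow> ('m \<Rightarrow>\<^sub>0 int)" and u :: "nat \<Rightarrow> _" and I c k q
  proof -
    show "f (frag_cmul k c) = frag_cmul k (f c)" "f (act q c) = act q (f c)"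
      using hom_act[OF U UNIV_I, of f] that by auto
    have "f 0 = 0" using hom_act(1)[OF U UNIV_I, of f] that by auto
    then show "f (sum u I) = (\<Sum>i\<in>I. f (u i))"
      by (induction I rule: infinite_finite_induct) (simp_all add: that)
  qed
  have tr_hom: "f (tr \<chi>' b c) = tr \<chi>' (f b) c"
    if "\<And>c d. f (c + d) = f c + f d" "\<And>c. f (sg c) = sg (f c)" for f \<chi>' b c
    using hom(3)[OF that, of "XX ^ _"]
    by (simp add: tr_def hom(1,2)[OF that] act_XX_pow)
  define \<phi> where "\<phi> c = (\<Sum>i<n. tr (\<chi> i) (l i) c)" for c
  show ?thesis
  proof (rule that[of \<phi>])
    fix c assume c: "c \<in> K"
    show "\<phi> c \<in> E" unfolding \<phi>_def using l by (auto intro!: submod_sum tr_closed E)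
    show "\<phi> (sg c) = sg (\<phi> c)" by (simp add: \<phi>_def tr_sg sg_sum)
    have "g (\<phi> c) = (\<Sum>i<n. tr (\<chi> i) (h (a i)) c)"
      using l by (simp add: \<phi>_def hom(1)[OF g] tr_hom[OF g])
    also have "\<dots> = h (\<Sum>i<n. tr (\<chi> i) (a i) c)"
      by (simp add: hom(1)[OF h] tr_hom[OF h])
    finally show "g (\<phi> c) = h c" using exp c by metis
    fix d assume "d \<in> K"
    then show "\<phi> (c + d) = \<phi> c + \<phi> d"
      using a c by (simp add: \<phi>_def sum.distrib[symmetric] tr_add[OF K(1)])
  qed
qed

lemma act_of_int: "act (of_int k) c = frag_cmul k c"
  by (simp add: of_int_poly)

lemma lam_pow_p: obtains q where "lam ^ p = of_int (int p) * q + (XX ^ p - 1)"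
proof -
  have "(of_nat p :: int poly) dvd (XX + (-1)) ^ p - XX ^ p - (-1) ^ p"
    by (rule prime_dvd_power_add_diff[OF prime_p])
  moreover have "(of_nat p :: int poly) dvd (-1) ^ p + 1"
    using prime_odd_nat[OF prime_p] prime_ge_2_nat[OF prime_p]
    by (cases "p = 2") (auto simp: power_minus_odd)
  ultimately have "(of_nat p :: int poly) dvd ((XX + (-1)) ^ p - XX ^ p - (-1) ^ p) + ((-1) ^ p + 1)"
    by (rule dvd_add)
  then have "(of_nat p :: int poly) dvd lam ^ p - (XX ^ p - 1)"
    by (simp add: lam_eq algebra_simps)
  then obtain q where "lam ^ p - (XX ^ p - 1) = of_nat p * q" by (elim dvdE)
  then show ?thesis using that[of q] by (simp add: algebra_simps)
qed

text \<open>
  Cyclotomic units: \<open>1 + X + \<dots> + X\<^sup>c\<^sup>-\<^sup>1\<close> with \<open>c\<close> prime to \<open>p\<close> is invertible modulo the norm element, the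
  inverse being \<open>(X - 1)/(X\<^sup>c - 1)\<close> written as a polynomial in \<open>X\<^sup>c\<close>.
\<close>

lemma unit_poly:
  assumes "\<not> int p dvd m"
  obtains u v r where "[poly u 1 = m] (mod int p)" "u * v = 1 + r * nrm"
proof -
  define c where "c = nat (m mod int p)"
  have p0: "int p > 0" using p_pos by simp
  have c: "int c = m mod int p" using p0 by (simp add: c_def)
  have "coprime c p"
  proof -
    have "\<not> int p dvd int c" using assms c by (simp add: dvd_eq_mod_eq_0)
    then have "\<not> p dvd c" by simp
    then show ?thesis using prime_p prime_imp_coprime coprime_commute by blast
  qed
  then obtain c' where c': "[c * c' = 1] (mod p)" using cong_solve_coprime_nat by auto
  moreover have p1: "p > 1" using prime_p prime_gt_1_nat by blast
  ultimately have "c * c' mod p = 1" by (simp add: cong_def)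
  then obtain t where t: "c * c' = 1 + p * t" by (metis add.commute mult_div_mod_eq)
  define u v where "u = (\<Sum>i<c. XX ^ i)" and "v = (\<Sum>i<c'. (XX ^ c) ^ i)"
  define S where "S = (\<Sum>i<t. (XX ^ p) ^ i)"
  have "lam * (u * v) = (XX ^ c - 1) * v"
    using power_diff_1_eq[of XX c] by (simp add: lam_eq u_def mult.assoc)
  also have "\<dots> = (XX ^ c) ^ c' - 1"
    unfolding v_def by (rule power_diff_1_eq[symmetric])
  also have "\<dots> = XX * (XX ^ p) ^ t - 1"
    unfolding power_mult[symmetric] t by (simp add: power_add)
  also have "\<dots> = XX * ((XX ^ p) ^ t - 1) + lam"
    by (simp add: lam_eq algebra_simps)
  also have "(XX ^ p) ^ t - 1 = lam * nrm * S"
    using power_diff_1_eq[of "XX ^ p" t] lam_nrm by (simp add: S_def)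
  finally have "lam * (u * v) = lam * (1 + (XX * S) * nrm)"
    by (simp add: algebra_simps)
  then have "u * v = 1 + (XX * S) * nrm"
    by (subst (asm) mult_cancel_left) (auto simp: lam_def)
  moreover have "poly u 1 = int c" by (simp add: u_def poly_sum)
  then have "[poly u 1 = m] (mod int p)" by (simp add: c cong_def)
  ultimately show ?thesis using that by blast
qed


section \<open>Orbits\<close>

text \<open>
  As \<open>p\<close> is prime, an orbit is a fixed point or is free.
\<close>

lemma s_pow_fixed:
  assumes "(s ^^ i) x = x" "\<not> p dvd i"
  shows "s x = x"
proof -
  have "coprime i p" using assms(2) prime_p prime_imp_coprime coprime_commute by blast
  then obtain k where "[i * k = 1] (mod p)" using cong_solve_coprime_nat by auto
  moreover have p1: "p > 1" using prime_p prime_gt_1_nat by blast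
  ultimately have k: "i * k mod p = 1" by (simp add: cong_def)
  have "((s ^^ i) ^^ k) x = x" using assms(1) by (induction k) simp_all
  then have "(s ^^ (i * k)) x = x" by (simp add: funpow_mult)
  then show ?thesis using s_pow_mod[of "i * k" x] k by simp
qed

lemma inj_on_orbit:
  assumes "s x \<noteq> x"
  shows "inj_on (\<lambda>j. (s ^^ j) x) {..<p}"
proof -
  have "i = j" if "(s ^^ i) x = (s ^^ j) x" "i \<le> j" "j < p" for i j
  proof (rule ccontr)
    assume "i \<noteq> j"
    have "(s ^^ j) x = (s ^^ i) ((s ^^ (j - i)) x)"
      using that(2) by (metis comp_apply funpow_add le_add_diff_inverse)
    then have "(s ^^ (j - i)) x = x" using that(1) inj_s_pow[of i] by (simp add: inj_eq)
    moreover have "\<not> p dvd (j - i)" using that \<open>i \<noteq> j\<close> by (auto dest: dvd_imp_le)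
    ultimately show False using s_pow_fixed assms by blast
  qed
  then show ?thesis
    by (intro inj_onI) (metis lessThan_iff nle_le)
qed

text \<open>
  The orbit of a point under the permutation.
\<close>

definition orb :: "'m \<Rightarrow> 'm set"
  where "orb x = (\<lambda>j. (s ^^ j) x) ` {..<p}"

lemma orb_pow: "(s ^^ n) x \<in> orb x"
  using s_pow_mod[of n x] p_pos by (auto simp: orb_def intro: image_eqI[of _ _ "n mod p"])

lemma orb_iff: "y \<in> orb x \<longleftrightarrow> (\<exists>n. y = (s ^^ n) x)"
  using orb_pow by (auto simp: orb_def)

lemma s_orb_iff: "s y \<in> orb x \<longleftrightarrow> y \<in> orb x"
proof
  assume "y \<in> orb x"
  then show "s y \<in> orb x" using orb_pow[of "Suc n" x for n] by (auto simp: orb_def)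
next
  assume "s y \<in> orb x"
  then obtain n where "s y = (s ^^ n) x" by (auto simp: orb_iff)
  then have "y = (s ^^ (p - 1 + n)) x" using s_inv(1)[of y] by (simp add: funpow_add)
  then show "y \<in> orb x" by (auto simp: orb_iff)
qed

lemma finite_orb: "finite (orb x)"
  by (simp add: orb_def)

text \<open>
  The span of an orbit. For a free orbit it is the free module of rank one on the base point \<open>x\<close>, and its
  submodules serve as the ideals of the group ring.
\<close>

definition ZO :: "'m \<Rightarrow> ('m \<Rightarrow>\<^sub>0 int) set"
  where "ZO x = {c. Poly_Mapping.keys c \<subseteq> orb x}"

lemma submod_ZO: "submod (ZO x)"
proof -
  have "sg c \<in> ZO x" if "c \<in> ZO x" for c
  proof -
    have "y \<in> orb x" if "y \<in> Poly_Mapping.keys (sg c)" for y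
    proof -
      have "(s ^^ (p - 1)) y \<in> Poly_Mapping.keys c" using that by (simp add: in_keys_iff lookup_sg_p_minus)
      then have "(s ^^ (p - 1)) y \<in> orb x" using \<open>c \<in> ZO x\<close> by (auto simp: ZO_def)
      then show ?thesis using s_orb_iff[of "(s ^^ (p - 1)) y" x] by (simp only: s_inv)
    qed
    then show ?thesis by (auto simp: ZO_def)
  qed
  moreover have "c - d \<in> ZO x" if "c \<in> ZO x" "d \<in> ZO x" for c d
    using that keys_diff[of c d] unfolding ZO_def by blast
  ultimately show ?thesis
    unfolding submod_def by (simp add: ZO_def)
qed

lemma ZO_expand:
  assumes "s x \<noteq> x" "c \<in> ZO x"
  shows "tr (\<lambda>d. Poly_Mapping.lookup d x) (frag_of x) c = c"
proof -
  have "c = (\<Sum>y\<in>Poly_Mapping.keys c. frag_cmul (Poly_Mapping.lookup c y) (frag_of y))"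
    using frag_expansion[of c] by (simp add: frag_extend_def)
  also have "\<dots> = (\<Sum>y\<in>orb x. frag_cmul (Poly_Mapping.lookup c y) (frag_of y))"
    using assms(2) by (intro sum.mono_neutral_left) (auto simp: ZO_def finite_orb in_keys_iff)
  also have "\<dots> = (\<Sum>j<p. frag_cmul (Poly_Mapping.lookup c ((s ^^ j) x)) (frag_of ((s ^^ j) x)))"
    unfolding orb_def by (subst sum.reindex[OF inj_on_orbit[OF assms(1)]]) simp
  finally show ?thesis
    by (simp add: tr_def lookup_sg_pow_complement sg_pow_frag_of)
qed

lemma tr_lookup_eq_act:
  "\<exists>q. \<forall>a. tr (\<lambda>d. Poly_Mapping.lookup d x) a c = act q a"
proof (intro exI allI)
  fix a
  show "tr (\<lambda>d. Poly_Mapping.lookup d x) a c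
    = act (\<Sum>j<p. of_int (Poly_Mapping.lookup c ((s ^^ j) x)) * XX ^ j) a"
    by (simp add: tr_def lookup_sg_pow_complement act_sum act_mult act_of_int act_XX_pow)
qed

lemma ZO_cyclic:
  assumes "s x \<noteq> x" "c \<in> ZO x"
  obtains q where "c = act q (frag_of x)"
  using tr_lookup_eq_act[of x c] ZO_expand[OF assms] that by metis

lemma frag_of_ZO: "frag_of x \<in> ZO x"
  using orb_pow[of 0 x] by (simp add: ZO_def)

lemma nrm_frag_of_ZO: "act nrm (frag_of x) \<in> ZO x"
  by (intro submod_act submod_ZO frag_of_ZO)

text \<open>
  The augmentation of the part on the orbit of \<open>x\<close>, for a free orbit: the norm sums the
  coefficients over the orbit.
\<close>

definition eps :: "'m \<Rightarrow> ('m \<Rightarrow>\<^sub>0 int) \<Rightarrow> int"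
  where "eps x c = Poly_Mapping.lookup (act nrm c) x"

lemma eps_add: "eps x (c + d) = eps x c + eps x d"
  and eps_diff: "eps x (c - d) = eps x c - eps x d"
  and eps_cmul: "eps x (frag_cmul k c) = k * eps x c"
  and eps_lam: "eps x (act lam c) = 0"
  by (simp_all add: eps_def act_add_right act_diff_right lookup_add lookup_minus act_cmul_right act_nrm_lam)

lemma lookup_nrm_frag_of:
  assumes "s x \<noteq> x"
  shows "Poly_Mapping.lookup (act nrm (frag_of x)) x = 1"
proof -
  have "Poly_Mapping.lookup (act nrm (frag_of x)) x = (\<Sum>i<p. if x = (s ^^ i) x then 1 else 0)"
    by (simp add: act_nrm lookup_sum sg_pow_frag_of)
  also have "\<dots> = (\<Sum>i<p. if i = 0 then 1 else 0)"
  proof (intro sum.cong if_cong refl)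
    fix i assume "i \<in> {..<p}"
    then show "(x = (s ^^ i) x) = (i = 0)"
      using inj_onD[OF inj_on_orbit[OF assms], of 0 i] p_pos by auto
  qed
  finally show ?thesis using p_pos by simp
qed

lemma eps_act_frag_of: "s x \<noteq> x \<Longrightarrow> eps x (act q (frag_of x)) = poly q 1"
  by (simp add: eps_def act_commute[of nrm q] act_fixed[OF act_lam_nrm] lookup_nrm_frag_of)

lemma eps_nrm_frag_of: "s x \<noteq> x \<Longrightarrow> eps x (act nrm (frag_of x)) = int p"
  by (simp add: eps_act_frag_of)

lemma eps_act:
  assumes "s x \<noteq> x" "c \<in> ZO x"
  shows "eps x (act q c) = poly q 1 * eps x c"
  using ZO_cyclic[OF assms] by (metis act_mult eps_act_frag_of[OF assms(1)] poly_mult)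

lemma act_nrm_ZO:
  assumes "s x \<noteq> x" "c \<in> ZO x"
  shows "act nrm c = frag_cmul (eps x c) (act nrm (frag_of x))"
  using ZO_cyclic[OF assms] 
  by (metis act_commute act_fixed act_lam_nrm eps_act_frag_of[OF assms(1)])

text \<open>
  The augmentation ideal is generated by \<open>\<lambda>\<close>.
\<close>

lemma eps_0_imp_lam:
  assumes "s x \<noteq> x" "c \<in> ZO x" "eps x c = 0"
  obtains y where "y \<in> ZO x" "c = act lam y"
proof -
  obtain q where q: "c = act q (frag_of x)" using ZO_cyclic[OF assms(1,2)] .
  then have "lam dvd q" using assms by (simp add: eps_act_frag_of dvd_lam_iff)
  then obtain r where "q = lam * r" by (elim dvdE)
  then show ?thesis using that[of "act r (frag_of x)"] q
    by (simp add: act_mult submod_act submod_ZO frag_of_ZO)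
qed

lemma ZO_fixed:
  assumes "s x \<noteq> x" "c \<in> ZO x" "act lam c = 0"
  shows "c = frag_cmul (Poly_Mapping.lookup c x) (act nrm (frag_of x))"
proof -
  have 1: "frag_cmul (int p) c = frag_cmul (eps x c) (act nrm (frag_of x))"
    using act_fixed[OF assms(3), of nrm] act_nrm_ZO[OF assms(1,2)] by simp
  then have "int p * Poly_Mapping.lookup c x = eps x c"
    using lookup_nrm_frag_of[OF assms(1)] by (metis lookup_frag_cmul mult.right_neutral)
  with 1 have "frag_cmul (int p) c = frag_cmul (int p) (frag_cmul (Poly_Mapping.lookup c x) (act nrm (frag_of x)))"
    by simp
  then have "frag_cmul (int p) (c - frag_cmul (Poly_Mapping.lookup c x) (act nrm (frag_of x))) = 0"
    using frag_cmul_distrib2[of "int p" "c - frag_cmul (Poly_Mapping.lookup c x) (act nrm (frag_of x))"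
        "frag_cmul (Poly_Mapping.lookup c x) (act nrm (frag_of x))"] by (metis add_cancel_left_left diff_add_cancel)
  then show ?thesis using p_pos by simp
qed

text \<open>
  Restriction of the coefficients to the orbit of \<open>x\<close>.
\<close>

definition restr :: "'m \<Rightarrow> ('m \<Rightarrow>\<^sub>0 int) \<Rightarrow> ('m \<Rightarrow>\<^sub>0 int)"
  where "restr x = frag_extend (\<lambda>y. if y \<in> orb x then frag_of y else 0)"

lemma restr_add: "restr x (c + d) = restr x c + restr x d"
  and restr_diff: "restr x (c - d) = restr x c - restr x d"
  and restr_zero [simp]: "restr x 0 = 0"
  and restr_cmul: "restr x (frag_cmul k c) = frag_cmul k (restr x c)"
  by (simp_all add: restr_def frag_extend_add frag_extend_diff frag_extend_cmul)

lemma lookup_restr: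
  "Poly_Mapping.lookup (restr x c) y = (if y \<in> orb x then Poly_Mapping.lookup c y else 0)"
  using subset_UNIV[of "Poly_Mapping.keys c"]
proof (induction c rule: frag_induction)
  case (one z) then show ?case by (simp add: restr_def)
qed (simp_all add: restr_diff lookup_minus)

lemma restr_sg: "restr x (sg c) = sg (restr x c)"
  using subset_UNIV[of "Poly_Mapping.keys c"]
proof (induction c rule: frag_induction)
  case (one z) then show ?case by (simp add: restr_def s_orb_iff)
qed (simp_all add: restr_diff sg_diff)

lemma restr_act: "restr x (act q c) = act q (restr x c)"
  by (induction q) (simp_all add: restr_add restr_cmul restr_sg)

lemma restr_ZO: "restr x c \<in> ZO x"
  by (auto simp: ZO_def in_keys_iff lookup_restr split: if_splits)

text \<open>
  Constancy of the coefficients along the orbit of \<open>x\<close>.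
\<close>

definition flat_at :: "'m \<Rightarrow> ('m \<Rightarrow>\<^sub>0 int) \<Rightarrow> bool"
  where "flat_at x c \<longleftrightarrow> act lam (restr x c) = 0"

lemma flat_at_zero: "flat_at x 0"
  and flat_at_add: "flat_at x c \<Longrightarrow> flat_at x d \<Longrightarrow> flat_at x (c + d)"
  and flat_at_diff: "flat_at x c \<Longrightarrow> flat_at x d \<Longrightarrow> flat_at x (c - d)"
  and flat_at_sg: "flat_at x c \<Longrightarrow> flat_at x (sg c)"
  by (simp_all add: flat_at_def restr_add restr_diff act_add_right act_diff_right restr_sg act_sg)

lemma flat_at_fixed: "act lam c = 0 \<Longrightarrow> flat_at x c"
  by (metis flat_at_def restr_act restr_zero)

lemma flat_at_lam_imp: "flat_at x (act lam c) \<Longrightarrow> flat_at x c"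
  using act_lam_reduced[of "restr x c"] by (simp add: flat_at_def restr_act)

lemma tr_lookup_frag_of_nrm:
  assumes "s x \<noteq> x"
  shows "tr (\<lambda>d. Poly_Mapping.lookup d x) a (act nrm (frag_of x)) = act nrm a"
proof -
  have "(sg ^^ n) (act nrm (frag_of x)) = act nrm (frag_of x)" for n
    using act_lam_nrm[of "frag_of x"] by (induction n) (simp_all add: act_lam_eq_0_iff)
  then show ?thesis by (simp add: tr_def lookup_nrm_frag_of assms act_nrm[of a])
qed


text \<open>
  The first cohomology of a permutation module vanishes. For a cyclic group it is the kernel of the
  norm modulo the image of \<open>\<lambda>\<close>. The proof removes one free orbit at a time; a fixed point
  cannot occur in \<open>l\<close>, since the norm multiplies its coefficient by \<open>p\<close>.
\<close>

lemma nrm_kernel_eq_lam_image: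
  assumes "act nrm l = 0" "Poly_Mapping.keys l \<subseteq> U" and U: "\<And>x. x \<in> U \<Longrightarrow> s x \<in> U"
  shows "\<exists>c. l = act lam c \<and> Poly_Mapping.keys c \<subseteq> U"
  using assms(1,2)
proof (induction "card (Poly_Mapping.keys l)" arbitrary: l rule: less_induct)
  case less
  have Upow: "(s ^^ n) x \<in> U" if "x \<in> U" for n x
    by (induction n) (simp_all add: that U)
  show ?case
  proof (cases "Poly_Mapping.keys l = {}")
    case True
    then show ?thesis by (intro exI[of _ 0]) simp
  next
    case False
    then obtain y where y: "y \<in> Poly_Mapping.keys l" by blast
    have sy: "s y \<noteq> y"
    proof
      assume fixed: "s y = y"
      have "Poly_Mapping.lookup ((sg ^^ i) l) y = Poly_Mapping.lookup l y" for i
      proof -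
        have "(s ^^ i) y = y" by (induction i) (simp_all add: fixed)
        then show ?thesis using lookup_sg_pow[of i l y] by simp
      qed
      then have "Poly_Mapping.lookup (act nrm l) y = int p * Poly_Mapping.lookup l y"
        by (simp add: act_nrm lookup_sum)
      then show False using less.prems(1) y p_pos by (simp add: in_keys_iff)
    qed
    have "eps y (restr y l) = 0"
      using less.prems(1) by (simp add: eps_def restr_act[symmetric])
    then obtain c1 where c1: "c1 \<in> ZO y" "restr y l = act lam c1"
      using eps_0_imp_lam[OF sy restr_ZO] by metis
    let ?l = "l - restr y l"
    have lk: "Poly_Mapping.lookup ?l z = (if z \<in> orb y then 0 else Poly_Mapping.lookup l z)" for z
      by (simp add: lookup_minus lookup_restr)
    have sub: "Poly_Mapping.keys ?l \<subseteq> Poly_Mapping.keys l"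
      by (auto simp: in_keys_iff lk split: if_splits)
    have "y \<notin> Poly_Mapping.keys ?l"
      using orb_pow[of 0 y] by (simp add: in_keys_iff lk)
    then have "card (Poly_Mapping.keys ?l) < card (Poly_Mapping.keys l)"
      using sub y by (intro psubset_card_mono) auto
    moreover have "act nrm ?l = 0"
      by (simp add: act_diff_right less.prems(1) restr_act[symmetric])
    ultimately obtain c2 where c2: "?l = act lam c2" "Poly_Mapping.keys c2 \<subseteq> U"
      using less.hyps[of ?l] sub less.prems(2) by blast
    have "l = act lam (c1 + c2)"
      using c1(2) c2(1) by (simp add: act_add_right algebra_simps)
    moreover have "Poly_Mapping.keys c1 \<subseteq> U"
      using c1(1) y less.prems(2) Upow by (auto simp: ZO_def orb_def)
    then have "Poly_Mapping.keys (c1 + c2) \<subseteq> U" using c2(2) keys_add[of c1 c2] by blast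
    ultimately show ?thesis by blast
  qed
qed

section \<open>Projective ideals in the span of a free orbit\<close>

lemma sum_frag_const: "(\<Sum>j<n. c) = frag_cmul (int n) (c :: 'm \<Rightarrow>\<^sub>0 int)"
  by (induction n) (simp_all add: frag_cmul_distrib algebra_simps)

text \<open>
  Averaging the expansion in integral coordinates over the group yields multiplication by \<open>p\<close>.
\<close>

lemma sum_tr_coordinates:
  assumes "submod K" "coordinates K n a \<chi>" "c \<in> K"
  shows "(\<Sum>i<n. tr (\<chi> i) (a i) c) = frag_cmul (int p) c"
proof -
  have exp: "(\<Sum>i<n. frag_cmul (\<chi> i d) (a i)) = d" if "d \<in> K" for d
    using assms(2) that unfolding coordinates_def by (metis (no_types, lifting))
  have "(\<Sum>i<n. tr (\<chi> i) (a i) c)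
    = (\<Sum>j<p. \<Sum>i<n. frag_cmul (\<chi> i ((sg ^^ (p - j)) c)) ((sg ^^ j) (a i)))"
    unfolding tr_def by (rule sum.swap)
  also have "\<dots> = (\<Sum>j<p. (sg ^^ j) ((sg ^^ (p - j)) c))"
  proof (rule sum.cong)
    fix j assume "j \<in> {..<p}"
    have "(\<Sum>i<n. frag_cmul (\<chi> i ((sg ^^ (p - j)) c)) ((sg ^^ j) (a i)))
      = act (XX ^ j) (\<Sum>i<n. frag_cmul (\<chi> i ((sg ^^ (p - j)) c)) (a i))"
      by (simp add: act_sum_right act_XX_pow act_cmul_right)
    also have "\<dots> = (sg ^^ j) ((sg ^^ (p - j)) c)"
      by (simp add: exp submod_sg_pow assms act_XX_pow)
    finally show "(\<Sum>i<n. frag_cmul (\<chi> i ((sg ^^ (p - j)) c)) ((sg ^^ j) (a i)))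
      = (sg ^^ j) ((sg ^^ (p - j)) c)" .
  qed simp
  also have "\<dots> = (\<Sum>j<p. c)"
  proof (rule sum.cong)
    fix j assume "j \<in> {..<p}"
    then have "(sg ^^ j) ((sg ^^ (p - j)) c) = (sg ^^ (j + (p - j))) c"
      by (metis comp_apply funpow_add)
    also have "\<dots> = c" using \<open>j \<in> {..<p}\<close> by (simp add: sg_pow_p)
    finally show "(sg ^^ j) ((sg ^^ (p - j)) c) = c" .
  qed simp
  finally show ?thesis by (simp add: sum_frag_const)
qed

text \<open>
  An ideal with an element \<open>e\<close> of augmentation 1 is projective. Writing \<open>e = 1 + \<lambda>y\<close>, the
  geometric series \<open>v\<close> of the powers \<open>(-\<lambda>y)\<^sup>i\<close> with \<open>i < p\<close> gives \<open>e v = 1 - (-\<lambda>y)\<^sup>p\<close>, and \<open>\<lambda>\<^sup>p\<close> is divisible by \<open>p\<close>, so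
  \<open>1 = e v + p t\<close>. The first summand contributes the single dual basis element \<open>e v\<close> and the second one
  the elements \<open>t a\<^sub>i\<close> for a \<open>\<int>\<close>-basis \<open>a\<^sub>i\<close>, by lemma \<open>sum_tr_coordinates\<close>.
\<close>

lemma dual_basis_ZO:
  assumes x: "s x \<noteq> x" and K: "submod K" "K \<subseteq> ZO x" and e: "e \<in> K" "eps x e = 1"
  shows "dual_basis K"
proof -
  obtain q where q: "e = act q (frag_of x)" using ZO_cyclic[OF x] K e by blast
  have "poly q 1 = 1" using e q eps_act_frag_of[OF x] by simp
  then have "lam dvd q - 1" by (simp add: dvd_lam_iff)
  then obtain y where y: "q - 1 = lam * y" by (elim dvdE)
  define z where "z = - (lam * y)"
  have qz: "q = 1 - z" using y by (simp add: z_def algebra_simps)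
  define v where "v = (\<Sum>i<p. z ^ i)"
  obtain q1 where q1: "lam ^ p = of_int (int p) * q1 + (XX ^ p - 1)" using lam_pow_p .
  define t where "t = q1 * (- y) ^ p"
  have qv: "1 - z ^ p = q * v" by (simp add: qz v_def one_diff_power_eq)
  have "z ^ p = lam ^ p * (- y) ^ p" by (simp add: z_def power_mult_distrib[symmetric])
  then have zp: "z ^ p = of_int (int p) * t + (- y) ^ p * (XX ^ p - 1)"
    by (simp only: q1 t_def) (simp add: algebra_simps)
  have split: "c = act (q * v) c + frag_cmul (int p) (act t c)" for c
  proof -
    have "act (z ^ p) c = frag_cmul (int p) (act t c)"
      unfolding zp act_add act_mult act_of_int act_diff act_XX_p by simp
    moreover have "act (1 - z ^ p) c = c - act (z ^ p) c" by (simp add: act_diff)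
    ultimately show ?thesis by (simp add: qv)
  qed
  have "\<exists>n a \<chi>. coordinates K n a \<chi>"
    using K by (intro finite_rank_basis[OF finite_orb[of x]]) (auto intro: submod_zero submod_diff simp: ZO_def)
  then obtain n a \<chi> where co: "coordinates K n a \<chi>" by auto
  note co1 = co[unfolded coordinates_def, THEN conjunct1]
  show ?thesis unfolding dual_basis_def
  proof (intro exI conjI allI impI ballI)
    fix i assume i: "i < Suc n"
    show "(if i = n then act v e else act t (a i)) \<in> K"
      using i co1 e K(1) by (auto intro!: submod_act)
    fix c d assume "c \<in> K" "d \<in> K"
    then show "(if i = n then (\<lambda>d. Poly_Mapping.lookup d x) else \<chi> i) (c + d)
      = (if i = n then (\<lambda>d. Poly_Mapping.lookup d x) else \<chi> i) c
      + (if i = n then (\<lambda>d. Poly_Mapping.lookup d x) else \<chi> i) d"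
      using i co1 by (simp add: lookup_add)
  next
    fix c assume c: "c \<in> K"
    have "(\<Sum>i<Suc n. tr (if i = n then (\<lambda>d. Poly_Mapping.lookup d x) else \<chi> i)
        (if i = n then act v e else act t (a i)) c)
      = (\<Sum>i<n. tr (\<chi> i) (act t (a i)) c) + tr (\<lambda>d. Poly_Mapping.lookup d x) (act v e) c"
      by simp
    also have "(\<Sum>i<n. tr (\<chi> i) (act t (a i)) c) = frag_cmul (int p) (act t c)"
      using sum_tr_coordinates[OF K(1) co c]
      by (simp add: tr_act act_sum_right[symmetric] act_cmul_right)
    also have "tr (\<lambda>d. Poly_Mapping.lookup d x) (act v e) c = act (q * v) c"
      using ZO_expand[OF x] c K by (auto simp: q tr_act act_mult act_commute[of q v])
    finally show "c = (\<Sum>i<Suc n. tr (if i = n then (\<lambda>d. Poly_Mapping.lookup d x) else \<chi> i)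
        (if i = n then act v e else act t (a i)) c)"
      using split[of c] by (simp add: add.commute)
  qed
qed


lemma act_lam_pow_nrm_ZO:
  "act (lam ^ k) (act nrm c) = frag_cmul (0 ^ k) (act nrm c)"
  by (simp add: act_fixed[OF act_lam_nrm])

lemma int_prime_bezout:
  assumes "\<not> int p dvd m"
  obtains a b where "a * m + b * int p = 1"
proof -
  have "Factorial_Ring.prime (int p)" using prime_p by simp
  then have "coprime (int p) m" using assms by (simp add: prime_imp_coprime)
  then have "gcd m (int p) = 1" by (simp add: coprime_iff_gcd_eq_1 gcd.commute)
  then show ?thesis using bezout_int[of m "int p"] that by metis
qed

text \<open>
  An ideal \<open>K\<^sub>0\<close> that contains the norm, but not only multiples of it, is \<open>\<lambda>\<^sup>k K\<close> modulo the norm for an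
  ideal \<open>K\<close> with an element of augmentation 1. Take \<open>k\<close> maximal such that \<open>K\<^sub>0\<close> is contained in the ideal
  generated by \<open>\<lambda>\<^sup>k\<close> and the norm. The maximum exists because \<open>\<lambda>\<^sup>p\<close> is divisible by \<open>p\<close>.
\<close>

lemma ideal_lam_saturation:
  assumes x: "s x \<noteq> x" and K0: "submod K0" "K0 \<subseteq> ZO x" "act nrm (frag_of x) \<in> K0"
    and c0: "c0 \<in> K0" "act lam c0 \<noteq> 0"
  obtains k K e where "submod K" "K \<subseteq> ZO x" "act nrm (frag_of x) \<in> K" "e \<in> K" "eps x e = 1"
    "\<And>c. c \<in> K \<Longrightarrow> act (lam ^ k) c \<in> K0"
    "\<And>c. c \<in> K0 \<Longrightarrow> \<exists>d\<in>K. \<exists>n. c = act (lam ^ k) d + frag_cmul n (act nrm (frag_of x))"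
proof -
  let ?N = "act nrm (frag_of x)"
  define Q where "Q k \<longleftrightarrow> (\<forall>c\<in>K0. \<exists>d\<in>ZO x. \<exists>n. c = act (lam ^ k) d + frag_cmul n ?N)" for k
  have "Q 0" using K0(2) by (auto simp: Q_def intro!: exI[of _ 0])
  moreover have "\<exists>k. \<not> Q k"
  proof (rule ccontr)
    assume "\<not> (\<exists>k. \<not> Q k)"
    then have Q: "Q k" for k by blast
    obtain q1 where q1: "lam ^ p = of_int (int p) * q1 + (XX ^ p - 1)" using lam_pow_p .
    have lp: "act (lam ^ p) c = frag_cmul (int p) (act q1 c)" for c
      unfolding q1 act_add act_mult act_of_int act_diff act_XX_p by simp
    have lpm: "\<exists>d'. act ((lam ^ p) ^ m) d = frag_cmul (int p ^ m) d'" for m d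
    proof (induction m arbitrary: d)
      case (Suc m)
      obtain d' where "act ((lam ^ p) ^ m) d = frag_cmul (int p ^ m) d'" using Suc by blast
      then have "act ((lam ^ p) ^ Suc m) d = frag_cmul (int p ^ Suc m) (act q1 d')"
        by (simp add: act_mult lp act_cmul_right mult.commute)
      then show ?case by blast
    qed (auto intro: exI[of _ d])
    have dvd: "int p ^ m dvd Poly_Mapping.lookup (act lam c0) y" for m y
    proof -
      obtain d n where "c0 = act (lam ^ (p * m)) d + frag_cmul n ?N"
        using Q[of "p * m"] c0 by (auto simp: Q_def)
      moreover obtain d' where "act (lam ^ (p * m)) d = frag_cmul (int p ^ m) d'"
        using lpm[of m d] by (auto simp: power_mult)
      ultimately have "act lam c0 = frag_cmul (int p ^ m) (act lam d')"
        by (simp add: act_add_right act_cmul_right act_lam_nrm)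
      then show ?thesis by simp
    qed
    obtain y where y: "Poly_Mapping.lookup (act lam c0) y \<noteq> 0"
      using c0(2) by (metis lookup_zero poly_mapping_eqI)
    define m where "m = nat \<bar>Poly_Mapping.lookup (act lam c0) y\<bar>"
    have "int p ^ m \<le> int m"
      using dvd_imp_le_int[OF y dvd[of m y]] by (simp add: m_def)
    moreover have "m < p ^ m" using prime_gt_1_nat[OF prime_p] by (simp add: power_gt_expt)
    ultimately show False by (metis linorder_not_less of_nat_le_iff of_nat_power)
  qed
  ultimately obtain k where k: "Q k" "\<not> Q (Suc k)"
    using nat_induct[of Q] by metis
  define K where "K = {c \<in> ZO x. act (lam ^ k) c \<in> K0}"
  have subK: "submod K"
    using submod_ZO[of x] K0(1) unfolding submod_def K_def
    by (simp add: act_diff_right act_sg)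
  have NK: "?N \<in> K"
    using K0 submod_cmul[OF K0(1)] by (simp add: K_def nrm_frag_of_ZO act_lam_pow_nrm_ZO)
  have cover: "\<exists>d\<in>K. \<exists>n. c = act (lam ^ k) d + frag_cmul n ?N" if c: "c \<in> K0" for c
  proof -
    obtain d n where d: "d \<in> ZO x" "c = act (lam ^ k) d + frag_cmul n ?N"
      using k(1) c unfolding Q_def by blast
    then have "act (lam ^ k) d = c - frag_cmul n ?N" by simp
    also have "\<dots> \<in> K0" using that K0 by (auto intro!: submod_diff submod_cmul)
    finally show ?thesis using d by (auto simp: K_def)
  qed
  \<comment> \<open>otherwise \<open>K\<close> would be contained in the ideal generated by \<open>\<lambda>\<close> and the norm, against the maximality of \<open>k\<close>\<close>
  have "\<exists>d\<in>K. \<not> int p dvd eps x d"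
  proof (rule ccontr)
    assume "\<not> ?thesis"
    then have all: "int p dvd eps x d" if "d \<in> K" for d using that by blast
    have "Q (Suc k)" unfolding Q_def
    proof
      fix c assume "c \<in> K0"
      then obtain d n where d: "d \<in> K" "c = act (lam ^ k) d + frag_cmul n ?N" using cover by blast
      from all[OF d(1)] obtain m where m: "eps x d = int p * m" by (elim dvdE)
      have "eps x (d - frag_cmul m ?N) = 0"
        by (simp add: eps_diff eps_cmul eps_nrm_frag_of x m)
      moreover have "d - frag_cmul m ?N \<in> ZO x"
        using d by (auto simp: K_def intro!: submod_diff submod_cmul submod_ZO nrm_frag_of_ZO)
      ultimately obtain y where y: "y \<in> ZO x" "d - frag_cmul m ?N = act lam y"
        using eps_0_imp_lam[OF x] by metis
      then have "d = act lam y + frag_cmul m ?N" by (simp add: algebra_simps)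
      then have "c = act (lam ^ Suc k) y + frag_cmul (m * 0 ^ k + n) ?N"
        using d(2) by (simp add: act_add_right act_cmul_right act_lam_pow_nrm_ZO frag_cmul_distrib
            power_commutes[symmetric] act_mult act_commute[of lam] add.assoc)
      then show "\<exists>d\<in>ZO x. \<exists>n. c = act (lam ^ Suc k) d + frag_cmul n ?N" using y(1) by blast
    qed
    then show False using k by blast
  qed
  then obtain d where d: "d \<in> K" "\<not> int p dvd eps x d" by blast
  then obtain a b where ab: "a * eps x d + b * int p = 1" using int_prime_bezout by blast
  have "frag_cmul a d + frag_cmul b ?N \<in> K"
    by (intro submod_add submod_cmul subK d NK)
  moreover have "eps x (frag_cmul a d + frag_cmul b ?N) = 1"
    using ab by (simp add: eps_add eps_cmul eps_nrm_frag_of x)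
  moreover have "K \<subseteq> ZO x" "\<And>c. c \<in> K \<Longrightarrow> act (lam ^ k) c \<in> K0" by (auto simp: K_def)
  ultimately show ?thesis using that[of K _ k] subK NK cover by blast
qed


section \<open>Adding one orbit\<close>

text \<open>
  Passage from \<open>E\<^sub>0\<close> to \<open>E\<close>, where \<open>E\<^sub>0\<close> is the part of \<open>E\<close> that is constant on one free orbit. The set
  \<open>C\<close> of candidates is the set of elements of \<open>E\<close> that generate \<open>E\<close> modulo \<open>E\<^sub>0\<close> and \<open>\<lambda>E\<close>; as
  that quotient has order \<open>p\<close>, these are the ones whose restriction corresponds to an element of \<open>K\<close> with
  augmentation prime to \<open>p\<close>. The norm of any candidate, multiplied by any integer \<open>n\<close> prime to \<open>p\<close> and
  changed by any \<open>p z\<close> with \<open>z\<close> fixed, is again the norm of a candidate \<open>l'\<close>, and it generates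
  \<open>P \<inter> E\<^sub>0\<close> for a projective \<open>P\<close> with \<open>E = P + E\<^sub>0\<close>.
\<close>

lemma orbit_step:
  assumes x: "s x \<noteq> x" and E: "submod E"
    and E0_def: "E0 = {c \<in> E. flat_at x c}" and ne: "E \<noteq> E0"
    and H1: "\<forall>l\<in>E. act nrm l = 0 \<longrightarrow> (\<exists>l'\<in>E. l = act lam l')"
  shows "\<exists>C. C \<noteq> {} \<and> C \<subseteq> E \<and> (\<forall>l\<in>C. \<forall>m\<in>E0. l + m \<in> C) \<and> (\<forall>l\<in>C. act nrm l \<noteq> 0) \<and>
    (\<forall>l\<in>C. \<forall>n z. \<not> int p dvd n \<longrightarrow> z \<in> E \<longrightarrow> sg z = z \<longrightarrow>
      (\<exists>P l'. l' \<in> C \<and> act nrm l' = frag_cmul n (act nrm l) + frag_cmul (int p) z \<and>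
        submod P \<and> P \<subseteq> E \<and> dual_basis P \<and> act nrm l' \<in> P \<and>
        (\<forall>c\<in>E. \<exists>u\<in>P. c - u \<in> E0) \<and> (\<forall>c\<in>P. c \<in> E0 \<longrightarrow> (\<exists>k. c = frag_cmul k (act nrm l')))))"
proof -
  let ?w = "frag_of x"
  let ?N = "act nrm (frag_of x)"
  have prime_int: "Factorial_Ring.prime (int p)" using prime_p by simp
  \<comment> \<open>the ideal of restrictions to the orbit, enlarged by the norm\<close>
  define K0 where "K0 = {c. \<exists>l\<in>E. \<exists>n. c = restr x l + frag_cmul n ?N}"
  have K0_sub: "submod K0"
  proof -
    have "0 \<in> K0" unfolding K0_def using submod_zero[OF E]
      by (auto intro!: bexI[of _ 0] exI[of _ 0])
    moreover have "c - d \<in> K0" if "c \<in> K0" "d \<in> K0" for c d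
    proof -
      from that obtain l n l' n' where "l \<in> E" "c = restr x l + frag_cmul n ?N"
        "l' \<in> E" "d = restr x l' + frag_cmul n' ?N" by (auto simp: K0_def)
      then show ?thesis unfolding K0_def
        by (auto intro!: bexI[of _ "l - l'"] exI[of _ "n - n'"] submod_diff E
            simp: restr_diff frag_cmul_diff_distrib)
    qed
    moreover have "sg c \<in> K0" if "c \<in> K0" for c
    proof -
      from that obtain l n where "l \<in> E" "c = restr x l + frag_cmul n ?N" by (auto simp: K0_def)
      moreover have "sg ?N = ?N" using act_lam_nrm act_lam_eq_0_iff by blast
      ultimately show ?thesis unfolding K0_def
        by (auto intro!: bexI[of _ "sg l"] exI[of _ n] submod_sg E simp: restr_sg sg_add sg_cmul)
    qed
    ultimately show ?thesis by (simp add: submod_def)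
  qed
  have K0_ZO: "K0 \<subseteq> ZO x"
    by (auto simp: K0_def intro!: submod_add[OF submod_ZO] submod_cmul[OF submod_ZO] restr_ZO nrm_frag_of_ZO)
  have restr_K0: "restr x l \<in> K0" if "l \<in> E" for l
    using that by (auto simp: K0_def intro!: bexI[of _ l] exI[of _ 0])
  have N_K0: "?N \<in> K0"
    using submod_zero[OF E] by (auto simp: K0_def intro!: bexI[of _ 0] exI[of _ 1])
  obtain c0 where "c0 \<in> E" "\<not> flat_at x c0" using ne E0_def by auto
  then have c0: "restr x c0 \<in> K0" "act lam (restr x c0) \<noteq> 0" using restr_K0 by (auto simp: flat_at_def)
  obtain k K e where K: "submod K" "K \<subseteq> ZO x" "?N \<in> K" and e: "e \<in> K" "eps x e = 1"
    and K_in: "\<And>c. c \<in> K \<Longrightarrow> act (lam ^ k) c \<in> K0"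
    and K_cover: "\<And>c. c \<in> K0 \<Longrightarrow> \<exists>d\<in>K. \<exists>n. c = act (lam ^ k) d + frag_cmul n ?N"
    using ideal_lam_saturation[OF x K0_sub K0_ZO N_K0 c0] by metis
  have db: "dual_basis K" by (rule dual_basis_ZO[OF x K(1,2) e])
  have lift1: "\<exists>l\<in>E. act lam (restr x l) = act (lam ^ Suc k) a" if a: "a \<in> K" for a
  proof -
    obtain l n where l: "l \<in> E" "act (lam ^ k) a = restr x l + frag_cmul n ?N"
      using K_in[OF a] by (auto simp: K0_def)
    have "act (lam ^ Suc k) a = act lam (restr x l)"
      by (simp add: act_mult l(2) act_add_right act_cmul_right act_lam_nrm)
    then show ?thesis using l(1) by auto
  qed
  have unlift1: "\<exists>r\<in>K. act lam (restr x l) = act (lam ^ Suc k) r" if l: "l \<in> E" for l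
  proof -
    obtain d n where d: "d \<in> K" "restr x l = act (lam ^ k) d + frag_cmul n ?N"
      using K_cover[OF restr_K0[OF l]] by blast
    then show ?thesis
      by (auto intro!: bexI[of _ d] simp: act_mult act_add_right act_cmul_right act_lam_nrm)
  qed
  \<comment> \<open>\<open>restr x l\<close> is congruent to \<open>\<lambda>\<^sup>k r\<close> modulo fixed elements; applying \<open>\<lambda>\<close> turns this into an equation\<close>
  define C where "C = {l \<in> E. \<exists>r\<in>K. \<not> int p dvd eps x r \<and> act lam (restr x l) = act (lam ^ Suc k) r}"
  have C_ne: "C \<noteq> {}"
  proof -
    obtain l where "l \<in> E" "act lam (restr x l) = act (lam ^ Suc k) e" using lift1[OF e(1)] by blast
    then have "l \<in> C" using e prime_gt_1_nat[OF prime_p] by (auto simp: C_def intro!: bexI[of _ e])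
    then show ?thesis by blast
  qed
  have C_add: "l + m \<in> C" if "l \<in> C" "m \<in> E0" for l m
    using that by (auto simp: C_def E0_def flat_at_def restr_add act_add_right intro!: submod_add E)
  have C_nrm: "act nrm l \<noteq> 0" if l: "l \<in> C" for l
  proof
    assume 0: "act nrm l = 0"
    obtain r where r: "l \<in> E" "r \<in> K" "\<not> int p dvd eps x r" "act lam (restr x l) = act (lam ^ Suc k) r"
      using l by (auto simp: C_def)
    obtain l' where l': "l' \<in> E" "l = act lam l'" using H1 r(1) 0 by blast
    obtain r' where r': "r' \<in> K" "act lam (restr x l') = act (lam ^ Suc k) r'" using unlift1[OF l'(1)] by blast
    have "act (lam ^ Suc k) r = act lam (act lam (restr x l'))" using r(4) l'(2) by (simp add: restr_act)
    also have "\<dots> = act (lam ^ Suc k) (act lam r')" by (simp only: r'(2) act_commute[of lam])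
    finally have "act (lam ^ Suc k) (r - act lam r') = 0" by (simp add: act_diff_right)
    then have "act lam (r - act lam r') = 0" by (rule act_lam_pow_reduced)
    moreover have "r - act lam r' \<in> ZO x" using r r' K submod_diff submod_act by blast
    ultimately obtain j where "r - act lam r' = frag_cmul j ?N" using ZO_fixed[OF x] by blast
    then have "r = act lam r' + frag_cmul j ?N" by (simp add: algebra_simps)
    then have "eps x r = j * int p" by (simp add: eps_add eps_lam eps_cmul eps_nrm_frag_of x)
    then show False using r(3) by simp
  qed
  obtain \<phi> where \<phi>: "\<And>c. c \<in> K \<Longrightarrow> \<phi> c \<in> E" "\<And>c. c \<in> K \<Longrightarrow> act lam (restr x (\<phi> c)) = act (lam ^ Suc k) c"
    "\<And>c d. c \<in> K \<Longrightarrow> d \<in> K \<Longrightarrow> \<phi> (c + d) = \<phi> c + \<phi> d" "\<And>c. c \<in> K \<Longrightarrow> \<phi> (sg c) = sg (\<phi> c)"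
    by (rule dual_basis_lift[OF K(1) db E, of "\<lambda>c. act lam (restr x c)" "act (lam ^ Suc k)"])
      ((simp_all only: restr_add act_add_right restr_sg act_sg lift1)[5], rule that)
  note \<phi>_hom = hom_act[OF K(1) _ \<phi>(3,4)]
  show ?thesis
  proof (rule exI[of _ C], intro conjI C_ne ballI allI impI)
    show "C \<subseteq> E" by (auto simp: C_def)
    show "l + m \<in> C" if "l \<in> C" "m \<in> E0" for l m using C_add that .
    show "act nrm l \<noteq> 0" if "l \<in> C" for l using C_nrm that .
    fix l n z assume l: "l \<in> C" and n: "\<not> int p dvd n" and z: "z \<in> E" "sg z = z"
    obtain r where r: "l \<in> E" "r \<in> K" "\<not> int p dvd eps x r" "act lam (restr x l) = act (lam ^ Suc k) r"
      using l by (auto simp: C_def)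
    obtain c' d' where cd: "c' * eps x r + d' * int p = 1" using int_prime_bezout[OF r(3)] .
    have "\<not> int p dvd n * eps x r" using n r(3) prime_int by (simp add: prime_dvd_mult_iff)
    then obtain u v rr where u: "[poly u 1 = n * eps x r] (mod int p)" and uv: "u * v = 1 + rr * nrm"
      using unit_poly by metis
    have pu: "\<not> int p dvd poly u 1"
      using u \<open>\<not> int p dvd n * eps x r\<close> cong_dvd_iff by blast
    obtain t where t: "n = poly u 1 * c' + int p * t"
    proof -
      have "[poly u 1 * c' = n * (eps x r * c')] (mod int p)"
        using cong_mult[OF u cong_refl, of c'] by (simp add: ac_simps)
      moreover have "[eps x r * c' = 1] (mod int p)"
        unfolding cong_iff_dvd_diff by (rule dvdI[of _ _ "- d'"]) (use cd in \<open>simp add: algebra_simps\<close>)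
      then have "[n * (eps x r * c') = n * 1] (mod int p)" by (rule cong_mult[OF cong_refl])
      ultimately have "[n = poly u 1 * c'] (mod int p)" using cong_trans cong_sym by (metis mult.right_neutral)
      then obtain t where "n - poly u 1 * c' = int p * t" by (auto simp: cong_iff_dvd_diff elim: dvdE)
      then show ?thesis using that[of t] by (simp add: algebra_simps)
    qed
    \<comment> \<open>The map \<open>\<phi>\<close> need not send \<open>r\<close> to \<open>l\<close>. It is corrected by a multiple of \<open>c \<mapsto> c m\<close>, twisted by
      the unit \<open>u\<close>, and shifted by the fixed element \<open>Z\<close> times the augmentation; \<open>Z\<close> is determined by the
      required norm.\<close>
    define m where "m = l - \<phi> r"
    have m: "m \<in> E" "act lam (restr x m) = 0"
      using r \<phi> by (auto simp: m_def restr_diff act_diff_right intro!: submod_diff E)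
    define A where "A = \<phi> ?N"
    have A: "A \<in> E" "act lam A = 0"
      using \<phi>(1) K(3) \<phi>_hom(3)[OF K(3), of lam, symmetric] \<phi>_hom(1)[OF K(3)]
      by (simp_all add: A_def act_lam_nrm)
    have A_eq: "frag_cmul (eps x r) A = act nrm l - act nrm m"
    proof -
      have "frag_cmul (eps x r) A = \<phi> (act nrm r)"
        using act_nrm_ZO[OF x, of r] r K by (auto simp: A_def \<phi>_hom(2))
      also have "\<dots> = act nrm (\<phi> r)" using r by (simp add: \<phi>_hom(3))
      finally show ?thesis by (simp add: m_def act_diff_right)
    qed
    define Z where "Z = z + frag_cmul t (act nrm l) + frag_cmul (- (poly u 1 * d')) A"
    have Z: "Z \<in> E" "act lam Z = 0"
      using z r A
      by (auto simp: Z_def act_add_right act_cmul_right act_lam_nrm act_lam_eq_0_iff[symmetric]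
          intro!: submod_add submod_cmul submod_act E)
    define mu where "mu = tr (\<lambda>d. Poly_Mapping.lookup d x) m"
    have mu_add: "mu (c + d) = mu c + mu d" for c d
      unfolding mu_def by (rule tr_add[of UNIV]) (simp_all add: submod_def lookup_add)
    have mu_sg: "mu (sg c) = sg (mu c)" for c by (simp add: mu_def tr_sg)
    have mu_E: "mu c \<in> E" for c unfolding mu_def by (rule tr_closed[OF E m(1)])
    have mu_flat: "act lam (restr x (mu c)) = 0" for c
    proof -
      obtain q where "\<forall>a. tr (\<lambda>d. Poly_Mapping.lookup d x) a c = act q a" using tr_lookup_eq_act by metis
      then have "mu c = act q m" by (simp add: mu_def)
      then show ?thesis using m(2) by (simp add: restr_act act_commute[of lam])
    qed
    have mu_N: "mu ?N = act nrm m" by (simp add: mu_def tr_lookup_frag_of_nrm x)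
    define \<psi> where "\<psi> c = \<phi> (act u c) + frag_cmul c' (mu (act u c)) + frag_cmul (eps x c) Z" for c
    have uK: "act u c \<in> K" if "c \<in> K" for c using that K by (simp add: submod_act)
    have \<psi>_E: "\<psi> c \<in> E" if "c \<in> K" for c
      using that uK by (auto simp: \<psi>_def intro!: submod_add submod_cmul E mu_E \<phi>(1) Z)
    have \<psi>_add: "\<psi> (c + d) = \<psi> c + \<psi> d" if "c \<in> K" "d \<in> K" for c d
      using that uK by (simp add: \<psi>_def act_add_right \<phi>(3) mu_add eps_add frag_cmul_distrib frag_cmul_distrib2)
    have \<psi>_sg: "\<psi> (sg c) = sg (\<psi> c)" if "c \<in> K" for c
    proof -
      have "sg Z = Z" using Z by (simp add: act_lam_eq_0_iff)
      moreover have "eps x (sg c) = eps x c"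
        using eps_lam[of x c] by (simp add: act_lam eps_diff)
      ultimately show ?thesis
        using that uK by (simp add: \<psi>_def act_sg \<phi>(4) mu_sg sg_add sg_cmul)
    qed
    note \<psi>_hom = hom_act[OF K(1) _ \<psi>_add \<psi>_sg]
    have \<psi>_flat: "act lam (restr x (\<psi> c)) = act (lam ^ Suc k * u) c" if "c \<in> K" for c
    proof -
      have "act lam (restr x Z) = 0" using Z(2) by (metis restr_act restr_zero)
      then show ?thesis
        using that uK by (simp add: \<psi>_def restr_add restr_cmul act_add_right act_cmul_right mu_flat \<phi>(2) act_mult)
    qed
    have \<psi>_N: "\<psi> ?N = frag_cmul n (act nrm l) + frag_cmul (int p) z"
    proof -
      have uN: "act u ?N = frag_cmul (poly u 1) ?N" by (rule act_fixed[OF act_lam_nrm])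
      have mu_uN: "mu (act u ?N) = frag_cmul (poly u 1) (act nrm m)"
      proof -
        have "mu (frag_cmul j c) = frag_cmul j (mu c)" for j c
          using hom_act(2)[of UNIV c mu j] mu_add mu_sg by (simp add: submod_def)
        then show ?thesis by (simp add: uN mu_N)
      qed
      have mm: "act nrm m = act nrm l - frag_cmul (eps x r) A" using A_eq by simp
      have "\<psi> ?N = frag_cmul (poly u 1) A + frag_cmul c' (frag_cmul (poly u 1) (act nrm m)) + frag_cmul (int p) Z"
        by (simp add: \<psi>_def mu_uN[unfolded uN] uN \<phi>_hom(2) K(3) A_def eps_nrm_frag_of x)
      also have "\<dots> = frag_cmul n (act nrm l) + frag_cmul (int p) z"
      proof (rule poly_mapping_eqI)
        fix y
        let ?a = "Poly_Mapping.lookup A y" and ?l = "Poly_Mapping.lookup (act nrm l) y"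
          and ?z = "Poly_Mapping.lookup z y" and ?u = "poly u 1"
        have "?u * ?a + c' * (?u * (?l - eps x r * ?a)) + int p * (?z + t * ?l - ?u * d' * ?a)
          = (?u * c' + int p * t) * ?l + int p * ?z + ?u * ?a * (1 - (c' * eps x r + d' * int p))"
          by (simp add: algebra_simps)
        also have "\<dots> = n * ?l + int p * ?z" by (simp only: cd t) simp
        finally         show "Poly_Mapping.lookup (frag_cmul ?u A + frag_cmul c' (frag_cmul ?u (act nrm m)) + frag_cmul (int p) Z) y
          = Poly_Mapping.lookup (frag_cmul n (act nrm l) + frag_cmul (int p) z) y"
          by (simp add: mm Z_def lookup_add lookup_minus)
      qed
      finally show ?thesis .
    qed
    \<comment> \<open>as \<open>e\<close> has augmentation 1, the norm of \<open>\<psi> e\<close> is the image under \<open>\<psi>\<close> of the norm of the base point\<close>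
    define l' where "l' = \<psi> e"
    have b: "act nrm l' = \<psi> ?N"
      using \<psi>_hom(3)[OF e(1), of nrm] act_nrm_ZO[OF x, of e] e K by (auto simp: l'_def)
    have l'_C: "l' \<in> C"
    proof -
      have "eps x (act u e) = poly u 1" using eps_act[OF x, of e u] e K by auto
      then have "\<not> int p dvd eps x (act u e)" using pu by simp
      moreover have "act lam (restr x l') = act (lam ^ Suc k) (act u e)"
        using \<psi>_flat[OF e(1)] by (simp add: l'_def act_mult)
      ultimately show ?thesis
        unfolding C_def using \<psi>_E[OF e(1)] uK[OF e(1)] by (auto simp only: l'_def mem_Collect_eq)
    qed
    have uv_act: "act (lam ^ Suc k * u * v) c = act (lam ^ Suc k) c" for c
    proof -
      have "lam ^ Suc k * u * v = lam ^ Suc k + (lam ^ k * rr) * (lam * nrm)"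
        using uv by (simp add: mult.assoc) (simp add: algebra_simps)
      then show ?thesis
        by (simp only: act_add act_mult act_lam_nrm act_zero_right add_0_right)
    qed
    have flat_imp: "\<exists>j. c = frag_cmul j ?N" if c: "c \<in> K" and 0: "act (lam ^ Suc k * u) c = 0" for c
    proof -
      have "act (lam ^ Suc k * u * v) c = 0"
        by (simp only: mult.commute[of _ v] act_mult[of v] 0 act_zero_right)
      then have "act (lam ^ Suc k) c = 0" by (simp only: uv_act)
      then have "act lam c = 0" by (rule act_lam_pow_reduced)
      then show ?thesis using ZO_fixed[OF x] c K by blast
    qed
    have \<psi>_cN: "\<psi> (frag_cmul j ?N) = frag_cmul j (act nrm l')" for j
      using \<psi>_hom(2)[OF K(3)] b by simp
    have inj: "c = 0" if c: "c \<in> K" "\<psi> c = 0" for c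
    proof -
      have "act (lam ^ Suc k * u) c = 0" using \<psi>_flat[OF c(1)] c(2) by simp
      then obtain j where j: "c = frag_cmul j ?N" using flat_imp c(1) by blast
      then show ?thesis using c(2) \<psi>_cN C_nrm[OF l'_C] by simp
    qed
    have "submod (\<psi> ` K)"
    proof -
      have "0 \<in> \<psi> ` K" using \<psi>_hom(1)[OF K(3)] submod_zero[OF K(1)] by force
      moreover have "c - d \<in> \<psi> ` K" if cd: "c \<in> \<psi> ` K" "d \<in> \<psi> ` K" for c d
      proof -
        obtain c1 d1 where "c1 \<in> K" "c = \<psi> c1" "d1 \<in> K" "d = \<psi> d1" using cd by blast
        moreover have "c1 - d1 \<in> K" using calculation by (simp add: submod_diff K)
        moreover have "\<psi> (c1 - d1) = \<psi> c1 - \<psi> d1"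
          by (rule additive_diff[of K]) (use calculation \<psi>_add in auto)
        ultimately show ?thesis by (metis imageI)
      qed
      moreover have "sg c \<in> \<psi> ` K" if c: "c \<in> \<psi> ` K" for c
        using c \<psi>_sg submod_sg[OF K(1)] by (metis (no_types, lifting) image_iff)
      ultimately show ?thesis by (simp add: submod_def)
    qed
    moreover have "\<psi> ` K \<subseteq> E" using \<psi>_E by blast
    moreover have "dual_basis (\<psi> ` K)"
      by (rule dual_basis_iso[OF K(1) db \<psi>_add \<psi>_sg inj])
    moreover have "act nrm l' \<in> \<psi> ` K" using b K(3) by simp
    moreover have "\<exists>u\<in>\<psi> ` K. c - u \<in> E0" if c: "c \<in> E" for c
    proof -
      obtain d where d: "d \<in> K" "act lam (restr x c) = act (lam ^ Suc k) d" using unlift1[OF c] by blast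
      have vd: "act v d \<in> K" using d K by (simp add: submod_act)
      have "act (lam ^ Suc k * u) (act v d) = act (lam ^ Suc k) d"
        by (simp only: uv_act flip: act_mult)
      then have "flat_at x (c - \<psi> (act v d))"
        using \<psi>_flat[OF vd] d(2) by (simp add: flat_at_def restr_diff act_diff_right)
      moreover have "c - \<psi> (act v d) \<in> E" using c \<psi>_E[OF vd] by (simp add: submod_diff E)
      ultimately show ?thesis using vd by (auto simp: E0_def)
    qed
    moreover have "\<exists>j. c = frag_cmul j (act nrm l')" if c: "c \<in> \<psi> ` K" "c \<in> E0" for c
    proof -
      obtain d where d: "d \<in> K" "c = \<psi> d" using c by blast
      then have "act (lam ^ Suc k * u) d = 0" using \<psi>_flat c(2) by (simp add: E0_def flat_at_def)
      then obtain j where "d = frag_cmul j ?N" using flat_imp d(1) by blast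
      then show ?thesis using \<psi>_cN d(2) by blast
    qed
    moreover have "act nrm l' = frag_cmul n (act nrm l) + frag_cmul (int p) z" using b \<psi>_N by simp
    ultimately show "\<exists>P l'. l' \<in> C \<and> act nrm l' = frag_cmul n (act nrm l) + frag_cmul (int p) z \<and>
        submod P \<and> P \<subseteq> E \<and> dual_basis P \<and> act nrm l' \<in> P \<and>
        (\<forall>c\<in>E. \<exists>u\<in>P. c - u \<in> E0) \<and> (\<forall>c\<in>P. c \<in> E0 \<longrightarrow> (\<exists>k. c = frag_cmul k (act nrm l')))"
      using l'_C by (intro exI[of _ "\<psi> ` K"] exI[of _ l']) blast
  qed
qed

end


section \<open>Decomposition of stable subgroups with vanishing first cohomology\<close>

text \<open>
  A submodule \<open>L\<close> of the permutation module with vanishing first cohomology, together with a strict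
  well-order \<open>lt\<close> of the basis.
\<close>

locale ordered_H1_module = prime_cyclic_perm s p for s :: "'m \<Rightarrow> 'm" and p +
  fixes lt :: "'m \<Rightarrow> 'm \<Rightarrow> bool" and L :: "('m \<Rightarrow>\<^sub>0 int) set"
  assumes wf: "wfp lt" and trans: "lt x y \<Longrightarrow> lt y z \<Longrightarrow> lt x z"
    and total: "x \<noteq> y \<Longrightarrow> lt x y \<or> lt y x"
    and L: "submod L"
    and H1: "l \<in> L \<Longrightarrow> act nrm l = 0 \<Longrightarrow> \<exists>l'\<in>L. l = act lam l'"
begin

lemma irrefl: "\<not> lt x x"
  using wf by (induction x rule: wfp_induct_rule) blast

lemma finite_max:
  assumes "finite A" "A \<noteq> {}"
  obtains m where "m \<in> A" "\<And>x. x \<in> A \<Longrightarrow> x = m \<or> lt x m"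
proof -
  have "\<exists>m\<in>A. \<forall>x\<in>A. x = m \<or> lt x m"
    using assms
  proof (induction A rule: finite_ne_induct)
    case (insert a A)
    then obtain m where m: "m \<in> A" "\<And>x. x \<in> A \<Longrightarrow> x = m \<or> lt x m" by blast
    show ?case
    proof (cases "lt m a")
      case True
      then show ?thesis using m trans by (intro bexI[of _ a]) blast+
    next
      case False
      then show ?thesis using m total[of a m] by (intro bexI[of _ m]) blast+
    qed
  qed simp
  then show ?thesis using that by blast
qed

lemma wf_min:
  assumes "Q x"
  obtains m where "Q m" "\<And>y. Q y \<Longrightarrow> y = m \<or> lt m y"
proof -
  obtain m where "Q m" "\<And>y. lt y m \<Longrightarrow> \<not> Q y"
    using wfp_on_iff_ex_minimal[of UNIV lt] wf assms
    by (metis (mono_tags, lifting) UNIV_I mem_Collect_eq subset_UNIV empty_iff)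
  then show ?thesis using that total by blast
qed

text \<open>
  The least point of each free orbit.
\<close>

definition reps :: "'m set"
  where "reps = {x. s x \<noteq> x \<and> (\<forall>y\<in>orb x. y = x \<or> lt x y)}"

lemma orb_refl: "x \<in> orb x"
  using orb_pow[of 0 x] by simp

lemma orb_sym: "y \<in> orb x \<Longrightarrow> x \<in> orb y"
proof -
  assume "y \<in> orb x"
  then obtain j where "j < p" "y = (s ^^ j) x" by (auto simp: orb_def)
  then have "x = (s ^^ (p - j)) y" using s_pow_complement[of j x] by simp
  then show ?thesis by (auto simp: orb_iff)
qed

lemma orb_trans: "z \<in> orb y \<Longrightarrow> y \<in> orb x \<Longrightarrow> z \<in> orb x"
  by (auto simp: orb_iff) (metis comp_apply funpow_add)

lemma rep_exists:
  assumes "s y \<noteq> y"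
  obtains x where "x \<in> reps" "y \<in> orb x"
proof -
  obtain x where x: "x \<in> orb y" "\<And>z. z \<in> orb y \<Longrightarrow> z = x \<or> lt x z"
    using wf_min[of "\<lambda>x. x \<in> orb y" y] orb_refl by blast
  have y: "y \<in> orb x" using orb_sym x(1) .
  have "s x \<noteq> x"
  proof
    assume "s x = x"
    then have "(s ^^ n) x = x" for n by (induction n) simp_all
    then have "y = x" using y by (auto simp: orb_iff)
    then show False using assms \<open>s x = x\<close> by simp
  qed
  moreover have "z = x \<or> lt x z" if "z \<in> orb x" for z
    using x(2) orb_trans[OF that x(1)] .
  ultimately have "x \<in> reps" by (simp add: reps_def)
  then show ?thesis using that y by blast
qed

text \<open>
  The fixed elements of \<open>L\<close>, and the filtration by the orbits on which an element need not be constant.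
  For a representative \<open>x\<close> of a free orbit, \<open>Llt x\<close> contains all earlier steps as well as \<open>L0\<close>.
\<close>

definition L0 :: "('m \<Rightarrow>\<^sub>0 int) set"
  where "L0 = {l \<in> L. act lam l = 0}"

definition Lle :: "'m \<Rightarrow> ('m \<Rightarrow>\<^sub>0 int) set"
  where "Lle x = {l \<in> L. \<forall>y\<in>reps. lt x y \<longrightarrow> flat_at y l}"

definition Llt :: "'m \<Rightarrow> ('m \<Rightarrow>\<^sub>0 int) set"
  where "Llt x = {l \<in> Lle x. flat_at x l}"

lemma submod_L0: "submod L0"
  using L unfolding submod_def L0_def by (simp add: act_diff_right act_sg)

lemma submod_Lle: "submod (Lle x)"
  using L unfolding submod_def Lle_def by (simp add: flat_at_zero flat_at_diff flat_at_sg)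

lemma submod_Llt: "submod (Llt x)"
  using submod_Lle unfolding submod_def Llt_def by (simp add: flat_at_zero flat_at_diff flat_at_sg)

lemma L0_Llt: "L0 \<subseteq> Llt x"
  by (auto simp: L0_def Llt_def Lle_def flat_at_fixed)

lemma L0_flat: "l \<in> L0 \<Longrightarrow> flat_at x l"
  by (simp add: L0_def flat_at_fixed)

lemma L0_I:
  assumes "l \<in> L" "\<And>y. y \<in> reps \<Longrightarrow> flat_at y l"
  shows "l \<in> L0"
proof -
  have "Poly_Mapping.lookup (act lam l) y = 0" for y
  proof (cases "s y = y")
    case True
    then show ?thesis using lookup_sg[of l y] by (simp add: act_lam lookup_minus)
  next
    case False
    then obtain x where "x \<in> reps" "y \<in> orb x" using rep_exists by blast
    then show ?thesis using assms(2)[of x] lookup_restr[of x "act lam l" y]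
      by (simp add: flat_at_def restr_act[symmetric])
  qed
  then show ?thesis using assms(1) by (simp add: L0_def poly_mapping_eqI)
qed

lemma finite_not_flat: "finite {y \<in> reps. \<not> flat_at y l}"
proof (rule finite_subset)
  show "{y \<in> reps. \<not> flat_at y l} \<subseteq> (\<Union>z\<in>Poly_Mapping.keys l. orb z)"
  proof
    fix y assume "y \<in> {y \<in> reps. \<not> flat_at y l}"
    then have "restr y l \<noteq> 0" by (auto simp: flat_at_def)
    then obtain z where "Poly_Mapping.lookup (restr y l) z \<noteq> 0"
      by (metis lookup_zero poly_mapping_eqI)
    then have "z \<in> orb y" "z \<in> Poly_Mapping.keys l"
      by (auto simp: lookup_restr in_keys_iff split: if_splits)
    then show "y \<in> (\<Union>z\<in>Poly_Mapping.keys l. orb z)" using orb_sym by blast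
  qed
  show "finite (\<Union>z\<in>Poly_Mapping.keys l. orb z)" by (simp add: finite_orb)
qed

lemma nrm_L0: "l \<in> L \<Longrightarrow> act nrm l \<in> L0"
  by (simp add: L0_def submod_act L act_lam_nrm)

text \<open>
  The leading position is the largest point of the support; \<open>supp_le y c\<close> bounds it by \<open>y\<close>.
\<close>

definition supp_le :: "'m \<Rightarrow> ('m \<Rightarrow>\<^sub>0 int) \<Rightarrow> bool"
  where "supp_le y c \<longleftrightarrow> (\<forall>z\<in>Poly_Mapping.keys c. z = y \<or> lt z y)"

lemma supp_le_diff: "supp_le y c \<Longrightarrow> supp_le y d \<Longrightarrow> supp_le y (c - d)"
  and supp_le_add: "supp_le y c \<Longrightarrow> supp_le y d \<Longrightarrow> supp_le y (c + d)"
  and supp_le_cmul: "supp_le y c \<Longrightarrow> supp_le y (frag_cmul k c)"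
  using keys_diff[of c d] keys_add[of c d] by (auto simp: supp_le_def)

lemma supp_le_lookup: "supp_le y c \<Longrightarrow> lt y z \<Longrightarrow> Poly_Mapping.lookup c z = 0"
  unfolding supp_le_def using irrefl trans by (metis in_keys_iff)

lemma leading_exists:
  assumes "c \<noteq> 0"
  obtains y where "supp_le y c" "Poly_Mapping.lookup c y \<noteq> 0"
  using finite_max[of "Poly_Mapping.keys c"] assms unfolding supp_le_def
  by (metis finite_keys in_keys_iff keys_eq_empty)

lemma leading_less:
  assumes "c \<noteq> 0" "supp_le y c" "Poly_Mapping.lookup c y = 0"
  obtains y' where "supp_le y' c" "lt y' y" "Poly_Mapping.lookup c y' \<noteq> 0"
  using leading_exists[OF assms(1)] assms(2,3) unfolding supp_le_def by (metis in_keys_iff)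

text \<open>
  The leading positions of the fixed elements of \<open>L\<close>.
\<close>

definition leads :: "'m set"
  where "leads = {y. \<exists>c\<in>L0. supp_le y c \<and> Poly_Mapping.lookup c y \<noteq> 0}"

text \<open>
  A fixed element supported up to \<open>y\<close> whose coefficient at \<open>y\<close> divides the coefficient at \<open>y\<close> of all such
  elements. For \<open>y\<close> in \<open>leads\<close> these form a triangular basis of \<open>L0\<close>.
\<close>

definition lead_gen :: "'m \<Rightarrow> ('m \<Rightarrow>\<^sub>0 int)"
  where "lead_gen y = (SOME d. d \<in> L0 \<and> supp_le y d \<and>
    (\<forall>c\<in>L0. supp_le y c \<longrightarrow> Poly_Mapping.lookup d y dvd Poly_Mapping.lookup c y))"

lemma lead_gen_props: "lead_gen y \<in> L0 \<and> supp_le y (lead_gen y) \<and>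
    (\<forall>c\<in>L0. supp_le y c \<longrightarrow> Poly_Mapping.lookup (lead_gen y) y dvd Poly_Mapping.lookup c y)"
proof -
  let ?A = "{c \<in> L0. supp_le y c}"
  let ?S = "(\<lambda>c. Poly_Mapping.lookup c y) ` ?A"
  have "0 \<in> ?A" using submod_zero[OF submod_L0] by (simp add: supp_le_def)
  have "\<exists>g\<in>?S. \<forall>x\<in>?S. g dvd x"
  proof (rule int_subgroup_generator[of ?S])
    show "0 \<in> ?S" using \<open>0 \<in> ?A\<close> by (intro image_eqI[of _ _ 0]) simp_all
  next
    fix u v assume uv: "u \<in> ?S" "v \<in> ?S"
    obtain c d where cd: "c \<in> ?A" "d \<in> ?A" "u = Poly_Mapping.lookup c y" "v = Poly_Mapping.lookup d y"
      using uv by blast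
    then have "c - d \<in> ?A" by (simp add: submod_diff submod_L0 supp_le_diff)
    then show "u - v \<in> ?S" using cd by (intro image_eqI[of _ _ "c - d"]) (simp_all add: lookup_minus)
  next
    fix g assume "g \<in> ?S" "\<And>x. x \<in> ?S \<Longrightarrow> g dvd x"
    then show ?thesis by blast
  qed
  then have "\<exists>d. d \<in> L0 \<and> supp_le y d \<and>
    (\<forall>c\<in>L0. supp_le y c \<longrightarrow> Poly_Mapping.lookup d y dvd Poly_Mapping.lookup c y)" by blast
  then show ?thesis unfolding lead_gen_def by (rule someI_ex)
qed

lemma lead_gen_L0: "lead_gen y \<in> L0" and lead_gen_supp: "supp_le y (lead_gen y)"
  and lead_gen_dvd: "c \<in> L0 \<Longrightarrow> supp_le y c \<Longrightarrow> Poly_Mapping.lookup (lead_gen y) y dvd Poly_Mapping.lookup c y"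
  using lead_gen_props[of y] by blast+

lemma lead_gen_nonzero:
  assumes "y \<in> leads"
  shows "Poly_Mapping.lookup (lead_gen y) y \<noteq> 0"
proof -
  obtain c where c: "c \<in> L0" "supp_le y c" "Poly_Mapping.lookup c y \<noteq> 0"
    using assms by (auto simp: leads_def)
  show ?thesis using lead_gen_dvd[OF c(1,2)] c(3) by auto
qed

text \<open>
  The orbits at which the filtration grows.
\<close>

definition jumps :: "'m set"
  where "jumps = {x \<in> reps. Lle x \<noteq> Llt x}"

lemma Lle_Llt: "lt x' x \<Longrightarrow> x \<in> reps \<Longrightarrow> Lle x' \<subseteq> Llt x"
  using trans by (auto simp: Lle_def Llt_def)

text \<open>
  The choices made at one orbit: the candidates \<open>C\<close>, the least leading position \<open>y\<close> of the norm of a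
  candidate, a candidate \<open>l\<close> whose norm has that leading position with the leading coefficient of
  \<open>lead_gen y\<close>, and the corresponding projective submodule \<open>P\<close>.
\<close>

definition step_data :: "'m \<Rightarrow> ('m \<Rightarrow>\<^sub>0 int) set \<Rightarrow> 'm \<Rightarrow> ('m \<Rightarrow>\<^sub>0 int) \<Rightarrow> ('m \<Rightarrow>\<^sub>0 int) set \<Rightarrow> bool"
  where "step_data x C y l P \<longleftrightarrow>
    C \<subseteq> Lle x \<and> (\<forall>l\<in>C. \<forall>m\<in>Llt x. l + m \<in> C) \<and> (\<forall>l\<in>C. act nrm l \<noteq> 0) \<and>
    (\<forall>l'\<in>C. \<forall>y'. supp_le y' (act nrm l') \<longrightarrow> y' = y \<or> lt y y') \<and>
    y \<in> leads \<and> l \<in> C \<and> supp_le y (act nrm l) \<and>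
    Poly_Mapping.lookup (act nrm l) y = Poly_Mapping.lookup (lead_gen y) y \<and>
    submod P \<and> P \<subseteq> Lle x \<and> dual_basis P \<and> act nrm l \<in> P \<and>
    (\<forall>c\<in>Lle x. \<exists>u\<in>P. c - u \<in> Llt x) \<and> (\<forall>c\<in>P. c \<in> Llt x \<longrightarrow> (\<exists>k. c = frag_cmul k (act nrm l)))"

lemma step_data_exists:
  assumes x: "x \<in> jumps"
  shows "\<exists>C y l P. step_data x C y l P"
proof -
  have sx: "s x \<noteq> x" and ne: "Lle x \<noteq> Llt x" and xr: "x \<in> reps"
    using x by (auto simp: jumps_def reps_def)
  have H: "\<forall>l\<in>Lle x. act nrm l = 0 \<longrightarrow> (\<exists>l'\<in>Lle x. l = act lam l')"
  proof (intro ballI impI)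
    fix l assume l: "l \<in> Lle x" "act nrm l = 0"
    obtain l' where l': "l' \<in> L" "l = act lam l'" using H1[of l] l by (auto simp: Lle_def)
    then have "l' \<in> Lle x" using l flat_at_lam_imp by (auto simp: Lle_def)
    then show "\<exists>l'\<in>Lle x. l = act lam l'" using l' by blast
  qed
  obtain C where C: "C \<noteq> {}" "C \<subseteq> Lle x" "\<forall>l\<in>C. \<forall>m\<in>Llt x. l + m \<in> C" "\<forall>l\<in>C. act nrm l \<noteq> 0"
    and C_step: "\<forall>l\<in>C. \<forall>n z. \<not> int p dvd n \<longrightarrow> z \<in> Lle x \<longrightarrow> sg z = z \<longrightarrow>
      (\<exists>P l'. l' \<in> C \<and> act nrm l' = frag_cmul n (act nrm l) + frag_cmul (int p) z \<and>
        submod P \<and> P \<subseteq> Lle x \<and> dual_basis P \<and> act nrm l' \<in> P \<and>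
        (\<forall>c\<in>Lle x. \<exists>u\<in>P. c - u \<in> Llt x) \<and>
        (\<forall>c\<in>P. c \<in> Llt x \<longrightarrow> (\<exists>k. c = frag_cmul k (act nrm l'))))"
    using orbit_step[OF sx submod_Lle Llt_def ne H] by (elim exE conjE) (rule that; assumption)
  have CL0: "act nrm l \<in> L0" if "l \<in> C" for l
    using that C(2) nrm_L0 by (auto simp: Lle_def)
  obtain l1 where l1: "l1 \<in> C" using C(1) by blast
  then have "\<exists>l\<in>C. \<exists>y. supp_le y (act nrm l)" using C(4) leading_exists by metis
  then obtain y0 where y0: "\<exists>l\<in>C. supp_le y0 (act nrm l)" by blast
  obtain y where y: "\<exists>l\<in>C. supp_le y (act nrm l)"
    and y_min: "\<And>y'. \<exists>l\<in>C. supp_le y' (act nrm l) \<Longrightarrow> y' = y \<or> lt y y'"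
    using wf_min[of "\<lambda>y. \<exists>l\<in>C. supp_le y (act nrm l)", OF y0] by metis
  obtain l where l: "l \<in> C" "supp_le y (act nrm l)" using y by blast
  have lead: "Poly_Mapping.lookup (act nrm m) y \<noteq> 0" if m: "m \<in> C" "supp_le y (act nrm m)" for m
  proof
    assume 0: "Poly_Mapping.lookup (act nrm m) y = 0"
    have "act nrm m \<noteq> 0" using C(4) m(1) by blast
    then obtain y' where "supp_le y' (act nrm m)" "lt y' y"
      using leading_less[OF _ m(2) 0] by metis
    then show False using y_min m(1) irrefl trans by blast
  qed
  have y_leads: "y \<in> leads" using l lead[OF l] CL0 by (auto simp: leads_def)
  have g0: "Poly_Mapping.lookup (lead_gen y) y \<noteq> 0" by (rule lead_gen_nonzero[OF y_leads])
  have "Poly_Mapping.lookup (lead_gen y) y dvd Poly_Mapping.lookup (act nrm l) y"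
    using lead_gen_dvd CL0 l by blast
  then obtain \<kappa> where \<kappa>: "Poly_Mapping.lookup (act nrm l) y = \<kappa> * Poly_Mapping.lookup (lead_gen y) y"
    by (metis dvdE mult.commute)
  have nrm_lead_gen: "act nrm (lead_gen y) = frag_cmul (int p) (lead_gen y)"
    using act_fixed[of "lead_gen y" nrm] lead_gen_L0[of y] by (simp add: L0_def)
  \<comment> \<open>otherwise subtracting a fixed element from \<open>l\<close> would cancel the leading term of the norm\<close>
  have "\<not> int p dvd \<kappa>"
  proof
    assume "int p dvd \<kappa>"
    then obtain j where j: "\<kappa> = int p * j" by (elim dvdE)
    have "frag_cmul (- j) (lead_gen y) \<in> Llt x"
      using lead_gen_L0 L0_Llt by (intro submod_cmul[OF submod_Llt]) blast
    then have m: "l + frag_cmul (- j) (lead_gen y) \<in> C" using C(3) l(1) by blast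
    have nm: "act nrm (l + frag_cmul (- j) (lead_gen y)) = act nrm l + frag_cmul (- j * int p) (lead_gen y)"
      by (simp only: act_add_right act_cmul_right nrm_lead_gen frag_cmul_cmul)
    have "supp_le y (act nrm (l + frag_cmul (- j) (lead_gen y)))"
      unfolding nm by (intro supp_le_add supp_le_cmul l(2) lead_gen_supp)
    from lead[OF m this] show False unfolding nm using \<kappa> j by (simp add: lookup_add)
  qed
  then obtain n d where nd: "n * \<kappa> + d * int p = 1" using int_prime_bezout by blast
  have n: "\<not> int p dvd n"
  proof
    assume "int p dvd n"
    then have "int p dvd n * \<kappa> + d * int p" by simp
    then show False using nd prime_gt_1_nat[OF prime_p] by simp
  qed
  have "lead_gen y \<in> L0" by (rule lead_gen_L0)
  then have z: "frag_cmul d (lead_gen y) \<in> Lle x" "sg (frag_cmul d (lead_gen y)) = frag_cmul d (lead_gen y)"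
    using L0_Llt[of x] by (auto simp: L0_def Llt_def sg_cmul act_lam_eq_0_iff intro!: submod_cmul submod_Lle)
  obtain P l' where l': "l' \<in> C"
    and nl': "act nrm l' = frag_cmul n (act nrm l) + frag_cmul (int p) (frag_cmul d (lead_gen y))"
    and P: "submod P \<and> P \<subseteq> Lle x \<and> dual_basis P \<and> act nrm l' \<in> P \<and>
        (\<forall>c\<in>Lle x. \<exists>u\<in>P. c - u \<in> Llt x) \<and>
        (\<forall>c\<in>P. c \<in> Llt x \<longrightarrow> (\<exists>k. c = frag_cmul k (act nrm l')))"
    using C_step[rule_format, OF l(1) n z] by (elim exE conjE) (rule that, assumption, assumption, intro conjI; assumption)
  have "Poly_Mapping.lookup (act nrm l') y = (n * \<kappa> + d * int p) * Poly_Mapping.lookup (lead_gen y) y"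
    by (simp add: nl' lookup_add \<kappa> algebra_simps)
  then have "Poly_Mapping.lookup (act nrm l') y = Poly_Mapping.lookup (lead_gen y) y" by (simp only: nd mult_1)
  moreover have "supp_le y (act nrm l')"
    unfolding nl' by (intro supp_le_add supp_le_cmul l(2) lead_gen_supp)
  moreover have "\<forall>l'\<in>C. \<forall>y'. supp_le y' (act nrm l') \<longrightarrow> y' = y \<or> lt y y'" using y_min by blast
  ultimately have "step_data x C y l' P"
    unfolding step_data_def using C(2,3,4) y_leads l' P by (intro conjI) (assumption | elim conjE)+
  then show ?thesis by blast
qed

text \<open>
  The summands are the submodules \<open>P\<close> of \<open>step_data\<close> and the span \<open>T\<close> of the elements \<open>lead_gen y\<close> at those
  leading positions \<open>y\<close> that no orbit uses.
\<close>

theorem direct_decomposition_exists: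
  "\<exists>(I :: 'm set) P T. direct_decomposition L I P T"
proof -
  have "\<forall>x. \<exists>C y l P. x \<in> jumps \<longrightarrow> step_data x C y l P" using step_data_exists by blast
  then obtain C Y m P where step: "\<And>x. x \<in> jumps \<Longrightarrow> step_data x (C x) (Y x) (m x) (P x)" by metis
  have C_add: "l + d \<in> C x" if "x \<in> jumps" "l \<in> C x" "d \<in> Llt x" for x l d
    using step[OF that(1)] that(2,3) unfolding step_data_def by blast
  have C_nrm: "act nrm l \<noteq> 0" if "x \<in> jumps" "l \<in> C x" for x l
    using step[OF that(1)] that(2) unfolding step_data_def by blast
  have Y_min: "y = Y x \<or> lt (Y x) y" if "x \<in> jumps" "l \<in> C x" "supp_le y (act nrm l)" for x y l
    using step[OF that(1)] that(2,3) unfolding step_data_def by blast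
  have Y_leads: "Y x \<in> leads" and m_C: "m x \<in> C x" and m_Lle: "m x \<in> Lle x"
    and m_supp: "supp_le (Y x) (act nrm (m x))"
    and m_lead: "Poly_Mapping.lookup (act nrm (m x)) (Y x) = Poly_Mapping.lookup (lead_gen (Y x)) (Y x)"
    and P_sub: "submod (P x)" and P_Lle: "P x \<subseteq> Lle x" and P_db: "dual_basis (P x)"
    and m_P: "act nrm (m x) \<in> P x" if "x \<in> jumps" for x
    using step[OF that] unfolding step_data_def by blast+
  have P_cover: "\<exists>u\<in>P x. c - u \<in> Llt x" if "x \<in> jumps" "c \<in> Lle x" for x c
    using step[OF that(1)] that(2) unfolding step_data_def by blast
  have P_Llt: "\<exists>k. c = frag_cmul k (act nrm (m x))" if "x \<in> jumps" "c \<in> P x" "c \<in> Llt x" for x c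
    using step[OF that(1)] that(2,3) unfolding step_data_def by blast
  have jumps_reps: "x \<in> reps" if "x \<in> jumps" for x using that by (simp add: jumps_def)
  have Lle_L: "Lle x \<subseteq> L" for x by (auto simp: Lle_def)
  have m_L0: "act nrm (m x) \<in> L0" if "x \<in> jumps" for x
    using m_Lle[OF that] Lle_L nrm_L0 by blast

  \<comment> \<open>if two orbits shared a leading position, the difference of their candidates would be a candidate for
    the later orbit with a smaller leading position\<close>
  have Y_less: False if x: "x \<in> jumps" "x' \<in> jumps" "lt x' x" "Y x = Y x'" for x x'
  proof -
    have "m x' \<in> Llt x" using m_Lle[OF x(2)] Lle_Llt[OF x(3) jumps_reps[OF x(1)]] by blast
    then have "- m x' \<in> Llt x" by (rule submod_minus[OF submod_Llt])
    from C_add[OF x(1) m_C[OF x(1)] this] have c: "m x - m x' \<in> C x" by simp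
    have nm: "act nrm (m x - m x') = act nrm (m x) - act nrm (m x')" by (rule act_diff_right)
    have "supp_le (Y x) (act nrm (m x - m x'))"
      unfolding nm using m_supp[OF x(1)] m_supp[OF x(2)] x(4) by (simp add: supp_le_diff)
    moreover have "Poly_Mapping.lookup (act nrm (m x - m x')) (Y x) = 0"
      unfolding nm using m_lead[OF x(1)] m_lead[OF x(2)] x(4) by (simp add: lookup_minus)
    ultimately obtain y' where "supp_le y' (act nrm (m x - m x'))" "lt y' (Y x)"
      using leading_less[OF C_nrm[OF x(1) c]] by blast
    then show False using Y_min[OF x(1) c] irrefl trans by blast
  qed
  have Y_inj: "inj_on Y jumps"
    using Y_less total by (intro inj_onI) metis

  \<comment> \<open>a triangular basis of \<open>L0\<close> adapted to the projective summands\<close>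
  define B where "B y = (if y \<in> Y ` jumps then act nrm (m (the_inv_into jumps Y y)) else lead_gen y)" for y
  have B_Y: "B (Y x) = act nrm (m x)" if "x \<in> jumps" for x
    using that by (simp add: B_def the_inv_into_f_f[OF Y_inj])
  have B_lead_gen: "B y = lead_gen y" if "y \<notin> Y ` jumps" for y
    using that by (simp add: B_def)
  have B_lead: "Poly_Mapping.lookup (B y) y = Poly_Mapping.lookup (lead_gen y) y" for y
    using B_Y B_lead_gen m_lead by (cases "y \<in> Y ` jumps") auto
  have B_supp: "supp_le y (B y)" for y
    using B_Y B_lead_gen m_supp lead_gen_supp by (cases "y \<in> Y ` jumps") auto
  have B_L0: "B y \<in> L0" for y
    using B_Y B_lead_gen m_L0 lead_gen_L0 by (cases "y \<in> Y ` jumps") auto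

  have B_indep: "k y = 0" if G: "finite G" "G \<subseteq> leads" "(\<Sum>y\<in>G. frag_cmul (k y) (B y)) = 0" "y \<in> G" for G k y
  proof (rule ccontr)
    assume "k y \<noteq> 0"
    then have ne: "{y \<in> G. k y \<noteq> 0} \<noteq> {}" using G(4) by blast
    have fin: "finite {y \<in> G. k y \<noteq> 0}" using G(1) by simp
    obtain z where zA: "z \<in> {y \<in> G. k y \<noteq> 0}"
      and zA_max: "\<And>x. x \<in> {y \<in> G. k y \<noteq> 0} \<Longrightarrow> x = z \<or> lt x z"
      by (rule finite_max[OF fin ne]) (rule that)
    have z: "z \<in> G" "k z \<noteq> 0" and z_max: "\<And>x. x \<in> G \<Longrightarrow> k x \<noteq> 0 \<Longrightarrow> x = z \<or> lt x z"
      using zA zA_max by simp_all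
    have "0 = (\<Sum>y\<in>G. k y * Poly_Mapping.lookup (B y) z)"
      using arg_cong[OF G(3), of "\<lambda>c. Poly_Mapping.lookup c z"] by (simp add: lookup_sum)
    also have "\<dots> = (\<Sum>y\<in>{z}. k y * Poly_Mapping.lookup (B y) z)"
    proof (rule sum.mono_neutral_right[OF G(1)])
      show "{z} \<subseteq> G" using z by simp
      show "\<forall>i\<in>G - {z}. k i * Poly_Mapping.lookup (B i) z = 0"
        using z_max supp_le_lookup[OF B_supp] by fastforce
    qed
    also have "\<dots> = k z * Poly_Mapping.lookup (lead_gen z) z" by (simp add: B_lead)
    finally show False using z G(2) lead_gen_nonzero by auto
  qed

  define T where "T = {t. \<exists>F k. finite F \<and> F \<subseteq> leads - Y ` jumps \<and> t = (\<Sum>y\<in>F. frag_cmul (k y) (B y))}"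
  have T_L0: "T \<subseteq> L0"
    using B_L0 by (auto simp: T_def intro!: submod_sum submod_cmul submod_L0)
  have T_L: "T \<subseteq> L" using T_L0 by (auto simp: L0_def)
  have T_fixed: "sg t = t" if "t \<in> T" for t
    using that T_L0 by (auto simp: L0_def act_lam_eq_0_iff)
  have sum_ext: "(\<Sum>y\<in>F. frag_cmul (k y) (B y)) = (\<Sum>y\<in>F \<union> F'. frag_cmul (if y \<in> F then k y else 0) (B y))"
    if "finite F" "finite F'" for F F' k
    using that by (intro sum.mono_neutral_cong_left) auto
  have T_sub: "submod T"
  proof -
    have "0 \<in> T" by (auto simp: T_def intro!: exI[of _ "{}"])
    moreover have "c - d \<in> T" if cd: "c \<in> T" "d \<in> T" for c d
    proof -
      obtain F k where c: "finite F" "F \<subseteq> leads - Y ` jumps" "c = (\<Sum>y\<in>F. frag_cmul (k y) (B y))"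
        using cd(1) unfolding T_def by blast
      obtain F' k' where d: "finite F'" "F' \<subseteq> leads - Y ` jumps" "d = (\<Sum>y\<in>F'. frag_cmul (k' y) (B y))"
        using cd(2) unfolding T_def by blast
      have "c - d = (\<Sum>y\<in>F \<union> F'. frag_cmul ((if y \<in> F then k y else 0) - (if y \<in> F' then k' y else 0)) (B y))"
        using sum_ext[OF c(1) d(1), of k] sum_ext[OF d(1) c(1), of k'] c(3) d(3)
        by (simp only: Un_commute[of F' F] frag_cmul_diff_distrib sum_subtractf)
      then show ?thesis unfolding T_def using c(1,2) d(1,2)
        by (intro CollectI exI[of _ "F \<union> F'"]
            exI[of _ "\<lambda>y. (if y \<in> F then k y else 0) - (if y \<in> F' then k' y else 0)"]) auto
    qed
    moreover have "sg c \<in> T" if "c \<in> T" for c using that T_fixed by simp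
    ultimately show ?thesis by (simp add: submod_def)
  qed
  have B_T: "B y \<in> T" if "y \<in> leads" "y \<notin> Y ` jumps" for y
    using that unfolding T_def
    by (intro CollectI exI[of _ "{y}"] exI[of _ "\<lambda>_. 1"]) auto

  define S where "S = {l. \<exists>F f t. finite F \<and> F \<subseteq> jumps \<and> (\<forall>x\<in>F. f x \<in> P x) \<and> t \<in> T \<and> l = sum f F + t}"
  have S_T: "t \<in> S" if "t \<in> T" for t
    unfolding S_def using that by (intro CollectI exI[of _ "{}"] exI[of _ "\<lambda>_. 0"] exI[of _ t]) auto
  have S_P: "u \<in> S" if "x \<in> jumps" "u \<in> P x" for x u
    unfolding S_def using that submod_zero[OF T_sub]
    by (intro CollectI exI[of _ "{x}"] exI[of _ "\<lambda>_. u"] exI[of _ 0]) auto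
  have S_add: "c + d \<in> S" if cd: "c \<in> S" "d \<in> S" for c d
  proof -
    obtain F f t where c: "finite F" "F \<subseteq> jumps" "\<forall>x\<in>F. f x \<in> P x" "t \<in> T" "c = sum f F + t"
      using cd(1) unfolding S_def by blast
    obtain F' f' t' where d: "finite F'" "F' \<subseteq> jumps" "\<forall>x\<in>F'. f' x \<in> P x" "t' \<in> T" "d = sum f' F' + t'"
      using cd(2) unfolding S_def by blast
    let ?f = "\<lambda>x. (if x \<in> F then f x else 0) + (if x \<in> F' then f' x else 0)"
    have "sum f F = (\<Sum>x\<in>F \<union> F'. if x \<in> F then f x else 0)"
      using c(1) d(1) by (intro sum.mono_neutral_cong_left) auto
    moreover have "sum f' F' = (\<Sum>x\<in>F \<union> F'. if x \<in> F' then f' x else 0)"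
      using c(1) d(1) by (intro sum.mono_neutral_cong_left) auto
    ultimately have "c + d = sum ?f (F \<union> F') + (t + t')"
      using c(5) d(5) by (simp add: sum.distrib algebra_simps)
    moreover have "\<forall>x\<in>F \<union> F'. ?f x \<in> P x"
      using c(2,3) d(2,3) P_sub by (auto intro: submod_add simp: subset_iff)
    moreover have "t + t' \<in> T" using c(4) d(4) by (rule submod_add[OF T_sub])
    ultimately show ?thesis unfolding S_def using c(1,2) d(1,2)
      by (intro CollectI exI[of _ "F \<union> F'"] exI[of _ ?f] exI[of _ "t + t'"]) auto
  qed
  have B_S: "frag_cmul k (B y) \<in> S" if y: "y \<in> leads" for k y
  proof (cases "y \<in> Y ` jumps")
    case True
    then obtain x where x: "x \<in> jumps" "y = Y x" by blast
    then have "frag_cmul k (B y) \<in> P x"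
      using submod_cmul[OF P_sub[OF x(1)] m_P[OF x(1)]] by (simp add: B_Y)
    then show ?thesis using S_P x(1) by blast
  next
    case False
    then show ?thesis using B_T[OF y] S_T submod_cmul[OF T_sub] by blast
  qed
  have S_L0': "\<forall>c\<in>L0. supp_le y c \<longrightarrow> c \<in> S" for y
    using wf
  proof (induction y rule: wfp_induct_rule)
    case (less y)
    have zero: "c \<in> S" if c: "c \<in> L0" "supp_le y c" "Poly_Mapping.lookup c y = 0" for c
    proof (cases "c = 0")
      case True
      then show ?thesis using S_T[OF submod_zero[OF T_sub]] by simp
    next
      case False
      then obtain y' where "supp_le y' c" "lt y' y" using leading_less[OF _ c(2,3)] by metis
      then show ?thesis using less c(1) by blast
    qed
    show ?case
    proof (intro ballI impI)
      fix c assume c: "c \<in> L0" "supp_le y c"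
      show "c \<in> S"
      proof (cases "Poly_Mapping.lookup c y = 0")
        case True then show ?thesis using zero c by blast
      next
        case False
        then have y: "y \<in> leads" using c by (auto simp: leads_def)
        obtain k where k: "Poly_Mapping.lookup c y = k * Poly_Mapping.lookup (lead_gen y) y"
          using lead_gen_dvd[OF c] by (metis dvdE mult.commute)
        have "c - frag_cmul k (B y) \<in> S"
        proof (rule zero)
          show "c - frag_cmul k (B y) \<in> L0"
            by (intro submod_diff[OF submod_L0] submod_cmul[OF submod_L0] c B_L0)
          show "supp_le y (c - frag_cmul k (B y))" by (intro supp_le_diff supp_le_cmul c B_supp)
          show "Poly_Mapping.lookup (c - frag_cmul k (B y)) y = 0"
            by (simp add: lookup_minus B_lead k)
        qed
        then show ?thesis using S_add[OF _ B_S[OF y, of k]] by fastforce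
      qed
    qed
  qed
  have S_L0: "c \<in> S" if "c \<in> L0" for c
  proof (cases "c = 0")
    case True
    then show ?thesis using S_T[OF submod_zero[OF T_sub]] by simp
  next
    case False
    then show ?thesis using leading_exists S_L0' that by blast
  qed
  have last_bad: "\<exists>y\<in>reps. \<not> flat_at y l \<and> l \<in> Lle y" if l: "l \<in> L" "l \<notin> L0" for l
  proof -
    let ?A = "{y \<in> reps. \<not> flat_at y l}"
    have ne: "?A \<noteq> {}" using L0_I l by blast
    obtain y where y: "y \<in> ?A" "\<And>z. z \<in> ?A \<Longrightarrow> z = y \<or> lt z y"
      by (rule finite_max[OF finite_not_flat ne]) (rule that)
    have "flat_at z l" if z: "z \<in> reps" "lt y z" for z
      using y(2)[of z] z irrefl trans by blast
    then show ?thesis using y(1) l(1) by (auto simp: Lle_def)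
  qed
  have S_Lle: "\<forall>l\<in>Lle x. x \<in> reps \<longrightarrow> l \<in> S" for x
    using wf
  proof (induction x rule: wfp_induct_rule)
    case (less x)
    have Llt_S: "l \<in> S" if l: "l \<in> Llt x" "x \<in> reps" for l
    proof (cases "l \<in> L0")
      case False
      have "l \<in> L" using l(1) by (auto simp: Llt_def Lle_def)
      then obtain y where y: "y \<in> reps" "\<not> flat_at y l" "l \<in> Lle y" using last_bad False by blast
      have "lt y x" using y(1,2) l(1) total[of x y] by (auto simp: Llt_def Lle_def)
      then show ?thesis using less y by blast
    qed (rule S_L0)
    show ?case
    proof (intro ballI impI)
      fix l assume l: "l \<in> Lle x" "x \<in> reps"
      show "l \<in> S"
      proof (cases "x \<in> jumps")
        case True
        then obtain u where u: "u \<in> P x" "l - u \<in> Llt x" using P_cover l(1) by blast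
        then show ?thesis using S_add[OF Llt_S[OF u(2) l(2)] S_P[OF True u(1)]] by simp
      next
        case False
        then show ?thesis using Llt_S l by (auto simp: jumps_def)
      qed
    qed
  qed
  have span: "l \<in> S" if "l \<in> L" for l
    using S_L0 S_Lle last_bad[OF that] by blast

  have indep: "t = 0 \<and> (\<forall>x\<in>F. f x = 0)"
    if F: "finite F" "F \<subseteq> jumps" "\<forall>x\<in>F. f x \<in> P x" and t: "t \<in> T" and 0: "sum f F + t = 0" for F f t
  proof -
    have t_flat: "flat_at x t" for x using t T_L0 L0_flat by blast
    have flat_sum: "flat_at x (sum g G)" if "\<forall>i\<in>G. flat_at x (g i)" for x and g :: "'m \<Rightarrow> _" and G
      using that by (induction G rule: infinite_finite_induct) (auto simp: flat_at_zero flat_at_add)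
    \<comment> \<open>at the last orbit where this failed, the other summands are constant on the orbit, hence so is \<open>f x\<close>\<close>
    have all_Llt: "f x \<in> Llt x" if x: "x \<in> F" for x
    proof (rule ccontr)
      let ?A = "{x \<in> F. f x \<notin> Llt x}"
      assume "f x \<notin> Llt x"
      then have ne: "?A \<noteq> {}" using x by blast
      have fin: "finite ?A" using F(1) by simp
      obtain z where z: "z \<in> ?A" and z_max: "\<And>w. w \<in> ?A \<Longrightarrow> w = z \<or> lt w z"
        by (rule finite_max[OF fin ne]) (rule that)
      have zF: "z \<in> F" "z \<in> jumps" "z \<in> reps" using z F(2) jumps_reps by auto
      have "flat_at z (f w)" if w: "w \<in> F - {z}" for w
      proof (cases "f w \<in> Llt w")
        case True
        have "w \<in> jumps" using w F(2) by blast
        then obtain k where "f w = frag_cmul k (act nrm (m w))" using P_Llt True F(3) w by blast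
        then have "f w \<in> L0" using submod_cmul[OF submod_L0 m_L0[OF \<open>w \<in> jumps\<close>]] by simp
        then show ?thesis by (rule L0_flat)
      next
        case False
        then have "lt w z" using z_max w by blast
        moreover have "f w \<in> Lle w" using P_Lle F(2,3) w by blast
        ultimately show ?thesis using zF(3) by (auto simp: Lle_def)
      qed
      then have "flat_at z (sum f (F - {z}))" by (intro flat_sum ballI)
      then have "flat_at z (0 - (sum f (F - {z}) + t))"
        using t_flat by (intro flat_at_diff flat_at_add flat_at_zero)
      moreover have "f z = 0 - (sum f (F - {z}) + t)"
        using 0 sum.remove[OF F(1) zF(1), of f] by (simp add: algebra_simps eq_neg_iff_add_eq_0)
      ultimately have "flat_at z (f z)" by simp
      then have "f z \<in> Llt z" using P_Lle[OF zF(2)] F(3) zF(1) by (auto simp: Llt_def)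
      then show False using z by blast
    qed
    have "\<forall>x. \<exists>k. x \<in> F \<longrightarrow> f x = frag_cmul k (B (Y x))"
      using P_Llt all_Llt F(2,3) B_Y by (metis subsetD)
    then obtain k where k: "\<And>x. x \<in> F \<Longrightarrow> f x = frag_cmul (k x) (B (Y x))" by metis
    obtain G h where G: "finite G" "G \<subseteq> leads - Y ` jumps" "t = (\<Sum>y\<in>G. frag_cmul (h y) (B y))"
      using t unfolding T_def by blast
    define c where "c y = (if y \<in> G then h y else k (the_inv_into jumps Y y))" for y
    have injF: "inj_on Y F" using Y_inj F(2) by (rule inj_on_subset)
    have disj: "G \<inter> Y ` F = {}" using G(2) F(2) by blast
    have cY: "c (Y x) = k x" if "x \<in> F" for x
      using that F(2) disj by (auto simp: c_def the_inv_into_f_f[OF Y_inj])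
    have "(\<Sum>y\<in>Y ` F. frag_cmul (c y) (B y)) = sum f F"
      by (simp add: sum.reindex[OF injF] cY k)
    moreover have "(\<Sum>y\<in>G. frag_cmul (c y) (B y)) = t"
      by (simp add: G(3) c_def)
    moreover have "(\<Sum>y\<in>G \<union> Y ` F. frag_cmul (c y) (B y))
      = (\<Sum>y\<in>G. frag_cmul (c y) (B y)) + (\<Sum>y\<in>Y ` F. frag_cmul (c y) (B y))"
      using G(1) F(1) disj by (simp add: sum.union_disjoint)
    ultimately have "(\<Sum>y\<in>G \<union> Y ` F. frag_cmul (c y) (B y)) = 0" using 0 by (simp add: add.commute)
    moreover have "finite (G \<union> Y ` F)" using G(1) F(1) by simp
    moreover have "G \<union> Y ` F \<subseteq> leads" using G(2) F(2) Y_leads by blast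
    ultimately have c0: "c y = 0" if "y \<in> G \<union> Y ` F" for y
      using B_indep[of "G \<union> Y ` F" c y] that by blast
    have "f x = 0" if "x \<in> F" for x
      using k[OF that] cY[OF that] c0[of "Y x"] that by simp
    moreover have "t = 0" using \<open>(\<Sum>y\<in>G. frag_cmul (c y) (B y)) = t\<close> c0 by simp
    ultimately show ?thesis by blast
  qed
  have "direct_decomposition L jumps P T"
    unfolding direct_decomposition_def
  proof (intro conjI ballI allI impI)
    fix x assume x: "x \<in> jumps"
    show "submod (P x)" "dual_basis (P x)" by (fact P_sub[OF x] P_db[OF x])+
    show "P x \<subseteq> L" using P_Lle[OF x] Lle_L by blast
    show "P x \<noteq> {0}" using m_P[OF x] C_nrm[OF x m_C[OF x]] by blast
  next
    show "submod T" "T \<subseteq> L" by (fact T_sub T_L)+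
    show "sg t = t" if "t \<in> T" for t using T_fixed that .
    show "\<exists>F f t. finite F \<and> F \<subseteq> jumps \<and> (\<forall>x\<in>F. f x \<in> P x) \<and> t \<in> T \<and> l = sum f F + t" if "l \<in> L" for l
      using span[OF that] unfolding S_def by blast
  next
    fix F f t
    assume "finite F \<and> F \<subseteq> jumps \<and> (\<forall>x\<in>F. f x \<in> P x) \<and> t \<in> T \<and> sum f F + t = 0"
    then have "t = 0 \<and> (\<forall>x\<in>F. f x = 0)" by (elim conjE) (rule indep)
    then show "t = 0" "\<And>x. x \<in> F \<Longrightarrow> f x = 0" by auto
  qed
  then show ?thesis by blast
qed

end


section \<open>Direct sums, free modules and projective modules\<close>

lemma internal_direct_sumI:
  assumes A: "abelian_group M"
    and sub: "\<And>i. i \<in> I \<Longrightarrow> submodule (F i) R M"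
    and span: "\<And>x. x \<in> carrier M \<Longrightarrow> \<exists>f\<in>(\<Pi>\<^sub>E i\<in>I. F i).
      finite {i \<in> I. f i \<noteq> \<zero>\<^bsub>M\<^esub>} \<and> gfinprod (add_monoid M) f I = x"
    and indep: "\<And>f. f \<in> (\<Pi>\<^sub>E i\<in>I. F i) \<Longrightarrow> finite {i \<in> I. f i \<noteq> \<zero>\<^bsub>M\<^esub>} \<Longrightarrow>
      gfinprod (add_monoid M) f I = \<zero>\<^bsub>M\<^esub> \<Longrightarrow> \<forall>i\<in>I. f i = \<zero>\<^bsub>M\<^esub>"
  shows "internal_direct_sum R M I F"
proof -
  let ?A = "\<lambda>i. add_monoid (M\<lparr>carrier := F i\<rparr>)"
  interpret G: comm_group "add_monoid M" by (rule abelian_group.a_comm_group[OF A])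
  have subg: "subgroup (F i) (add_monoid M)" if "i \<in> I" for i
    using sub[OF that] by (rule submodule.axioms(1))
  have grp: "group (?A i)" if "i \<in> I" for i
    using subgroup.subgroup_is_group[OF subg[OF that] G.is_group] by simp
  have car: "carrier (sum_group I ?A) = {f \<in> (\<Pi>\<^sub>E i\<in>I. F i). finite {i \<in> I. f i \<noteq> \<zero>\<^bsub>M\<^esub>}}"
    by (subst carrier_sum_group[OF grp]) simp_all
  have "(\<lambda>f. gfinprod (add_monoid M) (\<lambda>i. (\<lambda>i x. x) i (f i)) I) \<in> hom (sum_group I ?A) (add_monoid M)"
  proof (rule G.hom_group_sum)
    fix i assume "i \<in> I"
    then show "(\<lambda>x. x) \<in> hom (?A i) (add_monoid M)"
      using subgroup.subset[OF subg] by (auto simp: hom_def)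
  qed (rule grp)
  then have hom: "(\<lambda>f. gfinprod (add_monoid M) f I) \<in> hom (sum_group I ?A) (add_monoid M)" by simp
  interpret h: group_hom "sum_group I ?A" "add_monoid M" "\<lambda>f. gfinprod (add_monoid M) f I"
    using hom grp G.is_group by (simp add: group_hom_def group_hom_axioms_def)
  have "(\<lambda>f. gfinprod (add_monoid M) f I) \<in> iso (sum_group I ?A) (add_monoid M)"
    unfolding h.iso_iff
  proof (intro conjI ballI impI subsetI)
    fix x assume "x \<in> carrier (add_monoid M)"
    then have "x \<in> carrier M" by simp
    then obtain f where "f \<in> (\<Pi>\<^sub>E i\<in>I. F i)" "finite {i \<in> I. f i \<noteq> \<zero>\<^bsub>M\<^esub>}"
      and fx: "gfinprod (add_monoid M) f I = x" using span by blast
    then have "f \<in> carrier (sum_group I ?A)" unfolding car by blast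
    then show "x \<in> (\<lambda>f. gfinprod (add_monoid M) f I) ` carrier (sum_group I ?A)"
      using fx by blast
  next
    fix f assume f: "f \<in> carrier (sum_group I ?A)" "gfinprod (add_monoid M) f I = \<one>\<^bsub>add_monoid M\<^esub>"
    then have "\<forall>i\<in>I. f i = \<zero>\<^bsub>M\<^esub>" using indep[of f] unfolding car by simp
    moreover have "f \<in> extensional I" using f(1) unfolding car by (auto simp: PiE_def)
    ultimately show "f = \<one>\<^bsub>sum_group I ?A\<^esub>"
      by (auto simp: fun_eq_iff extensional_def)
  qed
  then show ?thesis using sub by (simp add: internal_direct_sum_def)
qed

lemma submodule_iff_closed:
  assumes "module R M"
  shows "submodule H R M \<longleftrightarrow> H \<subseteq> carrier M \<and> \<zero>\<^bsub>M\<^esub> \<in> H \<and>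
    (\<forall>x\<in>H. \<forall>y\<in>H. x \<oplus>\<^bsub>M\<^esub> y \<in> H) \<and> (\<forall>r\<in>carrier R. \<forall>x\<in>H. r \<odot>\<^bsub>M\<^esub> x \<in> H)"
proof -
  interpret module R M by fact
  show ?thesis
  proof
    assume H: "submodule H R M"
    interpret submodule H R M by fact
    show "H \<subseteq> carrier M \<and> \<zero>\<^bsub>M\<^esub> \<in> H \<and>
      (\<forall>x\<in>H. \<forall>y\<in>H. x \<oplus>\<^bsub>M\<^esub> y \<in> H) \<and> (\<forall>r\<in>carrier R. \<forall>x\<in>H. r \<odot>\<^bsub>M\<^esub> x \<in> H)"
      using submoduleE[OF H] one_closed by simp
  next
    assume H: "H \<subseteq> carrier M \<and> \<zero>\<^bsub>M\<^esub> \<in> H \<and>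
      (\<forall>x\<in>H. \<forall>y\<in>H. x \<oplus>\<^bsub>M\<^esub> y \<in> H) \<and> (\<forall>r\<in>carrier R. \<forall>x\<in>H. r \<odot>\<^bsub>M\<^esub> x \<in> H)"
    show "submodule H R M"
    proof (rule submoduleI)
      fix x assume "x \<in> H"
      then have "\<ominus>\<^bsub>M\<^esub> x = (\<ominus>\<^bsub>R\<^esub> \<one>\<^bsub>R\<^esub>) \<odot>\<^bsub>M\<^esub> x" using H by (auto simp: smult_l_minus)
      then show "\<ominus>\<^bsub>M\<^esub> x \<in> H" using H \<open>x \<in> H\<close> by simp
    qed (use H in auto)
  qed
qed

lemma carrier_free_module:
  assumes "cring R"
  shows "carrier (free_module R B) = {f \<in> (\<Pi>\<^sub>E b\<in>B. carrier R). finite {b \<in> B. f b \<noteq> \<zero>\<^bsub>R\<^esub>}}"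
proof -
  interpret cring R by fact
  show ?thesis by (simp add: free_module_def) (subst carrier_sum_group, auto)
qed

lemma free_module_module:
  fixes R (structure)
  assumes "cring R"
  shows "module R (free_module R B)"
proof -
  interpret cring R by fact
  let ?F = "free_module R B"
  note car = carrier_free_module[OF assms, of B]
  have simps: "\<zero>\<^bsub>?F\<^esub> = (\<lambda>i\<in>B. \<zero>)" "f \<oplus>\<^bsub>?F\<^esub> g = (\<lambda>i\<in>B. f i \<oplus> g i)" "r \<odot>\<^bsub>?F\<^esub> f = (\<lambda>i\<in>B. r \<otimes> f i)"
    for f g r by (simp_all add: free_module_def)
  have fin: "finite {b \<in> B. h b \<noteq> \<zero>}"
    if "f \<in> carrier ?F" "g \<in> carrier ?F" "\<And>b. b \<in> B \<Longrightarrow> f b = \<zero> \<Longrightarrow> g b = \<zero> \<Longrightarrow> h b = \<zero>" for f g h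
  proof (rule finite_subset)
    show "{b \<in> B. h b \<noteq> \<zero>} \<subseteq> {b \<in> B. f b \<noteq> \<zero>} \<union> {b \<in> B. g b \<noteq> \<zero>}" using that(3) by blast
    show "finite ({b \<in> B. f b \<noteq> \<zero>} \<union> {b \<in> B. g b \<noteq> \<zero>})" using that(1,2) by (simp add: car)
  qed
  have val: "f b \<in> carrier R" if "f \<in> carrier ?F" "b \<in> B" for f b
    using that by (auto simp: car)
  have ext: "f = g" if "f \<in> carrier ?F" "g \<in> carrier ?F" "\<And>b. b \<in> B \<Longrightarrow> f b = g b" for f g
    using that by (intro PiE_ext[of f B "\<lambda>_. carrier R" g]) (auto simp: car)
  have I: "h \<in> carrier ?F" if "h \<in> extensional B" "\<And>b. b \<in> B \<Longrightarrow> h b \<in> carrier R" "finite {b \<in> B. h b \<noteq> \<zero>}" for h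
    using that by (auto simp: car PiE_def)
  have add_c: "f \<oplus>\<^bsub>?F\<^esub> g \<in> carrier ?F" if "f \<in> carrier ?F" "g \<in> carrier ?F" for f g
    using that val fin[OF that, of "f \<oplus>\<^bsub>?F\<^esub> g"] by (intro I) (auto simp: simps)
  have smult_c: "r \<odot>\<^bsub>?F\<^esub> f \<in> carrier ?F" if "r \<in> carrier R" "f \<in> carrier ?F" for r f
    using that val fin[OF that(2) that(2), of "r \<odot>\<^bsub>?F\<^esub> f"] by (intro I) (auto simp: simps)
  have zero_c: "\<zero>\<^bsub>?F\<^esub> \<in> carrier ?F" by (intro I) (auto simp: simps)
  have AG: "abelian_group ?F"
  proof (rule abelian_groupI)
    fix x assume x: "x \<in> carrier ?F"
    have "(\<lambda>i\<in>B. \<ominus> x i) \<in> carrier ?F"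
      using x val fin[OF x x, of "\<lambda>i\<in>B. \<ominus> x i"] by (intro I) auto
    moreover have "(\<lambda>i\<in>B. \<ominus> x i) \<oplus>\<^bsub>?F\<^esub> x = \<zero>\<^bsub>?F\<^esub>"
      using x val by (auto simp: simps fun_eq_iff l_neg)
    ultimately show "\<exists>y\<in>carrier ?F. y \<oplus>\<^bsub>?F\<^esub> x = \<zero>\<^bsub>?F\<^esub>" by blast
    show "\<zero>\<^bsub>?F\<^esub> \<oplus>\<^bsub>?F\<^esub> x = x"
      using x val by (intro ext add_c zero_c) (auto simp: simps)
  qed (use val in \<open>auto simp: simps fun_eq_iff a_ac intro: add_c[unfolded simps] zero_c[unfolded simps]\<close>)
  show ?thesis
  proof (rule moduleI[OF assms AG])
    fix x assume x: "x \<in> carrier ?F"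
    show "\<one> \<odot>\<^bsub>?F\<^esub> x = x"
      using x val by (intro ext smult_c) (auto simp: simps)
  qed (use val in \<open>auto simp: simps fun_eq_iff l_distr r_distr m_assoc intro: smult_c[unfolded simps]\<close>)
qed

lemma (in comm_monoid) gfinprod_bool:
  assumes "h True \<in> carrier G" "h False \<in> carrier G"
  shows "gfinprod G h UNIV = h True \<otimes> h False"
proof -
  have "h \<in> UNIV \<rightarrow> carrier G" using assms by (auto intro: bool.induct)
  moreover have "UNIV = {True, False}" by auto
  ultimately have "gfinprod G h UNIV = finprod G h {True, False}" by simp
  also have "\<dots> = h True \<otimes> h False" using assms by simp
  finally show ?thesis .
qed

text \<open>
  A retract of a free module is projective: the complement of the image of \<open>f\<close> is the kernel of \<open>g\<close>.
\<close>

lemma projective_moduleI: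
  fixes P :: "('r, 'a, 'y) module_scheme" and B :: "'a set"
  assumes P: "module R P"
    and f: "f \<in> carrier P \<rightarrow> carrier (free_module R B)"
    and f_add: "\<And>x y. x \<in> carrier P \<Longrightarrow> y \<in> carrier P \<Longrightarrow> f (x \<oplus>\<^bsub>P\<^esub> y) = f x \<oplus>\<^bsub>free_module R B\<^esub> f y"
    and f_smult: "\<And>r x. r \<in> carrier R \<Longrightarrow> x \<in> carrier P \<Longrightarrow> f (r \<odot>\<^bsub>P\<^esub> x) = r \<odot>\<^bsub>free_module R B\<^esub> f x"
    and g: "g \<in> carrier (free_module R B) \<rightarrow> carrier P"
    and g_add: "\<And>x y. x \<in> carrier (free_module R B) \<Longrightarrow> y \<in> carrier (free_module R B) \<Longrightarrow>
      g (x \<oplus>\<^bsub>free_module R B\<^esub> y) = g x \<oplus>\<^bsub>P\<^esub> g y"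
    and g_smult: "\<And>r x. r \<in> carrier R \<Longrightarrow> x \<in> carrier (free_module R B) \<Longrightarrow>
      g (r \<odot>\<^bsub>free_module R B\<^esub> x) = r \<odot>\<^bsub>P\<^esub> g x"
    and gf: "\<And>x. x \<in> carrier P \<Longrightarrow> g (f x) = x"
  shows "projective_module R P"
proof -
  let ?F = "free_module R B"
  interpret P: module R P by fact
  have F: "module R ?F" by (rule free_module_module) (rule P.R.is_cring)
  interpret F: module R ?F by fact
  define H where "H = f ` carrier P"
  define K where "K = {x \<in> carrier ?F. g x = \<zero>\<^bsub>P\<^esub>}"
  have fc: "f x \<in> carrier ?F" if "x \<in> carrier P" for x using f that by blast
  have gc: "g x \<in> carrier P" if "x \<in> carrier ?F" for x using g that by blast
  have f0: "f \<zero>\<^bsub>P\<^esub> = \<zero>\<^bsub>?F\<^esub>"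
    using f_smult[OF P.R.zero_closed P.M.zero_closed] fc[OF P.M.zero_closed] by simp
  have g0: "g \<zero>\<^bsub>?F\<^esub> = \<zero>\<^bsub>P\<^esub>"
    using g_smult[OF P.R.zero_closed F.M.zero_closed] gc[OF F.M.zero_closed] by simp
  have H_sub: "submodule H R ?F"
    unfolding submodule_iff_closed[OF F] H_def
  proof (intro conjI ballI subsetI)
    show "\<zero>\<^bsub>?F\<^esub> \<in> f ` carrier P" using f0[symmetric] by blast
  qed (auto simp: fc f_add[symmetric] f_smult[symmetric])
  have K_sub: "submodule K R ?F"
    unfolding submodule_iff_closed[OF F] K_def
    by (auto simp: g0 g_add g_smult)
  have prod: "gfinprod (add_monoid ?F) h UNIV = h True \<oplus>\<^bsub>?F\<^esub> h False"
    if "h True \<in> carrier ?F" "h False \<in> carrier ?F" for h :: "bool \<Rightarrow> _"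
    using F.a_comm_monoid[THEN comm_monoid.gfinprod_bool, of h] that by simp
  have HF: "H \<subseteq> carrier ?F" and KF: "K \<subseteq> carrier ?F" using fc by (auto simp: H_def K_def)
  have "internal_direct_sum R ?F UNIV (\<lambda>b. if b then H else K)"
  proof (rule internal_direct_sumI)
    show "abelian_group ?F" by (rule F.abelian_group_axioms)
    show "submodule (if b then H else K) R ?F" for b using H_sub K_sub by simp
    fix x assume x: "x \<in> carrier ?F"
    define h where "h b = (if b then f (g x) else x \<ominus>\<^bsub>?F\<^esub> f (g x))" for b
    have fg: "f (g x) \<in> carrier ?F" using x fc gc by blast
    have neg: "g (\<ominus>\<^bsub>?F\<^esub> y) = \<ominus>\<^bsub>P\<^esub> g y" if y: "y \<in> carrier ?F" for y
    proof -
      have "g (\<ominus>\<^bsub>?F\<^esub> y) \<oplus>\<^bsub>P\<^esub> g y = \<zero>\<^bsub>P\<^esub>"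
        using g_add[of "\<ominus>\<^bsub>?F\<^esub> y" y] y by (simp add: F.M.l_neg g0)
      then show ?thesis using P.M.minus_equality[of "g (\<ominus>\<^bsub>?F\<^esub> y)" "g y"] y gc by simp
    qed
    have "g (x \<ominus>\<^bsub>?F\<^esub> f (g x)) = \<zero>\<^bsub>P\<^esub>"
      using x fg gc[OF x] by (simp add: a_minus_def g_add neg gf P.M.r_neg)
    then have "h \<in> (\<Pi>\<^sub>E b\<in>UNIV. if b then H else K)"
      using x fg gc[OF x] by (auto simp: h_def H_def K_def)
    moreover have "gfinprod (add_monoid ?F) h UNIV = x"
    proof -
      have "gfinprod (add_monoid ?F) h UNIV = f (g x) \<oplus>\<^bsub>?F\<^esub> (x \<ominus>\<^bsub>?F\<^esub> f (g x))"
        using prod[of h] x fg by (simp add: h_def)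
      also have "\<dots> = x"
        using x fg by (simp add: a_minus_def F.M.a_lcomm F.M.r_neg)
      finally show ?thesis .
    qed
    ultimately show "\<exists>h\<in>(\<Pi>\<^sub>E b\<in>UNIV. if b then H else K).
      finite {b \<in> UNIV. h b \<noteq> \<zero>\<^bsub>?F\<^esub>} \<and> gfinprod (add_monoid ?F) h UNIV = x" by auto
  next
    fix h assume h: "h \<in> (\<Pi>\<^sub>E b\<in>UNIV. if b then H else K)" and 0: "gfinprod (add_monoid ?F) h UNIV = \<zero>\<^bsub>?F\<^esub>"
    have hT: "h True \<in> H" and hF: "h False \<in> K" using PiE_mem[OF h, of True] PiE_mem[OF h, of False] by auto
    have sum: "h True \<oplus>\<^bsub>?F\<^esub> h False = \<zero>\<^bsub>?F\<^esub>" using prod[OF subsetD[OF HF hT] subsetD[OF KF hF]] 0 by simp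
    obtain x where x: "x \<in> carrier P" "h True = f x" using hT by (auto simp: H_def)
    have "g (h True \<oplus>\<^bsub>?F\<^esub> h False) = x"
      using hF x fc by (simp add: K_def g_add gf)
    then have "x = \<zero>\<^bsub>P\<^esub>" using sum g0 by simp
    then have T: "h True = \<zero>\<^bsub>?F\<^esub>" using x f0 by simp
    then have "h False = \<zero>\<^bsub>?F\<^esub>" using sum hF KF by (auto simp: subset_iff)
    with T have "h b = \<zero>\<^bsub>?F\<^esub>" for b by (cases b) auto
    then show "\<forall>b\<in>UNIV. h b = \<zero>\<^bsub>?F\<^esub>" by blast
  qed
  moreover have "f \<in> module_iso R P (?F\<lparr>carrier := H\<rparr>)"
  proof -
    have "inj_on f (carrier P)" using gf by (metis inj_onI)
    then have "f \<in> iso (add_monoid P) (add_monoid (?F\<lparr>carrier := H\<rparr>))"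
      by (auto simp: iso_def hom_def bij_betw_def H_def f_add)
    then show ?thesis by (simp add: module_iso_def f_smult)
  qed
  ultimately show ?thesis using P unfolding projective_module_def by blast
qed

lemma finprod_eq_sum:
  assumes "comm_monoid G" "finite A" "h \<in> A \<rightarrow> carrier G"
    and "\<And>x y. x \<otimes>\<^bsub>G\<^esub> y = x + y" "\<one>\<^bsub>G\<^esub> = 0"
  shows "finprod G h A = sum h A"
  using assms(2,3)
proof (induction A rule: finite_induct)
  case (insert i A)
  then show ?case using comm_monoid.finprod_insert[OF assms(1), of A i h] assms(4) by simp
qed (simp add: comm_monoid.finprod_empty[OF assms(1)] assms(5))


section \<open>Modules over the group ring of a cyclic group of prime order\<close>

text \<open>
  A module over the integral group ring of a cyclic group of prime order with a chosen generator.
\<close>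

locale prime_cyclic_module =
  fixes p :: nat
    and C :: "('c, 'y) monoid_scheme"
    and \<alpha> :: 'c
    and M :: "('c \<Rightarrow>\<^sub>0 int, 'm, 'z) module_scheme"
  assumes prime: "Factorial_Ring.prime p"
    and grp: "group C"
    and order: "order C = p"
    and alpha: "\<alpha> \<in> carrier C"
    and generates: "carrier C = generate C {\<alpha>}"
    and modM: "module (group_ring C) M"
begin

sublocale C: group C by (rule grp)
sublocale MM: module "group_ring C" M by (rule modM)

abbreviation R where "R \<equiv> group_ring C"

lemma carrier_R: "carrier R = {a. Poly_Mapping.keys a \<subseteq> carrier C}"
  and one_R: "\<one>\<^bsub>R\<^esub> = frag_of \<one>\<^bsub>C\<^esub>"
  and add_R: "a \<oplus>\<^bsub>R\<^esub> b = a + b"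
  and mult_R: "a \<otimes>\<^bsub>R\<^esub> b = frag_extend (\<lambda>g. frag_extend (\<lambda>h. frag_of (g \<otimes>\<^bsub>C\<^esub> h)) b) a"
  by (simp_all add: group_ring_def)

lemma frag_of_R: "g \<in> carrier C \<Longrightarrow> frag_of g \<in> carrier R"
  by (simp add: carrier_R)

lemma alpha_pow: "\<alpha> [^]\<^bsub>C\<^esub> (j::nat) \<in> carrier C"
  using alpha by simp

lemma frag_of_mult: "frag_of g \<otimes>\<^bsub>R\<^esub> frag_of h = frag_of (g \<otimes>\<^bsub>C\<^esub> h)"
  by (simp add: mult_R)

lemma alpha_pow_p: "\<alpha> [^]\<^bsub>C\<^esub> p = \<one>\<^bsub>C\<^esub>"
  using C.pow_order_eq_1[OF alpha] order by simp

lemma alpha_pow_exists: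
  assumes "g \<in> carrier C"
  obtains j :: nat where "g = \<alpha> [^]\<^bsub>C\<^esub> j"
proof -
  obtain k :: int where k: "g = \<alpha> [^]\<^bsub>C\<^esub> k"
    using assms generates C.generate_pow[OF alpha] by auto
  have p: "int p > 0" using prime prime_gt_0_nat by simp
  have "\<alpha> [^]\<^bsub>C\<^esub> (int p * (k div int p)) = \<one>\<^bsub>C\<^esub>"
    using C.int_pow_pow[OF alpha, of "int p" "k div int p"] alpha_pow_p
    by (simp add: int_pow_int)
  then have "g = \<alpha> [^]\<^bsub>C\<^esub> (k mod int p)"
    using C.int_pow_mult[OF alpha, of "int p * (k div int p)" "k mod int p"] alpha k by simp
  also have "k mod int p = int (nat (k mod int p))" using p by simp
  finally have "g = \<alpha> [^]\<^bsub>C\<^esub> nat (k mod int p)" by (simp add: int_pow_int)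
  then show ?thesis using that by blast
qed

text \<open>
  The generator permutes the elements of the module; outside the carrier the identity is taken, so
  that a permutation of the whole type results.
\<close>

definition sp :: "'m \<Rightarrow> 'm"
  where "sp x = (if x \<in> carrier M then frag_of \<alpha> \<odot>\<^bsub>M\<^esub> x else x)"

lemma sp_pow:
  assumes "x \<in> carrier M"
  shows "(sp ^^ j) x = frag_of (\<alpha> [^]\<^bsub>C\<^esub> j) \<odot>\<^bsub>M\<^esub> x" "(sp ^^ j) x \<in> carrier M"
proof -
  have "(sp ^^ j) x = frag_of (\<alpha> [^]\<^bsub>C\<^esub> j) \<odot>\<^bsub>M\<^esub> x \<and> (sp ^^ j) x \<in> carrier M"
  proof (induction j)
    case 0
    then show ?case using assms MM.smult_one[OF assms] by (simp add: one_R)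
  next
    case (Suc j)
    have "(sp ^^ Suc j) x = frag_of \<alpha> \<odot>\<^bsub>M\<^esub> (frag_of (\<alpha> [^]\<^bsub>C\<^esub> j) \<odot>\<^bsub>M\<^esub> x)"
      using Suc sp_def[of "(sp ^^ j) x"] by (metis comp_apply funpow.simps(2))
    also have "\<dots> = frag_of (\<alpha> [^]\<^bsub>C\<^esub> Suc j) \<odot>\<^bsub>M\<^esub> x"
      using MM.smult_assoc1[OF frag_of_R[OF alpha] frag_of_R[OF alpha_pow] assms, of j]
      by (simp only: frag_of_mult C.nat_pow_Suc2[OF alpha])
    finally have "(sp ^^ Suc j) x = frag_of (\<alpha> [^]\<^bsub>C\<^esub> Suc j) \<odot>\<^bsub>M\<^esub> x" .
    moreover have "frag_of (\<alpha> [^]\<^bsub>C\<^esub> Suc j) \<odot>\<^bsub>M\<^esub> x \<in> carrier M"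
      by (rule MM.smult_closed[OF frag_of_R[OF alpha_pow] assms])
    ultimately show ?case by simp
  qed
  then show "(sp ^^ j) x = frag_of (\<alpha> [^]\<^bsub>C\<^esub> j) \<odot>\<^bsub>M\<^esub> x" "(sp ^^ j) x \<in> carrier M" by auto
qed

sublocale prime_cyclic_perm sp p
proof
  show "sp ^^ p = id"
  proof
    fix x
    show "(sp ^^ p) x = id x"
    proof (cases "x \<in> carrier M")
      case True
      then show ?thesis using sp_pow(1)[OF True, of p] MM.smult_one[OF True]
        by (simp add: alpha_pow_p one_R)
    next
      case False
      then have "(sp ^^ n) x = x" for n by (induction n) (simp_all add: sp_def)
      then show ?thesis by simp
    qed
  qed
qed (rule prime)

text \<open>
  The underlying set of \<open>\<int>M\<close>, and the scalar multiplication on it.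
\<close>

definition ZM :: "('m \<Rightarrow>\<^sub>0 int) set"
  where "ZM = {c. Poly_Mapping.keys c \<subseteq> carrier M}"

definition sm :: "('c \<Rightarrow>\<^sub>0 int) \<Rightarrow> ('m \<Rightarrow>\<^sub>0 int) \<Rightarrow> ('m \<Rightarrow>\<^sub>0 int)"
  where "sm r c = frag_extend (\<lambda>g. frag_extend (\<lambda>x. frag_of (frag_of g \<odot>\<^bsub>M\<^esub> x)) c) r"

lemma sm_alpha_pow:
  assumes "c \<in> ZM"
  shows "sm (frag_of (\<alpha> [^]\<^bsub>C\<^esub> j)) c = (sg ^^ j) c"
proof -
  have "Poly_Mapping.keys c \<subseteq> carrier M" using assms by (simp add: ZM_def)
  then show ?thesis
  proof (induction c rule: frag_induction)
    case (one x)
    then show ?case by (simp add: sm_def sg_pow_frag_of sp_pow(1))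
  next
    case (diff a b)
    then show ?case by (simp add: sm_def frag_extend_diff sg_pow_diff)
  qed (simp add: sm_def)
qed

lemma sm_alpha: "c \<in> ZM \<Longrightarrow> sm (frag_of \<alpha>) c = sg c"
  using sm_alpha_pow[of c 1] alpha by simp

lemma sm_add_left: "sm (a + b) c = sm a c + sm b c"
  and sm_diff_left: "sm (a - b) c = sm a c - sm b c"
  and sm_minus_left: "sm (- a) c = - sm a c"
  and sm_zero_left [simp]: "sm 0 c = 0"
  and sm_cmul_left: "sm (frag_cmul k a) c = frag_cmul k (sm a c)"
  by (simp_all add: sm_def frag_extend_add frag_extend_diff frag_extend_minus frag_extend_cmul)

lemma sm_sum_left: "finite I \<Longrightarrow> sm (sum f I) c = (\<Sum>i\<in>I. sm (f i) c)"
  by (induction I rule: finite_induct) (simp_all add: sm_add_left)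

lemma R_induct [consumes 1, case_names zero pow diff]:
  assumes "r \<in> carrier R" "Q 0" "\<And>j. Q (frag_of (\<alpha> [^]\<^bsub>C\<^esub> (j::nat)))"
    "\<And>a b. a \<in> carrier R \<Longrightarrow> b \<in> carrier R \<Longrightarrow> Q a \<Longrightarrow> Q b \<Longrightarrow> Q (a - b)"
  shows "Q r"
proof -
  have "Poly_Mapping.keys r \<subseteq> carrier C" using assms(1) by (simp add: carrier_R)
  then have "r \<in> carrier R \<and> Q r"
  proof (induction r rule: frag_induction)
    case zero
    then show ?case using assms(2) by (simp add: carrier_R)
  next
    case (one g)
    then show ?case using assms(3) alpha_pow_exists frag_of_R by metis
  next
    case (diff a b)
    then have "a - b \<in> carrier R" using keys_diff[of a b] unfolding carrier_R by blast
    then show ?case using diff assms(4) by blast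
  qed
  then show ?thesis ..
qed

lemma submod_ZM: "submod ZM"
proof -
  have "sg c \<in> ZM" if "c \<in> ZM" for c
  proof -
    have "Poly_Mapping.keys c \<subseteq> carrier M" using that by (simp add: ZM_def)
    then have "Poly_Mapping.keys (sg c) \<subseteq> carrier M"
    proof (induction c rule: frag_induction)
      case (one x)
      then show ?case using sp_pow(2)[of x 1] by simp
    next
      case (diff a b)
      then show ?case unfolding sg_diff using keys_diff[of "sg a" "sg b"] by blast
    qed simp
    then show ?thesis by (simp add: ZM_def)
  qed
  moreover have "c - d \<in> ZM" if "c \<in> ZM" "d \<in> ZM" for c d
    using that keys_diff[of c d] unfolding ZM_def by blast
  ultimately show ?thesis unfolding submod_def by (simp add: ZM_def)
qed

lemma sm_closed:
  assumes "submod P" "P \<subseteq> ZM" "r \<in> carrier R" "c \<in> P"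
  shows "sm r c \<in> P"
  using assms(3)
proof (induction r rule: R_induct)
  case (pow j)
  have "c \<in> ZM" using assms by blast
  then show ?case using assms by (simp add: sm_alpha_pow submod_sg_pow)
qed (use assms in \<open>auto simp: sm_diff_left intro: submod_zero submod_diff\<close>)

lemma sm_add_right:
  assumes "r \<in> carrier R" "c \<in> ZM" "d \<in> ZM"
  shows "sm r (c + d) = sm r c + sm r d"
  using assms(1)
proof (induction r rule: R_induct)
  case (pow j)
  have "c + d \<in> ZM" using assms submod_add[OF submod_ZM] by blast
  then show ?case using assms by (simp add: sm_alpha_pow sg_pow_add)
qed (simp_all add: sm_diff_left algebra_simps)

lemma sm_assoc:
  assumes "r \<in> carrier R" "t \<in> carrier R" "c \<in> ZM"
  shows "sm (r \<otimes>\<^bsub>R\<^esub> t) c = sm r (sm t c)"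
  using assms(1)
proof (induction r rule: R_induct)
  case (pow j)
  have tc: "sm t c \<in> ZM" by (rule sm_closed[OF submod_ZM order_refl assms(2,3)])
  have "sm (frag_of (\<alpha> [^]\<^bsub>C\<^esub> j) \<otimes>\<^bsub>R\<^esub> t) c = (sg ^^ j) (sm t c)"
    using assms(2)
  proof (induction t rule: R_induct)
    case (pow k)
    have "frag_of (\<alpha> [^]\<^bsub>C\<^esub> j) \<otimes>\<^bsub>R\<^esub> frag_of (\<alpha> [^]\<^bsub>C\<^esub> k) = frag_of (\<alpha> [^]\<^bsub>C\<^esub> (j + k))"
      by (simp add: frag_of_mult C.nat_pow_mult alpha)
    then show ?case using assms(3) by (simp add: sm_alpha_pow funpow_add)
  next
    case (diff a b)
    then show ?case by (simp add: mult_R frag_extend_diff sm_diff_left sg_pow_diff)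
  qed (simp add: mult_R)
  then show ?case by (simp add: sm_alpha_pow tc)
next
  case (diff a b)
  then show ?case by (simp add: mult_R frag_extend_diff sm_diff_left)
qed (simp add: mult_R)

text \<open>
  The submodule of \<open>\<int>M\<close> with carrier \<open>P\<close>. Replacing the carrier discards the kernel condition, so
  \<open>P\<close> may be any submodule of \<open>\<int>M\<close>.
\<close>

abbreviation KM :: "('m \<Rightarrow>\<^sub>0 int) set \<Rightarrow> ('c \<Rightarrow>\<^sub>0 int, 'm \<Rightarrow>\<^sub>0 int) module"
  where "KM P \<equiv> (kernel_module M)\<lparr>carrier := P\<rparr>"

lemma KM_simps:
  "carrier (KM P) = P" "x \<oplus>\<^bsub>KM P\<^esub> y = x + y" "\<zero>\<^bsub>KM P\<^esub> = 0" "r \<odot>\<^bsub>KM P\<^esub> x = sm r x"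
  "x \<oplus>\<^bsub>kernel_module M\<^esub> y = x + y" "\<zero>\<^bsub>kernel_module M\<^esub> = 0" "r \<odot>\<^bsub>kernel_module M\<^esub> x = sm r x"
  by (simp_all add: kernel_module_def int_free_module_def sm_def)

lemma module_KM:
  assumes P: "submod P" "P \<subseteq> ZM"
  shows "module R (KM P)"
proof (rule moduleI)
  show "cring R" by (rule MM.R.is_cring)
  show "abelian_group (KM P)"
  proof (rule abelian_groupI)
    fix x assume x: "x \<in> carrier (KM P)"
    show "\<exists>y\<in>carrier (KM P). y \<oplus>\<^bsub>KM P\<^esub> x = \<zero>\<^bsub>KM P\<^esub>"
      using x submod_minus[OF P(1)] unfolding KM_simps by (intro bexI[of _ "- x"]) auto
  qed (use P in \<open>simp_all add: KM_simps submod_add submod_zero algebra_simps\<close>)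
next
  fix x assume "x \<in> carrier (KM P)"
  then have "x \<in> ZM" using P by (auto simp: KM_simps)
  then show "\<one>\<^bsub>R\<^esub> \<odot>\<^bsub>KM P\<^esub> x = x"
    using sm_alpha_pow[of x 0] by (simp add: KM_simps one_R)
qed (use P in \<open>auto simp: KM_simps sm_closed add_R sm_add_left intro!: sm_add_right sm_assoc\<close>)

lemma submodule_KM_iff:
  assumes P: "submod P" "P \<subseteq> ZM"
  shows "submodule H R (KM P) \<longleftrightarrow> submod H \<and> H \<subseteq> P"
proof
  assume H: "submod H \<and> H \<subseteq> P"
  then show "submodule H R (KM P)"
    unfolding submodule_iff_closed[OF module_KM[OF P]] KM_simps
    using P by (auto intro: submod_zero submod_add sm_closed)
next
  assume "submodule H R (KM P)"
  then have H: "H \<subseteq> P" "0 \<in> H" "\<And>x y. x \<in> H \<Longrightarrow> y \<in> H \<Longrightarrow> x + y \<in> H"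
    "\<And>r x. r \<in> carrier R \<Longrightarrow> x \<in> H \<Longrightarrow> sm r x \<in> H"
    unfolding submodule_iff_closed[OF module_KM[OF P]] KM_simps by auto
  have "sg x \<in> H" if "x \<in> H" for x
    using H(4)[OF frag_of_R[OF alpha] that] sm_alpha[of x] that H(1) P(2) by auto
  moreover have "x - y \<in> H" if xy: "x \<in> H" "y \<in> H" for x y
  proof -
    have "y \<in> ZM" using xy H(1) P(2) by blast
    then have "sm (- frag_of \<one>\<^bsub>C\<^esub>) y = - y"
      using sm_alpha_pow[of y 0] by (simp add: sm_minus_left)
    moreover have "- frag_of \<one>\<^bsub>C\<^esub> \<in> carrier R" by (simp add: carrier_R keys_minus)
    ultimately have "- y \<in> H" using H(4) xy(2) by metis
    then show ?thesis using H(3)[OF xy(1)] by fastforce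
  qed
  ultimately show "submod H \<and> H \<subseteq> P" using H(1,2) by (simp add: submod_def)
qed

lemma finitely_generated_KM:
  assumes P: "submod P" "P \<subseteq> ZM" and db: "dual_basis P"
  shows "finitely_generated_module R (KM P)"
proof -
  obtain n a \<chi> where d: "(\<forall>i<n::nat. a i \<in> P \<and> (\<forall>x\<in>P. \<forall>y\<in>P. \<chi> i (x + y) = \<chi> i x + \<chi> i y)) \<and>
    (\<forall>x\<in>P. x = (\<Sum>i<n. tr (\<chi> i) (a i) x))"
    using db unfolding dual_basis_def by (elim exE)
  note a = d[THEN conjunct1] and exp = d[THEN conjunct2]
  have "(\<lambda>H. submodule H R (KM P)) hull (a ` {..<n}) = P"
  proof (rule hull_unique)
    show "a ` {..<n} \<subseteq> P" using a by auto
    show "submodule P R (KM P)" using submodule_KM_iff[OF P] P by simp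
    fix H assume H: "a ` {..<n} \<subseteq> H" "submodule H R (KM P)"
    then have sH: "submod H" using submodule_KM_iff[OF P] by simp
    show "P \<subseteq> H"
    proof
      fix x assume "x \<in> P"
      then have "x = (\<Sum>i<n. tr (\<chi> i) (a i) x)" using exp by blast
      also have "\<dots> \<in> H" using H(1) by (intro submod_sum[OF sH] tr_closed[OF sH]) auto
      finally show "x \<in> H" .
    qed
  qed
  moreover have "a ` {..<n} \<subseteq> carrier (KM P)" using a by (auto simp: KM_simps)
  ultimately show ?thesis
    unfolding finitely_generated_module_def by (intro exI[of _ "a ` {..<n}"]) (simp add: KM_simps)
qed


text \<open>
  A dual basis exhibits the module as a retract of the free module of rank \<open>n\<close>. The basis of the latter
  has to consist of elements of the given type, here \<open>n\<close> distinct multiples of one basis element.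
\<close>

lemma projective_KM:
  assumes P: "submod P" "P \<subseteq> ZM" and db: "dual_basis P"
  shows "projective_module R (KM P)"
proof -
  obtain n a \<chi> where d: "(\<forall>i<n::nat. a i \<in> P \<and> (\<forall>x\<in>P. \<forall>y\<in>P. \<chi> i (x + y) = \<chi> i x + \<chi> i y)) \<and>
    (\<forall>x\<in>P. x = (\<Sum>i<n. tr (\<chi> i) (a i) x))"
    using db unfolding dual_basis_def by (elim exE)
  note a = d[THEN conjunct1] and exp = d[THEN conjunct2]
  define e :: "nat \<Rightarrow> 'm \<Rightarrow>\<^sub>0 int" where "e i = frag_cmul (int i) (frag_of undefined)" for i
  have "inj e"
  proof (rule injI)
    fix i j assume "e i = e j"
    then have "Poly_Mapping.lookup (e i) undefined = Poly_Mapping.lookup (e j) undefined" by simp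
    then show "i = j" by (simp add: e_def)
  qed
  then have idx: "inv_into UNIV e (e i) = i" for i by simp
  define B where "B = e ` {..<n}"
  have finB: "finite B" by (simp add: B_def)
  let ?F = "free_module R B"
  have cring: "cring R" by (rule MM.R.is_cring)
  have carF: "carrier ?F = (\<Pi>\<^sub>E b\<in>B. carrier R)"
    using finB by (simp add: carrier_free_module[OF cring])
  have F_simps: "f \<oplus>\<^bsub>?F\<^esub> g = (\<lambda>i\<in>B. f i + g i)" "r \<odot>\<^bsub>?F\<^esub> f = (\<lambda>i\<in>B. r \<otimes>\<^bsub>R\<^esub> f i)" for f g r
    by (simp_all add: free_module_def add_R)
  define \<theta> where "\<theta> i x = (\<Sum>j<p. frag_cmul (\<chi> i ((sg ^^ (p - j)) x)) (frag_of (\<alpha> [^]\<^bsub>C\<^esub> j)))" for i x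
  have R_sum: "sum h J \<in> carrier R" if "\<And>j. j \<in> J \<Longrightarrow> h j \<in> carrier R" for h and J :: "nat set"
    using that
  proof (induction J rule: infinite_finite_induct)
    case (insert j J)
    then have "h j \<oplus>\<^bsub>R\<^esub> sum h J \<in> carrier R" by (intro MM.R.a_closed) auto
    then show ?case using insert by (simp add: add_R)
  qed (simp_all add: carrier_R)
  have \<theta>_R: "\<theta> i x \<in> carrier R" for i x
    unfolding \<theta>_def
  proof (rule R_sum)
    show "frag_cmul k (frag_of (\<alpha> [^]\<^bsub>C\<^esub> (j::nat))) \<in> carrier R" for k j
      using keys_cmul[of k "frag_of (\<alpha> [^]\<^bsub>C\<^esub> j)"] alpha_pow[of j] by (auto simp: carrier_R)
  qed
  have \<theta>_add: "\<theta> i (x + y) = \<theta> i x + \<theta> i y" if "i < n" "x \<in> P" "y \<in> P" for i x y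
    using that a by (simp add: \<theta>_def sg_pow_add submod_sg_pow[OF P(1)] frag_cmul_distrib sum.distrib)
  have \<theta>_diff: "\<theta> i (x - y) = \<theta> i x - \<theta> i y" if "i < n" "x \<in> P" "y \<in> P" for i x y
    by (rule additive_diff[of P]) (use that \<theta>_add submod_diff[OF P(1)] in auto)
  have \<theta>_sg: "\<theta> i (sg x) = frag_of \<alpha> \<otimes>\<^bsub>R\<^esub> \<theta> i x" for i x
  proof -
    let ?f = "\<lambda>j. frag_cmul (\<chi> i ((sg ^^ (Suc p - j)) x)) (frag_of (\<alpha> [^]\<^bsub>C\<^esub> j))"
    have "\<theta> i (sg x) = sum ?f {..<p}"
      unfolding \<theta>_def by (intro sum.cong) (simp_all add: Suc_diff_le funpow_swap1)
    also have "\<dots> = (\<Sum>j<p. ?f (Suc j))"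
      using sum.lessThan_Suc_shift[of ?f p] sum.lessThan_Suc[of ?f p]
      by (simp add: sg_pow_p alpha_pow_p del: sum.lessThan_Suc)
    also have "\<dots> = frag_of \<alpha> \<otimes>\<^bsub>R\<^esub> \<theta> i x"
    proof -
      have "frag_of \<alpha> \<otimes>\<^bsub>R\<^esub> \<theta> i x
        = (\<Sum>j<p. frag_cmul (\<chi> i ((sg ^^ (p - j)) x)) (frag_of (\<alpha> \<otimes>\<^bsub>C\<^esub> \<alpha> [^]\<^bsub>C\<^esub> j)))"
        by (simp add: mult_R \<theta>_def frag_extend_sum frag_extend_cmul)
      then show ?thesis by (simp add: C.nat_pow_Suc2[OF alpha, symmetric] del: C.nat_pow_Suc)
    qed
    finally show ?thesis .
  qed
  have \<theta>_sm: "\<theta> i (sm r x) = r \<otimes>\<^bsub>R\<^esub> \<theta> i x" if r: "r \<in> carrier R" and i: "i < n" and x: "x \<in> P" for r i x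
    using r
  proof (induction r rule: R_induct)
    case zero
    have "\<theta> i 0 = 0" using \<theta>_diff[OF i x x] by simp
    then show ?case by (simp add: mult_R)
  next
    case (pow j)
    have "\<theta> i ((sg ^^ j) x) = frag_of (\<alpha> [^]\<^bsub>C\<^esub> j) \<otimes>\<^bsub>R\<^esub> \<theta> i x"
    proof (induction j)
      case 0
      then show ?case using MM.R.l_one[OF \<theta>_R] by (simp add: one_R)
    next
      case (Suc j)
      have "\<theta> i ((sg ^^ Suc j) x) = frag_of \<alpha> \<otimes>\<^bsub>R\<^esub> (frag_of (\<alpha> [^]\<^bsub>C\<^esub> j) \<otimes>\<^bsub>R\<^esub> \<theta> i x)"
        by (simp add: \<theta>_sg Suc)
      also have "\<dots> = frag_of (\<alpha> [^]\<^bsub>C\<^esub> Suc j) \<otimes>\<^bsub>R\<^esub> \<theta> i x"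
        using MM.R.m_assoc[OF frag_of_R[OF alpha] frag_of_R[OF alpha_pow[of j]] \<theta>_R]
        by (simp only: frag_of_mult C.nat_pow_Suc2[OF alpha])
      finally show ?case .
    qed
    moreover have "x \<in> ZM" using x P by blast
    ultimately show ?case by (simp add: sm_alpha_pow)
  next
    case (diff r t)
    have "\<theta> i (sm r x - sm t x) = \<theta> i (sm r x) - \<theta> i (sm t x)"
      by (rule \<theta>_diff[OF i sm_closed[OF P diff(1) x] sm_closed[OF P diff(2) x]])
    then show ?case using diff by (simp add: sm_diff_left mult_R frag_extend_diff)
  qed
  define f where "f x = (\<lambda>b\<in>B. \<theta> (inv_into UNIV e b) x)" for x
  define g where "g h = (\<Sum>i<n. sm (h (e i)) (a i))" for h
  have aP: "a i \<in> P" if "i < n" for i using a that by blast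
  have aZ: "a i \<in> ZM" if "i < n" for i using aP[OF that] P(2) by blast
  have e_B: "e i \<in> B" if "i < n" for i using that by (simp add: B_def)
  have h_R: "h (e i) \<in> carrier R" if "h \<in> carrier ?F" "i < n" for h i
    using that(1) e_B[OF that(2)] unfolding carF by (rule PiE_mem)
  have B_idx: "\<exists>i<n. b = e i" if "b \<in> B" for b using that by (auto simp: B_def)
  have g_P: "g h \<in> P" if "h \<in> carrier ?F" for h
    unfolding g_def using that by (intro submod_sum[OF P(1)] sm_closed[OF P]) (auto simp: h_R aP)
  show ?thesis
  proof (rule projective_moduleI[where f = f and g = g and B = B])
    show "module R (KM P)" by (rule module_KM[OF P])
    show "f \<in> carrier (KM P) \<rightarrow> carrier ?F"
      by (auto simp: carF f_def \<theta>_R)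
    show "g \<in> carrier ?F \<rightarrow> carrier (KM P)" using g_P by (auto simp: KM_simps)
    show "f (x \<oplus>\<^bsub>KM P\<^esub> y) = f x \<oplus>\<^bsub>?F\<^esub> f y" if "x \<in> carrier (KM P)" "y \<in> carrier (KM P)" for x y
      using that B_idx by (fastforce simp: f_def F_simps fun_eq_iff KM_simps idx \<theta>_add)
    show "f (r \<odot>\<^bsub>KM P\<^esub> x) = r \<odot>\<^bsub>?F\<^esub> f x" if "r \<in> carrier R" "x \<in> carrier (KM P)" for r x
      using that B_idx by (fastforce simp: f_def F_simps fun_eq_iff KM_simps idx \<theta>_sm)
    show "g (h \<oplus>\<^bsub>?F\<^esub> k) = g h \<oplus>\<^bsub>KM P\<^esub> g k" if "h \<in> carrier ?F" "k \<in> carrier ?F" for h k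
      by (simp add: g_def F_simps KM_simps e_B sm_add_left sum.distrib)
    show "g (r \<odot>\<^bsub>?F\<^esub> h) = r \<odot>\<^bsub>KM P\<^esub> g h" if r: "r \<in> carrier R" and h: "h \<in> carrier ?F" for r h
    proof -
      have Z: "sm (h (e i)) (a i) \<in> ZM" if "i < n" for i
        using sm_closed[OF submod_ZM order_refl h_R[OF h that] aZ[OF that]] .
      have sm_sum: "sm r (sum k J) = (\<Sum>i\<in>J. sm r (k i))" if "\<And>i. i \<in> J \<Longrightarrow> k i \<in> ZM" for k and J :: "nat set"
        using that
      proof (induction J rule: infinite_finite_induct)
        case (insert i J)
        then show ?case by (simp add: sm_add_right[OF r] submod_sum[OF submod_ZM])
      qed (simp_all add: sm_def frag_extend_eq_0)
      have "g (r \<odot>\<^bsub>?F\<^esub> h) = (\<Sum>i<n. sm r (sm (h (e i)) (a i)))"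
        unfolding g_def by (intro sum.cong) (simp_all add: F_simps e_B sm_assoc r h_R[OF h] aZ)
      also have "\<dots> = sm r (g h)" unfolding g_def by (rule sm_sum[symmetric]) (use Z in auto)
      finally show ?thesis by (simp add: KM_simps)
    qed
    show "g (f x) = x" if "x \<in> carrier (KM P)" for x
    proof -
      have x: "x \<in> P" using that by (simp add: KM_simps)
      have "g (f x) = (\<Sum>i<n. sm (\<theta> i x) (a i))"
        by (simp add: g_def f_def e_B idx)
      also have "\<dots> = (\<Sum>i<n. tr (\<chi> i) (a i) x)"
        by (intro sum.cong) (simp_all add: \<theta>_def tr_def sm_sum_left sm_cmul_left sm_alpha_pow aZ)
      also have "\<dots> = x" using exp x by metis
      finally show ?thesis .
    qed
  qed
qed

lemma eval_superset:
  assumes "finite S" "Poly_Mapping.keys c \<subseteq> S" "S \<subseteq> carrier M"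
  shows "eval_map M c = (\<Oplus>\<^bsub>M\<^esub>x\<in>S. [Poly_Mapping.lookup c x] \<cdot>\<^bsub>M\<^esub> x)"
  unfolding eval_map_def
  by (rule MM.M.add.finprod_mono_neutral_cong_left)
    (use assms in \<open>auto simp: in_keys_iff add_pow_def[of M "0::int"] intro: MM.M.add.int_pow_closed\<close>)

lemma eval_closed: "c \<in> ZM \<Longrightarrow> eval_map M c \<in> carrier M"
  unfolding eval_map_def by (rule MM.M.finsum_closed) (auto simp: ZM_def intro: MM.M.add.int_pow_closed)

lemma eval_add:
  assumes "c \<in> ZM" "d \<in> ZM"
  shows "eval_map M (c + d) = eval_map M c \<oplus>\<^bsub>M\<^esub> eval_map M d"
proof -
  let ?S = "Poly_Mapping.keys c \<union> Poly_Mapping.keys d"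
  have S: "finite ?S" "?S \<subseteq> carrier M" using assms by (auto simp: ZM_def)
  have "eval_map M (c + d) = (\<Oplus>\<^bsub>M\<^esub>x\<in>?S. [Poly_Mapping.lookup (c + d) x] \<cdot>\<^bsub>M\<^esub> x)"
    by (rule eval_superset[OF S(1) keys_add S(2)])
  also have "\<dots> = (\<Oplus>\<^bsub>M\<^esub>x\<in>?S. [Poly_Mapping.lookup c x] \<cdot>\<^bsub>M\<^esub> x \<oplus>\<^bsub>M\<^esub> [Poly_Mapping.lookup d x] \<cdot>\<^bsub>M\<^esub> x)"
    using S(2) by (intro MM.M.finsum_cong') (auto simp: lookup_add MM.M.add.int_pow_mult)
  also have "\<dots> = (\<Oplus>\<^bsub>M\<^esub>x\<in>?S. [Poly_Mapping.lookup c x] \<cdot>\<^bsub>M\<^esub> x) \<oplus>\<^bsub>M\<^esub> (\<Oplus>\<^bsub>M\<^esub>x\<in>?S. [Poly_Mapping.lookup d x] \<cdot>\<^bsub>M\<^esub> x)"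
    using S(2) by (intro MM.M.finsum_addf) auto
  also have "\<dots> = eval_map M c \<oplus>\<^bsub>M\<^esub> eval_map M d"
    using eval_superset[OF S(1) _ S(2), of c] eval_superset[OF S(1) _ S(2), of d] by simp
  finally show ?thesis .
qed

lemma eval_zero: "eval_map M 0 = \<zero>\<^bsub>M\<^esub>"
  by (simp add: eval_map_def)

lemma eval_frag_of: "x \<in> carrier M \<Longrightarrow> eval_map M (frag_of x) = x"
  using eval_superset[of "{x}" "frag_of x"] by simp

lemma eval_diff:
  assumes "c \<in> ZM" "d \<in> ZM"
  shows "eval_map M (c - d) = eval_map M c \<ominus>\<^bsub>M\<^esub> eval_map M d"
proof -
  have cd: "c - d \<in> ZM" by (rule submod_diff[OF submod_ZM assms])
  have "eval_map M c = eval_map M (c - d) \<oplus>\<^bsub>M\<^esub> eval_map M d"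
    using eval_add[OF cd assms(2)] by simp
  then show ?thesis
    using eval_closed[OF cd] eval_closed[OF assms(2)]
    by (simp add: a_minus_def MM.M.a_assoc MM.M.r_neg)
qed

lemma eval_sg:
  assumes "c \<in> ZM"
  shows "eval_map M (sg c) = frag_of \<alpha> \<odot>\<^bsub>M\<^esub> eval_map M c"
proof -
  have "Poly_Mapping.keys c \<subseteq> carrier M" using assms by (simp add: ZM_def)
  then have "c \<in> ZM \<and> eval_map M (sg c) = frag_of \<alpha> \<odot>\<^bsub>M\<^esub> eval_map M c"
  proof (induction c rule: frag_induction)
    case zero
    then show ?case using MM.smult_r_null[OF frag_of_R[OF alpha]] by (simp add: eval_zero ZM_def)
  next
    case (one x)
    then have "sp x \<in> carrier M" using sp_pow(2)[of x 1] by simp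
    then show ?case using one by (simp add: eval_frag_of ZM_def) (simp add: sp_def)
  next
    case (diff c d)
    have "sg c \<in> ZM" "sg d \<in> ZM" using diff submod_sg[OF submod_ZM] by auto
    then have "eval_map M (sg (c - d)) = frag_of \<alpha> \<odot>\<^bsub>M\<^esub> eval_map M c \<ominus>\<^bsub>M\<^esub> frag_of \<alpha> \<odot>\<^bsub>M\<^esub> eval_map M d"
      using diff by (simp add: sg_diff eval_diff)
    also have "\<dots> = frag_of \<alpha> \<odot>\<^bsub>M\<^esub> (eval_map M c \<ominus>\<^bsub>M\<^esub> eval_map M d)"
      using diff eval_closed
      by (simp add: a_minus_def MM.smult_r_distr MM.smult_r_minus frag_of_R alpha)
    finally show ?case using diff eval_diff submod_diff[OF submod_ZM] by simp
  qed
  then show ?thesis ..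
qed

text \<open>
  The underlying set of the kernel \<open>N\<^sub>M\<close>.
\<close>

definition NM :: "('m \<Rightarrow>\<^sub>0 int) set"
  where "NM = {c \<in> ZM. eval_map M c = \<zero>\<^bsub>M\<^esub>}"

lemma carrier_kernel_module: "carrier (kernel_module M) = NM"
  by (simp add: kernel_module_def a_kernel_def' NM_def ZM_def int_free_module_def)

lemma submod_NM: "submod NM"
  unfolding submod_def
proof (intro conjI ballI)
  show "0 \<in> NM" by (simp add: NM_def eval_zero submod_zero[OF submod_ZM])
  show "x - y \<in> NM" if "x \<in> NM" "y \<in> NM" for x y
    using that by (simp add: NM_def eval_diff submod_diff[OF submod_ZM] MM.M.r_neg a_minus_def)
  show "sg x \<in> NM" if "x \<in> NM" for x
    using that MM.smult_r_null[OF frag_of_R[OF alpha]]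
    by (simp add: NM_def eval_sg submod_sg[OF submod_ZM])
qed

text \<open>
  If \<open>l = \<lambda>c\<close> lies in the kernel, then the image \<open>m\<close> of \<open>c\<close> in \<open>M\<close> is a fixed point. So the basis element at \<open>m\<close>
  is fixed, and subtracting it from \<open>c\<close> gives an element of the kernel with the same image under \<open>\<lambda>\<close>.
\<close>

lemma NM_cohomology_vanishes:
  assumes l: "l \<in> NM" "act nrm l = 0"
  shows "\<exists>l'\<in>NM. l = act lam l'"
proof -
  have "\<exists>c. l = act lam c \<and> Poly_Mapping.keys c \<subseteq> carrier M"
    by (rule nrm_kernel_eq_lam_image[OF l(2)]) (use l(1) sp_pow(2)[of _ 1] in \<open>auto simp: NM_def ZM_def\<close>)
  then obtain c where c: "l = act lam c" "c \<in> ZM" by (auto simp: ZM_def)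
  define m where "m = eval_map M c"
  have m: "m \<in> carrier M" using eval_closed[OF c(2)] by (simp add: m_def)
  have "frag_of \<alpha> \<odot>\<^bsub>M\<^esub> m \<ominus>\<^bsub>M\<^esub> m = \<zero>\<^bsub>M\<^esub>"
    using l(1) c by (simp add: NM_def act_lam eval_diff submod_sg[OF submod_ZM] eval_sg m_def)
  moreover have am: "frag_of \<alpha> \<odot>\<^bsub>M\<^esub> m \<in> carrier M" by (rule MM.smult_closed[OF frag_of_R[OF alpha] m])
  moreover have "(frag_of \<alpha> \<odot>\<^bsub>M\<^esub> m \<ominus>\<^bsub>M\<^esub> m) \<oplus>\<^bsub>M\<^esub> m = frag_of \<alpha> \<odot>\<^bsub>M\<^esub> m"
    using m am by (simp add: a_minus_def MM.M.a_assoc MM.M.l_neg)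
  ultimately have "frag_of \<alpha> \<odot>\<^bsub>M\<^esub> m = m" using m by simp
  then have "sp m = m" using m by (simp add: sp_def)
  then have "act lam (frag_of m) = 0" by (simp add: act_lam)
  then have "l = act lam (c - frag_of m)" using c(1) by (simp add: act_diff_right)
  moreover have "frag_of m \<in> ZM" using m by (simp add: ZM_def)
  then have "c - frag_of m \<in> NM"
    using c(2) m by (simp add: NM_def submod_diff[OF submod_ZM] eval_diff eval_frag_of MM.M.r_neg a_minus_def flip: m_def)
  ultimately show ?thesis by blast
qed

lemma gfinprod_KM:
  assumes "submod P" "P \<subseteq> ZM" "\<And>i. i \<in> I \<Longrightarrow> h i \<in> P" "finite {i \<in> I. h i \<noteq> 0}"
  shows "gfinprod (add_monoid (KM P)) h I = sum h {i \<in> I. h i \<noteq> 0}"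
proof -
  interpret K: module R "KM P" by (rule module_KM[OF assms(1,2)])
  have "finprod (add_monoid (KM P)) h {i \<in> I. h i \<noteq> 0} = sum h {i \<in> I. h i \<noteq> 0}"
    by (rule finprod_eq_sum[OF K.a_comm_monoid]) (use assms(3,4) in \<open>auto simp: KM_simps\<close>)
  then show ?thesis using assms(4) by (simp add: gfinprod_def KM_simps)
qed

lemma KM_NM: "KM NM = kernel_module M"
  by (simp add: carrier_kernel_module[symmetric])

lemma internal_direct_sum_kernel_module:
  assumes dec: "direct_decomposition NM I P T"
  shows "internal_direct_sum R (kernel_module M) (insert None (Some ` P ` I)) (case_option T id)"
proof -
  let ?J = "insert None (Some ` P ` I)" and ?F = "case_option T id"
  have P: "submod (P x) \<and> P x \<subseteq> NM \<and> P x \<noteq> {0}" if "x \<in> I" for x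
    using bspec[OF direct_decompositionD(1)[OF dec] that] by simp
  note T = direct_decompositionD(2,3)[OF dec]
  note span = bspec[OF direct_decompositionD(5)[OF dec]]
  have indep: "t = 0 \<and> (\<forall>x\<in>F. f x = 0)"
    if "finite F" "F \<subseteq> I" "\<forall>x\<in>F. f x \<in> P x" "t \<in> T" "sum f F + t = 0" for F f t
    by (rule mp[OF spec[OF spec[OF spec[OF direct_decompositionD(6)[OF dec]]]]]) (intro conjI that)
  have NM_ZM: "NM \<subseteq> ZM" by (auto simp: NM_def)
  note NM = submod_NM NM_ZM
  have inj: "inj_on P I"
  proof (rule inj_onI, rule ccontr)
    fix x y assume xy: "x \<in> I" "y \<in> I" "P x = P y" "x \<noteq> y"
    have "0 \<in> P x" using P[OF xy(1)] submod_zero by blast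
    then obtain u where u: "u \<in> P x" "u \<noteq> 0" using P[OF xy(1)] by blast
    let ?f = "\<lambda>z. if z = x then u else - u"
    have "- u \<in> P y" using u(1) xy P submod_minus by metis
    then have "\<forall>z\<in>{x, y}. ?f z \<in> P z" using u(1) by auto
    then have "?f x = 0"
      using indep[of "{x, y}" ?f 0] xy submod_zero[OF T(1)] by simp
    then show False using u(2) by simp
  qed
  have F_sub: "submod (?F i) \<and> ?F i \<subseteq> NM" if i: "i \<in> ?J" for i
  proof (cases i)
    case (Some Q)
    then obtain x where "x \<in> I" "Q = P x" using i by blast
    then show ?thesis using P[of x] Some by simp
  qed (simp add: T)
  have mem: "h i \<in> NM" if h: "h \<in> (\<Pi>\<^sub>E i\<in>?J. ?F i)" and i: "i \<in> ?J" for h i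
    using PiE_mem[OF h i] F_sub[OF i] by blast
  have total: "gfinprod (add_monoid (KM NM)) h ?J = (\<Sum>x\<in>{x \<in> I. h (Some (P x)) \<noteq> 0}. h (Some (P x))) + h None"
    "finite {x \<in> I. h (Some (P x)) \<noteq> 0}"
    if h: "h \<in> (\<Pi>\<^sub>E i\<in>?J. ?F i)" and fin: "finite {i \<in> ?J. h i \<noteq> 0}" for h
  proof -
    let ?A = "{x \<in> I. h (Some (P x)) \<noteq> 0}"
    have injA: "inj_on (\<lambda>x. Some (P x)) ?A" using inj by (auto simp: inj_on_def)
    have img: "(\<lambda>x. Some (P x)) ` ?A = {i \<in> ?J. h i \<noteq> 0} - {None}" by auto
    have "finite ((\<lambda>x. Some (P x)) ` ?A)" unfolding img using fin by simp
    then show finA: "finite ?A" using injA by (rule finite_imageD)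
    have "gfinprod (add_monoid (KM NM)) h ?J = sum h {i \<in> ?J. h i \<noteq> 0}"
      by (rule gfinprod_KM[OF NM mem[OF h] fin])
    also have "\<dots> = sum h (insert None ((\<lambda>x. Some (P x)) ` ?A))"
      unfolding img using fin by (intro sum.mono_neutral_left) auto
    also have "\<dots> = h None + sum h ((\<lambda>x. Some (P x)) ` ?A)"
      using finA by (subst sum.insert) auto
    also have "sum h ((\<lambda>x. Some (P x)) ` ?A) = (\<Sum>x\<in>?A. h (Some (P x)))"
      using injA by (simp add: sum.reindex)
    finally show "gfinprod (add_monoid (KM NM)) h ?J = (\<Sum>x\<in>?A. h (Some (P x))) + h None"
      by (simp add: add.commute)
  qed
  have "internal_direct_sum R (KM NM) ?J ?F"
  proof (rule internal_direct_sumI)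
    show "abelian_group (KM NM)" using module_KM[OF NM] by (rule module.axioms(2))
    fix i assume "i \<in> ?J"
    then show "submodule (?F i) R (KM NM)"
      unfolding submodule_KM_iff[OF NM] by (rule F_sub)
  next
    fix l assume "l \<in> carrier (KM NM)"
    then have "l \<in> NM" by (simp add: KM_simps)
    from span[OF this] obtain F f t where f: "finite F" "F \<subseteq> I" "\<forall>x\<in>F. f x \<in> P x" "t \<in> T" "l = sum f F + t"
      by blast
    define f' where "f' x = (if x \<in> F then f x else 0)" for x
    define h where "h i = (if i \<in> ?J then case i of None \<Rightarrow> t | Some Q \<Rightarrow> f' (the_inv_into I P Q) else undefined)" for i
    have hP: "h (Some (P x)) = f' x" if "x \<in> I" for x
      using that by (simp add: h_def the_inv_into_f_f[OF inj])
    have f'P: "f' x \<in> P x" if "x \<in> I" for x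
      using that f(3) P submod_zero by (auto simp: f'_def)
    have h: "h \<in> (\<Pi>\<^sub>E i\<in>?J. ?F i)"
    proof (rule PiE_I)
      fix i assume "i \<in> ?J"
      then show "h i \<in> ?F i" using f(4) hP f'P by (auto simp: h_def)
    qed (auto simp: h_def)
    have "{i \<in> ?J. h i \<noteq> 0} \<subseteq> insert None ((\<lambda>x. Some (P x)) ` F)"
      using hP by (auto simp: f'_def split: if_splits)
    then have fin: "finite {i \<in> ?J. h i \<noteq> 0}" using f(1) by (auto intro: finite_subset)
    have "(\<Sum>x\<in>{x \<in> I. h (Some (P x)) \<noteq> 0}. h (Some (P x))) = sum f F"
      using f(1,2) hP by (intro sum.mono_neutral_cong_left) (auto simp: f'_def split: if_splits)
    moreover have "h None = t" by (simp add: h_def)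
    ultimately have "gfinprod (add_monoid (KM NM)) h ?J = l"
      using total(1)[OF h fin] f(5) by simp
    then show "\<exists>h\<in>(\<Pi>\<^sub>E i\<in>?J. ?F i). finite {i \<in> ?J. h i \<noteq> \<zero>\<^bsub>KM NM\<^esub>} \<and>
      gfinprod (add_monoid (KM NM)) h ?J = l"
      unfolding KM_simps using h fin by blast
  next
    fix h assume h: "h \<in> (\<Pi>\<^sub>E i\<in>?J. ?F i)" and fin: "finite {i \<in> ?J. h i \<noteq> \<zero>\<^bsub>KM NM\<^esub>}"
      and 0: "gfinprod (add_monoid (KM NM)) h ?J = \<zero>\<^bsub>KM NM\<^esub>"
    have fin': "finite {i \<in> ?J. h i \<noteq> 0}" using fin unfolding KM_simps .
    let ?A = "{x \<in> I. h (Some (P x)) \<noteq> 0}"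
    have "h None = 0 \<and> (\<forall>x\<in>?A. h (Some (P x)) = 0)"
    proof (rule indep)
      show "finite ?A" by (rule total(2)[OF h fin'])
      show "\<forall>x\<in>?A. h (Some (P x)) \<in> P x" using PiE_mem[OF h, of "Some (P x)" for x] by auto
      show "h None \<in> T" using PiE_mem[OF h, of None] by simp
      show "(\<Sum>x\<in>?A. h (Some (P x))) + h None = 0"
        using total(1)[OF h fin'] 0 unfolding KM_simps by metis
    qed auto
    then show "\<forall>i\<in>?J. h i = \<zero>\<^bsub>KM NM\<^esub>" unfolding KM_simps by auto
  qed
  then show ?thesis by (simp only: KM_NM)
qed

end

theorem theorem1p2:
  fixes p :: nat
    and C :: "('c, 'y) monoid_scheme"
    and \<alpha> :: 'c
    and M :: "('c \<Rightarrow>\<^sub>0 int, 'm, 'z) module_scheme"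
  assumes "Factorial_Ring.prime p"
    and "group C"
    and "order C = p"
    and "\<alpha> \<in> carrier C"
    and "carrier C = generate C {\<alpha>}"
    and "module (group_ring C) M"
  shows "\<exists>(\<P> :: ('m \<Rightarrow>\<^sub>0 int) set set) T.
    (\<forall>P\<in>\<P>. finitely_generated_module (group_ring C) ((kernel_module M)\<lparr>carrier := P\<rparr>) \<and>
            projective_module (group_ring C) ((kernel_module M)\<lparr>carrier := P\<rparr>)) \<and>
    trivial_module \<alpha> ((kernel_module M)\<lparr>carrier := T\<rparr>) \<and>
    internal_direct_sum (group_ring C) (kernel_module M)
      (insert None (Some ` \<P>)) (case_option T id)"
proof -
  interpret prime_cyclic_module p C \<alpha> M
    by (rule prime_cyclic_module.intro[OF assms])
  obtain r :: "'m rel" where r: "well_order_on UNIV r" using well_order_on by blast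
  define lt where "lt x y \<longleftrightarrow> (x, y) \<in> r - Id" for x y
  have lin: "linear_order r" and wf: "wf (r - Id)" using r by (auto simp: well_order_on_def)
  have trans: "trans r" and antisym: "antisym r" and total: "total r"
    using lin by (auto simp: linear_order_on_def partial_order_on_def preorder_on_def)
  interpret D: ordered_H1_module sp p lt NM
  proof
    have "{(x, y). lt x y} = r - Id" by (auto simp: lt_def)
    then show "wfp lt" using wf by (simp add: wfp_def)
    show "lt x z" if "lt x y" "lt y z" for x y z
      using that trans antisym unfolding lt_def by (auto dest: transD antisymD)
    show "lt x y \<or> lt y x" if "x \<noteq> y" for x y
      using that total by (auto simp: lt_def total_on_def)
    show "submod NM" by (rule submod_NM)
    show "\<exists>l'\<in>NM. l = act lam l'" if "l \<in> NM" "act nrm l = 0" for l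
      using that by (rule NM_cohomology_vanishes)
  qed
  obtain I :: "'m set" and P T where dec: "direct_decomposition NM I P T"
    using D.direct_decomposition_exists by blast
  have P: "submod Q \<and> Q \<subseteq> NM \<and> dual_basis Q" if "Q \<in> P ` I" for Q
    using direct_decompositionD(1)[OF dec] that by auto
  have "NM \<subseteq> ZM" by (auto simp: NM_def)
  then have "finitely_generated_module R (KM Q) \<and> projective_module R (KM Q)" if "Q \<in> P ` I" for Q
    using P[OF that] finitely_generated_KM projective_KM by blast
  moreover have "trivial_module \<alpha> (KM T)"
    using direct_decompositionD(3,4)[OF dec] sm_alpha by (auto simp: trivial_module_def KM_simps NM_def subset_iff)
  moreover have "internal_direct_sum R (kernel_module M) (insert None (Some ` P ` I)) (case_option T id)"
    by (rule internal_direct_sum_kernel_module[OF dec])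
  ultimately show ?thesis by blast
qed

end
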